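(* Let $(X,\sigma_X)$ be an irreducible one-sided shift of finite type, $(Y,\sigma_Y)$ a subshift and $\pi:(X,\sigma_X)\to(Y,\sigma_Y)$ a (one-block) factor map. Let $\alpha>0$. For each $n\in\mathbb N$ define $\phi_n:Y\to\mathbb R$ by $\phi_n(y)=\log\big(|\pi^{-1}[y_1\cdots y_n]|^{1/(\alpha+1)}\big)$ and let $\Phi=\{\phi_n\}_{n=1}^\infty$. Then $$\sup_{\mu\in M(X,\sigma_X)}\{h_\mu(\sigma_X)+\alpha h_{\pi\mu}(\sigma_Y)\}=(\alpha+1)\sup_{m\in M(Y,\sigma_Y)}\Big\{h_m(\sigma_Y)+\lim_{n\to\infty}\frac1n\int\phi_n\,dm\Big\}$$ $$=(\alpha+1)\sup_{\mu\in M(X,\sigma_X)}\Big\{h_\mu(\sigma_X)-\lim_{n\to\infty}\frac1n\int\alpha\,\phi_n\circ\pi\,d\mu\Big\}.$$ There exists a $\sigma_X$-invariant ergodic Borel probability measure on $X$ attaining the first supremum. Let $K_\alpha$ be the collection of all measures in $M(X,\sigma_X)$ attaining the first supremum. Then $\mu\in K_\alpha$ if and only if (i) $\pi\mu$ is an equilibrium state for $\Phi$ and (ii) $\mu$ is a measure of maximal relative entropy over $\pi\mu$.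
   Context: A (one-sided) subshift $(X,\sigma_X)$ is a closed shift-invariant subset $X\subseteq\{1,\dots,k\}^{\mathbb N}$ with the shift $\sigma_X$. A factor map $\pi$ is a continuous surjection with $\pi\circ\sigma_X=\sigma_Y\circ\pi$; it is one-block if the $i$-th coordinate of $\pi(x)$ depends only on $x_i$. $M(X,\sigma_X)$ is the set of $\sigma_X$-invariant Borel probability measures, $h_\mu$ is entropy, and $\pi\mu$ is the push-forward. $|\pi^{-1}[y_1\cdots y_n]|$ denotes the number of cylinders $[x_1\cdots x_n]$ in $X$ with $\pi([x_1\cdots x_n])\subseteq[y_1\cdots y_n]$, i.e. the number of words of length $n$ occurring in $X$ that map to $y_1\cdots y_n$. An equilibrium state for $\Phi=\{\phi_n\}$ (a subadditive sequence: $\phi_{n+m}\le\phi_n+\phi_m\circ\sigma_Y^n$) is an $m\in M(Y,\sigma_Y)$ attaining $\sup_{\nu\in M(Y,\sigma_Y)}\{h_\nu(\sigma_Y)+\lim_{n\to\infty}\frac1n\int\phi_n\,d\nu\}$. A measure $\mu\in M(X,\sigma_X)$ is a measure of maximal relative entropy over $m\in M(Y,\sigma_Y)$ if $\pi\mu=m$ and $h_\mu(\sigma_X)=\sup\{h_{\bar\mu}(\sigma_X):\bar\mu\in M(X,\sigma_X),\ \pi\bar\mu=m\}$. *)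

theory Defs
  imports "HOL-Probability.Probability"
begin

text \<open>
  Sequences have type \<^typ>\<open>nat \<Rightarrow> nat\<close>, and the coordinate written $x_i$ with $i \geq 1$ is
  \<open>x (i - 1)\<close>. The library topology on this type is the product topology over discrete
  \<^typ>\<open>nat\<close>, so \<^const>\<open>closed\<close>, \<^const>\<open>continuous_on\<close> and \<^const>\<open>borel\<close> have their usual
  meaning for subsets of $\{1,\dots,k\}^{\mathbb N}$.
\<close>

definition shift :: "(nat \<Rightarrow> nat) \<Rightarrow> nat \<Rightarrow> nat" where
  "shift x = (\<lambda>i. x (Suc i))"

definition full_shift :: "nat \<Rightarrow> (nat \<Rightarrow> nat) set" where
  "full_shift k = {x. \<forall>i. x i \<in> {1..k}}"

definition subshift :: "nat \<Rightarrow> (nat \<Rightarrow> nat) set \<Rightarrow> bool" where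
  "subshift k X \<longleftrightarrow> X \<subseteq> full_shift k \<and> closed X \<and> shift ` X \<subseteq> X"

definition language :: "(nat \<Rightarrow> nat) set \<Rightarrow> nat list set" where
  "language X = {map x [i..<i + n] | x i n. x \<in> X}"

definition cylinder :: "(nat \<Rightarrow> nat) set \<Rightarrow> nat list \<Rightarrow> (nat \<Rightarrow> nat) set" where
  "cylinder X u = {x \<in> X. map x [0..<length u] = u}"

definition shift_of_finite_type :: "nat \<Rightarrow> (nat \<Rightarrow> nat) set \<Rightarrow> bool" where
  "shift_of_finite_type k X \<longleftrightarrow> subshift k X \<and>
     (\<exists>F. finite F \<and>
       X = {x \<in> full_shift k. \<forall>w\<in>F. \<forall>i. map x [i..<i + length w] \<noteq> w})"

text \<open>Irreducible shifts are nonempty by convention; the word condition holds vacuously for the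
  empty set.\<close>

definition irreducible_shift :: "(nat \<Rightarrow> nat) set \<Rightarrow> bool" where
  "irreducible_shift X \<longleftrightarrow> X \<noteq> {} \<and>
     (\<forall>u\<in>language X. \<forall>v\<in>language X. \<exists>w\<in>language X. u @ w @ v \<in> language X)"

definition factor_map ::
  "(nat \<Rightarrow> nat) set \<Rightarrow> (nat \<Rightarrow> nat) set \<Rightarrow> ((nat \<Rightarrow> nat) \<Rightarrow> nat \<Rightarrow> nat) \<Rightarrow> bool" where
  "factor_map X Y \<pi> \<longleftrightarrow> continuous_on X \<pi> \<and> \<pi> ` X = Y \<and>
     (\<forall>x\<in>X. \<pi> (shift x) = shift (\<pi> x))"

definition one_block ::
  "(nat \<Rightarrow> nat) set \<Rightarrow> ((nat \<Rightarrow> nat) \<Rightarrow> nat \<Rightarrow> nat) \<Rightarrow> bool" where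
  "one_block X \<pi> \<longleftrightarrow> (\<forall>i. \<forall>x\<in>X. \<forall>x'\<in>X. x i = x' i \<longrightarrow> \<pi> x i = \<pi> x' i)"

text \<open>Distinct words occurring in a shift-invariant set have distinct, nonempty cylinders, so
  the cylinders of length \<open>n\<close> are counted through their words.\<close>

definition preimage_count ::
  "(nat \<Rightarrow> nat) set \<Rightarrow> (nat \<Rightarrow> nat) set \<Rightarrow> ((nat \<Rightarrow> nat) \<Rightarrow> nat \<Rightarrow> nat) \<Rightarrow> nat list \<Rightarrow> nat" where
  "preimage_count X Y \<pi> v =
     card {u \<in> language X. length u = length v \<and> \<pi> ` cylinder X u \<subseteq> cylinder Y v}"

definition invariant_measures :: "(nat \<Rightarrow> nat) set \<Rightarrow> (nat \<Rightarrow> nat) measure set" where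
  "invariant_measures X =
     {\<mu>. sets \<mu> = sets (restrict_space borel X) \<and> prob_space \<mu> \<and> distr \<mu> \<mu> shift = \<mu>}"

definition ergodic :: "(nat \<Rightarrow> nat) measure \<Rightarrow> bool" where
  "ergodic \<mu> \<longleftrightarrow>
     (\<forall>A\<in>sets \<mu>. shift -` A \<inter> space \<mu> = A \<longrightarrow> measure \<mu> A = 0 \<or> measure \<mu> A = 1)"

definition push_forward ::
  "(nat \<Rightarrow> nat) set \<Rightarrow> ((nat \<Rightarrow> nat) \<Rightarrow> nat \<Rightarrow> nat) \<Rightarrow> (nat \<Rightarrow> nat) measure
    \<Rightarrow> (nat \<Rightarrow> nat) measure" where
  "push_forward Y \<pi> \<mu> = distr \<mu> (restrict_space borel Y) \<pi>"

subsection \<open>Measure-theoretic (Kolmogorov--Sinai) entropy\<close>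

definition finite_partitions :: "'a measure \<Rightarrow> 'a set set set" where
  "finite_partitions M = {P. finite P \<and> P \<subseteq> sets M \<and> partition_on (space M) P}"

text \<open>The join of \<open>P\<close>, \<open>T\<^sup>-\<^sup>1 P\<close>, \dots, \<open>T\<^sup>-\<^sup>(\<^sup>n\<^sup>-\<^sup>1\<^sup>) P\<close>.\<close>

definition iterated_join :: "'a measure \<Rightarrow> ('a \<Rightarrow> 'a) \<Rightarrow> 'a set set \<Rightarrow> nat \<Rightarrow> 'a set set" where
  "iterated_join M T P n =
     {{x \<in> space M. \<forall>i<n. (T ^^ i) x \<in> A i} | A. \<forall>i<n. A i \<in> P} - {{}}"

text \<open>Since \<open>ln 0 = 0\<close>, null atoms contribute \<open>0\<close>.\<close>

definition partition_entropy :: "'a measure \<Rightarrow> 'a set set \<Rightarrow> real" where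
  "partition_entropy M P = - (\<Sum>A\<in>P. measure M A * ln (measure M A))"

definition entropy_wrt :: "'a measure \<Rightarrow> ('a \<Rightarrow> 'a) \<Rightarrow> 'a set set \<Rightarrow> real" where
  "entropy_wrt M T P = lim (\<lambda>n. partition_entropy M (iterated_join M T P n) / real n)"

definition ks_entropy :: "'a measure \<Rightarrow> ('a \<Rightarrow> 'a) \<Rightarrow> ereal" where
  "ks_entropy M T = (SUP P\<in>finite_partitions M. ereal (entropy_wrt M T P))"

abbreviation shift_entropy :: "(nat \<Rightarrow> nat) measure \<Rightarrow> ereal" where
  "shift_entropy \<mu> \<equiv> ks_entropy \<mu> shift"

subsection \<open>Equilibrium states and relative entropy\<close>

text \<open>Taken in \<^typ>\<open>ereal\<close>: for a subadditive sequence of bounded measurable functions and an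
  invariant \<open>\<mu>\<close> the limit exists by Fekete's lemma, but it may be \<open>-\<infinity>\<close>.\<close>

definition limit_average :: "(nat \<Rightarrow> (nat \<Rightarrow> nat) \<Rightarrow> real) \<Rightarrow> (nat \<Rightarrow> nat) measure \<Rightarrow> ereal" where
  "limit_average \<Phi> \<mu> = lim (\<lambda>n. ereal ((1 / real n) * (\<integral>x. \<Phi> n x \<partial>\<mu>)))"

definition equilibrium_state ::
  "(nat \<Rightarrow> nat) set \<Rightarrow> (nat \<Rightarrow> (nat \<Rightarrow> nat) \<Rightarrow> real) \<Rightarrow> (nat \<Rightarrow> nat) measure \<Rightarrow> bool" where
  "equilibrium_state Y \<Phi> m \<longleftrightarrow> m \<in> invariant_measures Y \<and>
     shift_entropy m + limit_average \<Phi> m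
       = (SUP \<nu>\<in>invariant_measures Y. shift_entropy \<nu> + limit_average \<Phi> \<nu>)"

definition maximal_relative_entropy ::
  "(nat \<Rightarrow> nat) set \<Rightarrow> (nat \<Rightarrow> nat) set \<Rightarrow> ((nat \<Rightarrow> nat) \<Rightarrow> nat \<Rightarrow> nat) \<Rightarrow> (nat \<Rightarrow> nat) measure
    \<Rightarrow> (nat \<Rightarrow> nat) measure \<Rightarrow> bool" where
  "maximal_relative_entropy X Y \<pi> m \<mu> \<longleftrightarrow>
     m \<in> invariant_measures Y \<and> \<mu> \<in> invariant_measures X \<and> push_forward Y \<pi> \<mu> = m \<and>
     shift_entropy \<mu>
       = (SUP \<mu>'\<in>{\<mu>' \<in> invariant_measures X. push_forward Y \<pi> \<mu>' = m}. shift_entropy \<mu>')"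

definition potential ::
  "(nat \<Rightarrow> nat) set \<Rightarrow> (nat \<Rightarrow> nat) set \<Rightarrow> ((nat \<Rightarrow> nat) \<Rightarrow> nat \<Rightarrow> nat) \<Rightarrow> real
    \<Rightarrow> nat \<Rightarrow> (nat \<Rightarrow> nat) \<Rightarrow> real" where
  "potential X Y \<pi> \<alpha> n y =
     ln (real (preimage_count X Y \<pi> (map y [0..<n])) powr (1 / (\<alpha> + 1)))"

definition weighted_entropy ::
  "(nat \<Rightarrow> nat) set \<Rightarrow> ((nat \<Rightarrow> nat) \<Rightarrow> nat \<Rightarrow> nat) \<Rightarrow> real \<Rightarrow> (nat \<Rightarrow> nat) measure \<Rightarrow> ereal" where
  "weighted_entropy Y \<pi> \<alpha> \<mu> =
     shift_entropy \<mu> + ereal \<alpha> * shift_entropy (push_forward Y \<pi> \<mu>)"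

definition weighted_maximizers ::
  "(nat \<Rightarrow> nat) set \<Rightarrow> (nat \<Rightarrow> nat) set \<Rightarrow> ((nat \<Rightarrow> nat) \<Rightarrow> nat \<Rightarrow> nat) \<Rightarrow> real
    \<Rightarrow> (nat \<Rightarrow> nat) measure set" where
  "weighted_maximizers X Y \<pi> \<alpha> =
     {\<mu> \<in> invariant_measures X.
        weighted_entropy Y \<pi> \<alpha> \<mu>
          = (SUP \<mu>'\<in>invariant_measures X. weighted_entropy Y \<pi> \<alpha> \<mu>')}"

end

theory Submission
  imports Defs
begin

text \<open>
  Everything reduces to the relative variational principle
  \[ \max \{h_\mu : \pi\mu = m\} = h_m + \lim \frac1n \int \log |\pi^{-1}[y_1 \cdots y_n]| \, dm, \]
  valid for every subshift \<open>X\<close>. For the upper bound, compare the distribution of \<open>n\<close>-words under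
  \<open>\<mu>\<close> (by Gibbs' inequality) with the one that chooses an \<open>m\<close>-random word and then, uniformly, one
  of its preimages. For the lower bound, realize the latter distribution by point masses in \<open>X\<close> and
  average along the orbits as in Misiurewicz's proof of the variational principle; any limit
  automatically projects to \<open>m\<close>. The two formulas for the supremum and the description of the
  maximizers are then arithmetic.

  An invariant measure is encoded by its cylinder probabilities, so that a maximizer comes from
  compactness of a set of functions on words. Maximizing the cylinder probabilities one after the
  other singles out an extreme point of the set of maximizers, and since the functional is affine this
  point is ergodic.
\<close>

section \<open>Entropy of finitely valued random variables\<close>

text \<open>Two facts turn the theorem into statements about finite words. The partition by the
  first symbol generates, so entropy, a supremum over all finite partitions, is one limit of block
  entropies; and by subadditivity this limit is also an infimum. The infimum form makes maximizers
  exist: entropy at least \<open>s\<close> is a family of closed conditions on word probabilities,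
  one for each block length.

  With g the limit of the averaged logarithm of the fibre counts, the relative principle reads
  h_\<mu> + \<alpha> h_m \<le> (\<alpha> + 1) h_m + g whenever \<pi>\<mu> = m, with equality exactly
  for maximal relative entropy. The exponent 1 / (\<alpha> + 1) in the potential makes the right
  side \<alpha> + 1 times a pressure.

  The obstacle in the lower bound is that the uniform lifts of m to words of length n are in general
  neither stationary nor consistent for different n. Averaging repairs stationarity in the limit. It
  does not spoil the projection because m is stationary: every window inside the first n symbols
  already projects to the right law, and only the few windows reaching beyond n are
  neglected.\<close>

definition pr :: "'a measure \<Rightarrow> ('a \<Rightarrow> 'b) \<Rightarrow> 'b \<Rightarrow> real" where
  "pr M X v = measure M {x \<in> space M. X x = v}"

text \<open>Entropy is attached to a random variable instead of a partition: joins become pairs and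
  lists of values, and coarsening becomes composition with a function. Values of probability 0
  contribute 0.\<close>

definition rv_entropy :: "'a measure \<Rightarrow> ('a \<Rightarrow> 'b) \<Rightarrow> real" where
  "rv_entropy M X = - (\<Sum>v\<in>X ` space M. pr M X v * ln (pr M X v))"

lemma pr_nonneg [simp]: "0 \<le> pr M X v"
  by (simp add: pr_def)

lemma pr_eq_0: "v \<notin> X ` space M \<Longrightarrow> pr M X v = 0"
proof -
  assume "v \<notin> X ` space M"
  then have "{x \<in> space M. X x = v} = {}" by auto
  then show ?thesis unfolding pr_def by (simp only: measure_empty)
qed

lemma rv_entropy_superset:
  assumes "finite S" "X ` space M \<subseteq> S"
  shows "rv_entropy M X = - (\<Sum>v\<in>S. pr M X v * ln (pr M X v))"
  unfolding rv_entropy_def using assms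
  by (intro arg_cong[where f=uminus] sum.mono_neutral_left) (auto simp: pr_eq_0)

lemma pr_cong:
  assumes "\<And>x. x \<in> space M \<Longrightarrow> X x = Z x"
  shows "pr M X = pr M Z"
proof
  fix v show "pr M X v = pr M Z v"
    unfolding pr_def using assms by (intro arg_cong[where f="measure M"]) auto
qed

lemma rv_entropy_cong:
  assumes "\<And>x. x \<in> space M \<Longrightarrow> X x = Z x"
  shows "rv_entropy M X = rv_entropy M Z"
proof -
  have "X ` space M = Z ` space M" using assms by (auto simp: image_iff)
  then show ?thesis using pr_cong[of M X Z, OF assms] by (simp add: rv_entropy_def)
qed

lemma simple_function_sets:
  assumes "simple_function M X"
  shows "{x \<in> space M. X x = v} \<in> sets M"
proof -
  have "X -` {v} \<inter> space M \<in> sets M"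
    using simple_functionD(2)[OF assms] by auto
  moreover have "X -` {v} \<inter> space M = {x \<in> space M. X x = v}" by auto
  ultimately show ?thesis by simp
qed

lemma sum_pr_measure:
  assumes "prob_space M" "simple_function M X" "finite S"
  shows "(\<Sum>v\<in>S. pr M X v) = measure M {x \<in> space M. X x \<in> S}"
proof -
  interpret prob_space M by fact
  have "{x \<in> space M. X x \<in> S} = (\<Union>v\<in>S. {x \<in> space M. X x = v})" by auto
  moreover have "measure M (\<Union>v\<in>S. {x \<in> space M. X x = v})
      = (\<Sum>v\<in>S. measure M {x \<in> space M. X x = v})"
    using assms simple_function_sets[OF assms(2)]
    by (intro finite_measure_finite_Union) (auto simp: disjoint_family_on_def)
  ultimately show ?thesis by (simp add: pr_def)
qed

lemma sum_pr:
  assumes "prob_space M" "simple_function M X" "finite S" "X ` space M \<subseteq> S"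
  shows "(\<Sum>v\<in>S. pr M X v) = 1"
proof -
  have "{x \<in> space M. X x \<in> S} = space M" using assms(4) by auto
  then show ?thesis
    using sum_pr_measure[OF assms(1-3)] prob_space.prob_space[OF assms(1)] by simp
qed

lemma pr_le_1: "prob_space M \<Longrightarrow> pr M X v \<le> 1"
  by (simp add: pr_def prob_space.prob_le_1)

lemma pr_compose_sum:
  assumes "prob_space M" "simple_function M X" "finite S" "X ` space M \<subseteq> S"
  shows "pr M (\<lambda>x. f (X x)) w = (\<Sum>v\<in>{v\<in>S. f v = w}. pr M X v)"
proof -
  have "{x \<in> space M. f (X x) = w} = {x \<in> space M. X x \<in> {v\<in>S. f v = w}}"
    using assms(4) by auto
  then show ?thesis
    using sum_pr_measure[OF assms(1,2), of "{v\<in>S. f v = w}"] assms(3) by (simp add: pr_def)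
qed

text \<open>Termwise this is ln t \<le> t - 1 at t = q / p. The positivity hypothesis rules out a
  point with p > 0 = q: its true contribution is infinite, but \<open>ln 0 = 0\<close> would make it
  vanish. Subadditivity, the cardinality bound, concavity and the relative upper bound all come from
  a suitable choice of q.\<close>

lemma gibbs:
  fixes p q :: "'b \<Rightarrow> real"
  assumes "finite S" "\<And>v. v \<in> S \<Longrightarrow> 0 \<le> p v" "\<And>v. v \<in> S \<Longrightarrow> 0 \<le> q v"
    and "\<And>v. v \<in> S \<Longrightarrow> p v > 0 \<Longrightarrow> q v > 0"
    and "(\<Sum>v\<in>S. q v) \<le> (\<Sum>v\<in>S. p v)"
  shows "- (\<Sum>v\<in>S. p v * ln (p v)) \<le> - (\<Sum>v\<in>S. p v * ln (q v))"
proof -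
  have "p v * ln (q v) - p v * ln (p v) \<le> q v - p v" if v: "v \<in> S" for v
  proof (cases "p v = 0")
    case True then show ?thesis using assms(3)[OF v] by simp
  next
    case False
    then have pp: "p v > 0" "q v > 0" using assms(2)[OF v] assms(4)[OF v] by auto
    then have "ln (q v) - ln (p v) = ln (q v / p v)" by (simp add: ln_div)
    also have "\<dots> \<le> q v / p v - 1" using pp by (intro ln_le_minus_one) auto
    finally have "p v * (ln (q v) - ln (p v)) \<le> p v * (q v / p v - 1)"
      using pp by (intro mult_left_mono) auto
    then show ?thesis using pp by (simp add: algebra_simps)
  qed
  then have "(\<Sum>v\<in>S. p v * ln (q v) - p v * ln (p v)) \<le> (\<Sum>v\<in>S. q v - p v)"
    by (rule sum_mono)
  then show ?thesis using assms(5) by (simp add: sum_subtractf)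
qed

lemma sum_fibres:
  fixes g :: "'a \<Rightarrow> real"
  assumes "finite S" "finite T" "f ` S \<subseteq> T"
  shows "(\<Sum>x\<in>S. h (f x) * g x) = (\<Sum>y\<in>T. h y * (\<Sum>x\<in>{x\<in>S. f x = y}. g x))"
proof -
  have "(\<Sum>x\<in>S. h (f x) * g x) = (\<Sum>y\<in>T. \<Sum>x\<in>{x\<in>S. f x = y}. h (f x) * g x)"
    using sum.group[OF assms, of "\<lambda>x. h (f x) * g x"] by simp
  also have "\<dots> = (\<Sum>y\<in>T. h y * (\<Sum>x\<in>{x\<in>S. f x = y}. g x))"
    by (intro sum.cong refl) (auto simp: sum_distrib_left)
  finally show ?thesis .
qed

text \<open>A value of f (X) is at least as likely as each value of X over it, so replacing the
  probability inside the logarithm by that of the image value can only lower the entropy; grouping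
  by images then leaves the entropy of f (X).\<close>

lemma rv_entropy_compose_le:
  assumes M: "prob_space M" and X: "simple_function M X"
  shows "rv_entropy M (\<lambda>x. f (X x)) \<le> rv_entropy M X"
proof -
  let ?S = "X ` space M"
  have fin: "finite ?S" using simple_functionD(1)[OF X] .
  let ?p = "pr M X" and ?q = "pr M (\<lambda>x. f (X x))"
  have q: "?q w = (\<Sum>v\<in>{v\<in>?S. f v = w}. ?p v)" for w
    by (rule pr_compose_sum[OF M X fin]) simp
  have le: "?p v \<le> ?q (f v)" if "v \<in> ?S" for v
    unfolding q using fin that by (intro member_le_sum) auto
  have "rv_entropy M (\<lambda>x. f (X x)) = - (\<Sum>w\<in>f ` ?S. ?q w * ln (?q w))"
    using fin by (intro rv_entropy_superset) auto
  also have "(\<Sum>w\<in>f ` ?S. ?q w * ln (?q w)) = (\<Sum>w\<in>f ` ?S. ln (?q w) * (\<Sum>v\<in>{v\<in>?S. f v = w}. ?p v))"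
    by (simp add: q mult.commute)
  also have "\<dots> = (\<Sum>v\<in>?S. ln (?q (f v)) * ?p v)"
    using fin by (intro sum_fibres[symmetric]) auto
  finally have eq: "rv_entropy M (\<lambda>x. f (X x)) = - (\<Sum>v\<in>?S. ln (?q (f v)) * ?p v)" .
  have "(\<Sum>v\<in>?S. ln (?q (f v)) * ?p v) \<ge> (\<Sum>v\<in>?S. ?p v * ln (?p v))"
  proof (rule sum_mono)
    fix v assume v: "v \<in> ?S"
    show "?p v * ln (?p v) \<le> ln (?q (f v)) * ?p v"
    proof (cases "?p v = 0")
      case False
      then have "?p v > 0" using pr_nonneg[of M X v] by linarith
      then have "ln (?p v) \<le> ln (?q (f v))" using le[OF v] by simp
      then show ?thesis using \<open>?p v > 0\<close> by (simp add: mult.commute mult_left_mono)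
    qed simp
  qed
  then show ?thesis unfolding eq by (simp add: rv_entropy_def)
qed

lemma rv_entropy_mono:
  assumes "prob_space M" "simple_function M X"
    and dep: "\<And>x y. x \<in> space M \<Longrightarrow> y \<in> space M \<Longrightarrow> X x = X y \<Longrightarrow> Z x = Z y"
  shows "rv_entropy M Z \<le> rv_entropy M X"
proof -
  define f where "f v = Z (SOME y. y \<in> space M \<and> X y = v)" for v
  have "f (X x) = Z x" if "x \<in> space M" for x
  proof -
    have "\<exists>y. y \<in> space M \<and> X y = X x" using that by auto
    from someI_ex[OF this] show ?thesis unfolding f_def using dep that by blast
  qed
  then have "rv_entropy M Z = rv_entropy M (\<lambda>x. f (X x))" by (intro rv_entropy_cong) simp
  then show ?thesis using rv_entropy_compose_le[OF assms(1,2)] by simp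
qed

text \<open>Gibbs against the product of the marginals, whose cross entropy splits into the two
  marginal entropies.\<close>

lemma rv_entropy_Pair_le:
  assumes M: "prob_space M" and X: "simple_function M X" and Z: "simple_function M Z"
  shows "rv_entropy M (\<lambda>x. (X x, Z x)) \<le> rv_entropy M X + rv_entropy M Z"
proof -
  let ?A = "X ` space M" and ?B = "Z ` space M"
  have fin: "finite ?A" "finite ?B" using X Z by (auto dest: simple_functionD)
  let ?p = "pr M (\<lambda>x. (X x, Z x))"
  have XZ: "simple_function M (\<lambda>x. (X x, Z x))" using X Z by (rule simple_function_Pair)
  have sub: "(\<lambda>x. (X x, Z x)) ` space M \<subseteq> ?A \<times> ?B" by auto
  have finAB: "finite (?A \<times> ?B)" using fin by simp
  have mX: "pr M X a = (\<Sum>c\<in>{c\<in>?A \<times> ?B. fst c = a}. ?p c)" for a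
    using pr_compose_sum[OF M XZ finAB sub, of fst a] by simp
  have mZ: "pr M Z b = (\<Sum>c\<in>{c\<in>?A \<times> ?B. snd c = b}. ?p c)" for b
    using pr_compose_sum[OF M XZ finAB sub, of snd b] by simp
  have pos: "pr M X (fst c) > 0 \<and> pr M Z (snd c) > 0" if "c \<in> ?A \<times> ?B" "?p c > 0" for c
  proof -
    have "?p c \<le> pr M X (fst c)" "?p c \<le> pr M Z (snd c)"
      unfolding mX mZ using finAB that by (auto intro!: member_le_sum)
    then show ?thesis using that by linarith
  qed
  have "rv_entropy M (\<lambda>x. (X x, Z x)) = - (\<Sum>c\<in>?A \<times> ?B. ?p c * ln (?p c))"
    by (rule rv_entropy_superset[OF finAB sub])
  also have "\<dots> \<le> - (\<Sum>c\<in>?A \<times> ?B. ?p c * ln (pr M X (fst c) * pr M Z (snd c)))"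
  proof (rule gibbs[OF finAB])
    have "(\<Sum>c\<in>?A \<times> ?B. pr M X (fst c) * pr M Z (snd c)) = (\<Sum>a\<in>?A. pr M X a) * (\<Sum>b\<in>?B. pr M Z b)"
      by (simp add: sum_product sum.cartesian_product case_prod_beta)
    also have "\<dots> = 1" using sum_pr[OF M X fin(1)] sum_pr[OF M Z fin(2)] by simp
    also have "\<dots> = (\<Sum>c\<in>?A \<times> ?B. ?p c)" using sum_pr[OF M XZ finAB sub] by simp
    finally show "(\<Sum>c\<in>?A \<times> ?B. pr M X (fst c) * pr M Z (snd c)) \<le> (\<Sum>c\<in>?A \<times> ?B. ?p c)" by simp
  qed (use pos in auto)
  also have "(\<Sum>c\<in>?A \<times> ?B. ?p c * ln (pr M X (fst c) * pr M Z (snd c)))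
      = (\<Sum>c\<in>?A \<times> ?B. ln (pr M X (fst c)) * ?p c) + (\<Sum>c\<in>?A \<times> ?B. ln (pr M Z (snd c)) * ?p c)"
    unfolding sum.distrib[symmetric]
  proof (rule sum.cong[OF refl])
    fix c assume c: "c \<in> ?A \<times> ?B"
    show "?p c * ln (pr M X (fst c) * pr M Z (snd c)) = ln (pr M X (fst c)) * ?p c + ln (pr M Z (snd c)) * ?p c"
    proof (cases "?p c = 0")
      case False
      then have "?p c > 0" using pr_nonneg[of M _ c] by (simp add: order_less_le)
      from pos[OF c this] show ?thesis by (simp add: ln_mult algebra_simps)
    qed simp
  qed
  also have "(\<Sum>c\<in>?A \<times> ?B. ln (pr M X (fst c)) * ?p c) = (\<Sum>a\<in>?A. ln (pr M X a) * (\<Sum>c\<in>{c\<in>?A \<times> ?B. fst c = a}. ?p c))"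
    by (rule sum_fibres[OF finAB fin(1)]) auto
  also have "(\<Sum>c\<in>?A \<times> ?B. ln (pr M Z (snd c)) * ?p c) = (\<Sum>b\<in>?B. ln (pr M Z b) * (\<Sum>c\<in>{c\<in>?A \<times> ?B. snd c = b}. ?p c))"
    by (rule sum_fibres[OF finAB fin(2)]) auto
  finally show ?thesis by (simp add: rv_entropy_def mX[symmetric] mZ[symmetric] mult.commute)
qed

lemma rv_entropy_nonneg:
  assumes "prob_space M" shows "0 \<le> rv_entropy M X"
proof -
  have "pr M X v * ln (pr M X v) \<le> 0" for v
  proof (cases "pr M X v = 0")
    case False
    then have "pr M X v > 0" using pr_nonneg[of M X v] by linarith
    then have "ln (pr M X v) \<le> 0" using pr_le_1[OF assms, of X v] by simp
    then show ?thesis by (simp add: mult_nonneg_nonpos)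
  qed simp
  then show ?thesis by (simp add: rv_entropy_def sum_nonpos)
qed

text \<open>Gibbs against the uniform distribution on \<open>S\<close>.\<close>

lemma rv_entropy_le_card:
  assumes M: "prob_space M" and X: "simple_function M X" and "finite S" "X ` space M \<subseteq> S"
  shows "rv_entropy M X \<le> ln (real (card S))"
proof -
  have ne: "S \<noteq> {}" using assms prob_space.not_empty[OF M] by auto
  then have c: "real (card S) > 0" using assms by (simp add: card_gt_0_iff)
  have "rv_entropy M X = - (\<Sum>v\<in>S. pr M X v * ln (pr M X v))"
    by (rule rv_entropy_superset) fact+
  also have "\<dots> \<le> - (\<Sum>v\<in>S. pr M X v * ln (1 / real (card S)))"
    using c sum_pr[OF assms] by (intro gibbs) (auto simp: \<open>finite S\<close>)
  also have "\<dots> = ln (real (card S))"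
    using c sum_pr[OF assms] by (simp add: ln_div sum_distrib_right[symmetric] sum_negf)
  finally show ?thesis .
qed

text \<open>Nonnegativity makes the infimum of a n / n a real number. Besides convergence the lemma
  keeps the bound by each single a n / n, which later yields upper semicontinuity of
  entropy.\<close>

lemma fekete:
  fixes a :: "nat \<Rightarrow> real"
  assumes sub: "\<And>m n. a (m + n) \<le> a m + a n" and nonneg: "\<And>n. 0 \<le> a n"
  obtains l where "(\<lambda>n. a n / real n) \<longlonglongrightarrow> l" "\<And>n. n > 0 \<Longrightarrow> l \<le> a n / real n"
proof -
  define l where "l = (INF n\<in>{1..}. a n / real n)"
  have bdd: "bdd_below ((\<lambda>n. a n / real n) ` {1..})"
    by (rule bdd_belowI[where m=0]) (auto simp: nonneg)
  have le: "l \<le> a n / real n" if "n > 0" for n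
    unfolding l_def using that by (intro cINF_lower[OF bdd]) auto
  have mult: "a (k * q + r) \<le> real k * a q + a r" for k q r
  proof (induction k)
    case (Suc k)
    have "a (Suc k * q + r) = a (q + (k * q + r))" by (simp add: algebra_simps)
    also have "\<dots> \<le> a q + a (k * q + r)" by (rule sub)
    finally show ?case using Suc by (simp add: algebra_simps)
  qed simp
  have "(\<lambda>n. a n / real n) \<longlonglongrightarrow> l"
  proof (rule LIMSEQ_I)
    fix e :: real assume e: "e > 0"
    have "\<exists>x\<in>(\<lambda>n. a n / real n) ` {1..}. x < l + e / 2"
      using e cInf_less_iff[OF _ bdd, of "l + e/2"] unfolding l_def[symmetric] by auto
    then obtain q where "q \<in> {1..}" "a q / real q < l + e / 2" by blast
    then have q: "q > 0" "a q / real q < l + e / 2" by auto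
    define B where "B = Max (a ` {..<q})"
    have B: "a r \<le> B" if "r < q" for r unfolding B_def using that by (intro Max_ge) auto
    have B0: "0 \<le> B" using B[of 0] q nonneg[of 0] by linarith
    obtain N :: nat where N: "real N > 2 * B / e" using reals_Archimedean2 by blast
    show "\<exists>no. \<forall>n\<ge>no. norm (a n / real n - l) < e"
    proof (intro exI[of _ "Suc N"] allI impI)
      fix n assume n: "Suc N \<le> n"
      then have n0: "real n > 0" by simp
      have "a n = a (n div q * q + n mod q)" by simp
      also have "\<dots> \<le> real (n div q) * a q + B"
        using mult[of "n div q" q "n mod q"] B[of "n mod q"] q by simp
      also have "real (n div q) * a q = real (n div q * q) * (a q / real q)" using q by simp
      also have "\<dots> \<le> real n * (a q / real q)"
        using nonneg[of q] by (intro mult_right_mono) (auto simp: of_nat_mult[symmetric] simp del: of_nat_mult)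
      finally have "a n / real n \<le> a q / real q + B / real n"
        using n0 by (simp add: field_simps)
      moreover have "B / real n < e / 2"
      proof -
        have "2 * B / e < real n" using N n by linarith
        then show ?thesis using e n0 by (simp add: field_simps)
      qed
      ultimately have "a n / real n < l + e" using q by linarith
      moreover have "l \<le> a n / real n" using le n by simp
      ultimately show "norm (a n / real n - l) < e" by simp
    qed
  qed
  then show ?thesis using le that by blast
qed

section \<open>Entropy along orbits\<close>

lemma rv_entropy_eq_of_pr:
  assumes "finite (X ` space M)" "finite (Z ` space N)" "\<And>v. pr M X v = pr N Z v"
  shows "rv_entropy M X = rv_entropy N Z"
  using assms rv_entropy_superset[of "X ` space M \<union> Z ` space N" X M]
    rv_entropy_superset[of "X ` space M \<union> Z ` space N" Z N] by simp

lemma simple_function_map: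
  assumes "\<And>i. simple_function M (Z i)"
  shows "simple_function M (\<lambda>x. map (\<lambda>i. Z i x) is)"
proof (induction "is")
  case Nil show ?case by simp
next
  case (Cons a "is")
  from simple_function_compose2[OF assms[of a] this, of Cons] show ?case by simp
qed

text \<open>Stated for an arbitrary sequence of variables, since it serves both itineraries under an
  invariant measure and coordinates under the non-invariant measures of the block estimate.\<close>

lemma rv_entropy_block_le:
  assumes M: "prob_space M" and Z: "\<And>i. simple_function M (Z i)" and "a \<le> b" "b \<le> c"
  shows "rv_entropy M (\<lambda>x. map (\<lambda>i. Z i x) [a..<c])
    \<le> rv_entropy M (\<lambda>x. map (\<lambda>i. Z i x) [a..<b]) + rv_entropy M (\<lambda>x. map (\<lambda>i. Z i x) [b..<c])"
proof -
  let ?P = "\<lambda>x. (map (\<lambda>i. Z i x) [a..<b], map (\<lambda>i. Z i x) [b..<c])"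
  have "[a..<c] = [a..<b] @ [b..<c]"
    using assms upt_add_eq_append[of a b "c - b"] by simp
  then have "(\<lambda>x. map (\<lambda>i. Z i x) [a..<c]) = (\<lambda>x. (\<lambda>(u, v). u @ v) (?P x))" by simp
  then have "rv_entropy M (\<lambda>x. map (\<lambda>i. Z i x) [a..<c]) \<le> rv_entropy M ?P"
    using rv_entropy_compose_le[OF M simple_function_Pair[OF simple_function_map[of M Z, OF Z]
      simple_function_map[of M Z, OF Z]], of "\<lambda>(u, v). u @ v"]
    by simp
  also have "\<dots> \<le> rv_entropy M (\<lambda>x. map (\<lambda>i. Z i x) [a..<b]) + rv_entropy M (\<lambda>x. map (\<lambda>i. Z i x) [b..<c])"
    by (intro rv_entropy_Pair_le M simple_function_map[of M Z, OF Z])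
  finally show ?thesis .
qed

lemma simple_function_measurable_compose:
  assumes "simple_function N g" "f \<in> M \<rightarrow>\<^sub>M N"
  shows "simple_function M (\<lambda>x. g (f x))"
  unfolding simple_function_def
proof (intro conjI ballI)
  have "(\<lambda>x. g (f x)) ` space M \<subseteq> g ` space N" using measurable_space[OF assms(2)] by auto
  then show "finite ((\<lambda>x. g (f x)) ` space M)"
    using simple_functionD(1)[OF assms(1)] finite_subset by blast
  fix v
  have "f -` {x \<in> space N. g x = v} \<inter> space M \<in> sets M"
    using assms(2) simple_function_sets[OF assms(1)] by (rule measurable_sets)
  also have "f -` {x \<in> space N. g x = v} \<inter> space M = (\<lambda>x. g (f x)) -` {v} \<inter> space M"
    using measurable_space[OF assms(2)] by auto
  finally show "(\<lambda>x. g (f x)) -` {v} \<inter> space M \<in> sets M" .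
qed

lemma pr_distr:
  assumes "simple_function N g" "f \<in> M \<rightarrow>\<^sub>M N"
  shows "pr (distr M N f) g v = pr M (\<lambda>x. g (f x)) v"
proof -
  have "measure (distr M N f) {x \<in> space N. g x = v} = measure M (f -` {x \<in> space N. g x = v} \<inter> space M)"
    using assms(2) simple_function_sets[OF assms(1)] by (rule measure_distr)
  also have "f -` {x \<in> space N. g x = v} \<inter> space M = {x \<in> space M. g (f x) = v}"
    using measurable_space[OF assms(2)] by auto
  finally show ?thesis by (simp add: pr_def)
qed

lemma simple_function_distr_iff [simp]: "simple_function (distr M N f) g \<longleftrightarrow> simple_function N g"
  by (simp add: simple_function_def)

definition orbit_word :: "('a \<Rightarrow> 'a) \<Rightarrow> ('a \<Rightarrow> 'b) \<Rightarrow> nat \<Rightarrow> 'a \<Rightarrow> 'b list" where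
  "orbit_word T g n x = map (\<lambda>i. g ((T ^^ i) x)) [0..<n]"

lemma funpow_measurable: "T \<in> M \<rightarrow>\<^sub>M M \<Longrightarrow> T ^^ i \<in> M \<rightarrow>\<^sub>M M"
proof (induction i)
  case (Suc i)
  from measurable_comp[OF Suc.IH[OF Suc.prems] Suc.prems] show ?case by (simp add: comp_def)
qed (simp add: id_def)

lemma distr_funpow:
  assumes "T \<in> M \<rightarrow>\<^sub>M M" "distr M M T = M"
  shows "distr M M (T ^^ i) = M"
proof (induction i)
  case (Suc i)
  have "distr M M (T ^^ Suc i) = distr (distr M M (T ^^ i)) M T"
    using distr_distr[OF assms(1) funpow_measurable[OF assms(1), of i]] by simp
  then show ?case using Suc assms by (simp add: comp_def)
qed (simp add: distr_id)

lemma simple_function_orbit_word: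
  assumes "T \<in> M \<rightarrow>\<^sub>M M" "simple_function M g"
  shows "simple_function M (orbit_word T g n)"
proof -
  have "simple_function M (\<lambda>x. map (\<lambda>i. g ((T ^^ i) x)) [0..<n])"
    by (intro simple_function_map simple_function_measurable_compose[OF assms(2)] funpow_measurable assms)
  then show ?thesis by (simp add: orbit_word_def[abs_def])
qed

text \<open>Cutting the itinerary at time m leaves a second block that starts at time m; by
  invariance it has the law of the initial block of length n.\<close>

lemma orbit_entropy_subadditive:
  assumes M: "prob_space M" and T: "T \<in> M \<rightarrow>\<^sub>M M" "distr M M T = M" and g: "simple_function M g"
  shows "rv_entropy M (orbit_word T g (m + n)) \<le> rv_entropy M (orbit_word T g m) + rv_entropy M (orbit_word T g n)"
proof -
  have Z: "simple_function M (\<lambda>x. g ((T ^^ i) x))" for i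
    by (intro simple_function_measurable_compose[OF g] funpow_measurable T)
  have eq: "map (\<lambda>i. g ((T ^^ i) x)) [m..<m + n] = orbit_word T g n ((T ^^ m) x)" for x
    by (rule nth_equalityI) (simp_all add: orbit_word_def add.commute[of m] funpow_add)
  have "rv_entropy M (\<lambda>x. map (\<lambda>i. g ((T ^^ i) x)) [m..<m + n]) = rv_entropy M (orbit_word T g n)"
    unfolding eq
  proof (rule rv_entropy_eq_of_pr)
    note so = simple_function_orbit_word[OF T(1) g, of n]
    show "finite (orbit_word T g n ` space M)" using simple_functionD(1)[OF so] .
    have sc: "simple_function M (\<lambda>x. orbit_word T g n ((T ^^ m) x))"
      by (intro simple_function_measurable_compose[OF so] funpow_measurable T)
    then show "finite ((\<lambda>x. orbit_word T g n ((T ^^ m) x)) ` space M)" by (rule simple_functionD)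
    fix v
    show "pr M (\<lambda>x. orbit_word T g n ((T ^^ m) x)) v = pr M (orbit_word T g n) v"
      using pr_distr[OF so funpow_measurable[OF T(1), of m]] distr_funpow[OF T, of m] by simp
  qed
  then show ?thesis
    using rv_entropy_block_le[OF M, of "\<lambda>i x. g ((T ^^ i) x)" 0 m "m + n"] Z by (simp add: orbit_word_def[abs_def])
qed

definition orbit_entropy :: "'a measure \<Rightarrow> ('a \<Rightarrow> 'a) \<Rightarrow> ('a \<Rightarrow> 'b) \<Rightarrow> real" where
  "orbit_entropy M T g = lim (\<lambda>n. rv_entropy M (orbit_word T g n) / real n)"

lemma orbit_entropy:
  assumes "prob_space M" "T \<in> M \<rightarrow>\<^sub>M M" "distr M M T = M" "simple_function M g"
  shows "(\<lambda>n. rv_entropy M (orbit_word T g n) / real n) \<longlonglongrightarrow> orbit_entropy M T g"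
    and "n > 0 \<Longrightarrow> orbit_entropy M T g \<le> rv_entropy M (orbit_word T g n) / real n"
proof -
  obtain l where l: "(\<lambda>n. rv_entropy M (orbit_word T g n) / real n) \<longlonglongrightarrow> l"
    "\<And>n. n > 0 \<Longrightarrow> l \<le> rv_entropy M (orbit_word T g n) / real n"
    using fekete[of "\<lambda>n. rv_entropy M (orbit_word T g n)", OF orbit_entropy_subadditive[OF assms] rv_entropy_nonneg[OF assms(1)]]
    by metis
  moreover have "orbit_entropy M T g = l" unfolding orbit_entropy_def using l(1) by (rule limI)
  ultimately show "(\<lambda>n. rv_entropy M (orbit_word T g n) / real n) \<longlonglongrightarrow> orbit_entropy M T g"
    "n > 0 \<Longrightarrow> orbit_entropy M T g \<le> rv_entropy M (orbit_word T g n) / real n" by auto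
qed

section \<open>Partitions as random variables, and entropy under small errors\<close>

definition cell :: "'a set set \<Rightarrow> 'a \<Rightarrow> 'a set" where
  "cell P x = (THE A. A \<in> P \<and> x \<in> A)"

lemma cell_eqI:
  assumes "partition_on S P" "A \<in> P" "x \<in> A"
  shows "cell P x = A"
  unfolding cell_def using assms partition_onD2[OF assms(1)]
  by (intro the_equality) (auto simp: disjoint_def)

lemma cell_in:
  assumes "partition_on S P" "x \<in> S"
  shows "cell P x \<in> P" "x \<in> cell P x"
proof -
  obtain A where "A \<in> P" "x \<in> A" using partition_onD1[OF assms(1)] assms(2) by auto
  then show "cell P x \<in> P" "x \<in> cell P x" using cell_eqI[OF assms(1)] by auto
qed

lemma cell_iff:
  assumes "partition_on S P" "x \<in> S" "A \<in> P"
  shows "x \<in> A \<longleftrightarrow> cell P x = A"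
  using cell_eqI[OF assms(1,3)] cell_in[OF assms(1,2)] by auto

lemma simple_function_cell:
  assumes "P \<in> finite_partitions M"
  shows "simple_function M (cell P)"
  unfolding simple_function_def
proof (intro conjI ballI)
  have P: "finite P" "P \<subseteq> sets M" "partition_on (space M) P"
    using assms by (auto simp: finite_partitions_def)
  have "cell P ` space M \<subseteq> P" using cell_in[OF P(3)] by auto
  then show "finite (cell P ` space M)" using P finite_subset by blast
  fix A assume "A \<in> cell P ` space M"
  then have "A \<in> P" using cell_in[OF P(3)] by auto
  then have "A \<subseteq> space M" using P(2) sets.sets_into_space by auto
  then have "cell P -` {A} \<inter> space M = A"
    using cell_iff[OF P(3) _ \<open>A \<in> P\<close>] by (intro set_eqI) fastforce
  then show "cell P -` {A} \<inter> space M \<in> sets M" using \<open>A \<in> P\<close> P(2) by auto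
qed

text \<open>The atoms of the join are the level sets of the itinerary
  \<open>orbit_word T (cell P) n\<close>. Since the empty atom is discarded, distinct attained
  itineraries correspond to distinct atoms, and the sum over atoms can be reindexed.\<close>

lemma partition_entropy_iterated_join:
  assumes "P \<in> finite_partitions M" and T: "\<And>x. x \<in> space M \<Longrightarrow> T x \<in> space M"
  shows "partition_entropy M (iterated_join M T P n) = rv_entropy M (orbit_word T (cell P) n)"
proof -
  have P: "finite P" "P \<subseteq> sets M" "partition_on (space M) P"
    using assms by (auto simp: finite_partitions_def)
  let ?X = "orbit_word T (cell P) n"
  let ?f = "\<lambda>v. {x \<in> space M. ?X x = v}"
  have Tn: "(T ^^ i) x \<in> space M" if "x \<in> space M" for i x
    using that by (induction i) (auto intro: T)
  have atom: "{x \<in> space M. \<forall>i<n. (T ^^ i) x \<in> A i} = ?f (?X y)"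
    if "\<forall>i<n. A i \<in> P" "y \<in> space M" "\<forall>i<n. (T ^^ i) y \<in> A i" for A y
  proof -
    have "(T ^^ i) x \<in> A i \<longleftrightarrow> cell P ((T ^^ i) x) = A i" if "x \<in> space M" "i < n" for x i
      using cell_iff[OF P(3) Tn[OF that(1)]] \<open>\<forall>i<n. A i \<in> P\<close> that(2) by simp
    then have "(\<forall>i<n. (T ^^ i) x \<in> A i) \<longleftrightarrow> (\<forall>i<n. cell P ((T ^^ i) x) = A i)" if "x \<in> space M" for x
      using that by blast
    moreover from this[OF that(2)] that(3) have "\<forall>i<n. cell P ((T ^^ i) y) = A i" by blast
    ultimately show ?thesis by (intro Collect_cong conj_cong refl) (auto simp: orbit_word_def)
  qed
  have "iterated_join M T P n = ?f ` (?X ` space M)"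
  proof (intro equalityI subsetI)
    fix B assume "B \<in> iterated_join M T P n"
    then obtain A where A: "B = {x \<in> space M. \<forall>i<n. (T ^^ i) x \<in> A i}" "\<forall>i<n. A i \<in> P" and "B \<noteq> {}"
      unfolding iterated_join_def by blast
    then obtain y where "y \<in> space M" "\<forall>i<n. (T ^^ i) y \<in> A i" by blast
    then have "B = ?f (?X y)" unfolding A(1) by (intro atom[OF A(2)])
    then show "B \<in> ?f ` (?X ` space M)" using \<open>y \<in> space M\<close> by (intro image_eqI) auto
  next
    fix B assume "B \<in> ?f ` (?X ` space M)"
    then obtain y where y: "y \<in> space M" "B = ?f (?X y)" by auto
    define A where "A i = cell P ((T ^^ i) y)" for i
    have A: "\<forall>i<n. A i \<in> P" "\<forall>i<n. (T ^^ i) y \<in> A i"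
      unfolding A_def using cell_in[OF P(3) Tn[OF y(1)]] by auto
    have "B = {x \<in> space M. \<forall>i<n. (T ^^ i) x \<in> A i}"
      unfolding y(2) by (rule atom[OF A(1) y(1) A(2), symmetric])
    moreover have "y \<in> B" unfolding y(2) using y(1) by blast
    ultimately show "B \<in> iterated_join M T P n" unfolding iterated_join_def using A(1) by blast
  qed
  moreover have "inj_on ?f (?X ` space M)" by (auto simp: inj_on_def)
  ultimately show ?thesis
    by (simp add: partition_entropy_def rv_entropy_def sum.reindex pr_def)
qed

lemma entropy_wrt_eq:
  assumes "P \<in> finite_partitions M" "\<And>x. x \<in> space M \<Longrightarrow> T x \<in> space M"
  shows "entropy_wrt M T P = orbit_entropy M T (cell P)"
  by (simp add: entropy_wrt_def orbit_entropy_def partition_entropy_iterated_join[OF assms])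

text \<open>Apply ln x \<le> x - 1 to x = 1 / sqrt t. The square root controls t ln t near 0; the
  linear bound that follows is the sharp one near 1.\<close>

lemma neg_mult_ln_le_sqrt: "0 \<le> t \<Longrightarrow> - (t * ln t) \<le> 2 * sqrt t" for t :: real
proof (cases "t = 0")
  case False
  assume "0 \<le> t"
  then have t: "t > 0" using False by simp
  have "ln (1 / sqrt t) \<le> 1 / sqrt t - 1" using t by (intro ln_le_minus_one) auto
  then have "- ln (sqrt t) \<le> 1 / sqrt t" using t by (simp add: ln_div)
  then have "- ln t \<le> 2 / sqrt t" using t by (simp add: ln_sqrt)
  then have "t * (- ln t) \<le> t * (2 / sqrt t)" using t by (intro mult_left_mono) auto
  also have "t * (2 / sqrt t) = 2 * sqrt t" using t by (simp add: real_div_sqrt field_simps)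
  finally show ?thesis by simp
qed simp

lemma neg_mult_ln_le: "0 \<le> t \<Longrightarrow> - (t * ln t) \<le> 1 - t" for t :: real
proof (cases "t = 0")
  case False
  assume "0 \<le> t"
  then have t: "t > 0" using False by simp
  have "ln (1 / t) \<le> 1 / t - 1" using t by (intro ln_le_minus_one) auto
  then have "t * (- ln t) \<le> t * (1 / t - 1)" using t by (intro mult_left_mono) (auto simp: ln_div)
  then show ?thesis using t by (simp add: algebra_simps)
qed simp

text \<open>The dominant value \<open>c\<close> is estimated by the bound 1 - t, small near t = 1,
  and each remaining value by the square root bound, small near t = 0.\<close>

lemma rv_entropy_concentrated:
  assumes M: "prob_space M" and E: "simple_function M E" and S: "finite S" "E ` space M \<subseteq> insert c S" "c \<notin> S"
    and small: "measure M {x \<in> space M. E x \<noteq> c} \<le> d"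
  shows "rv_entropy M E \<le> d + real (card S) * (2 * sqrt d)"
proof -
  interpret prob_space M by fact
  have "{x \<in> space M. E x \<noteq> c} = space M - {x \<in> space M. E x = c}" by auto
  then have "measure M {x \<in> space M. E x \<noteq> c} = 1 - pr M E c"
    using prob_compl[OF simple_function_sets[OF E, of c]] by (simp add: pr_def)
  then have c: "- (pr M E c * ln (pr M E c)) \<le> d"
    using neg_mult_ln_le[of "pr M E c"] small by simp
  have v: "- (pr M E v * ln (pr M E v)) \<le> 2 * sqrt d" if "v \<in> S" for v
  proof -
    have "{x \<in> space M. E x \<noteq> c} \<in> sets M"
    proof -
      have "space M - {x \<in> space M. E x = c} \<in> sets M" using simple_function_sets[OF E] by auto
      then show ?thesis using \<open>{x \<in> space M. E x \<noteq> c} = _\<close> by simp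
    qed
    then have "pr M E v \<le> measure M {x \<in> space M. E x \<noteq> c}"
      unfolding pr_def using that S(3) by (intro finite_measure_mono) auto
    then have "sqrt (pr M E v) \<le> sqrt d" using small by simp
    then show ?thesis using neg_mult_ln_le_sqrt[OF pr_nonneg, of M E v] by linarith
  qed
  have "rv_entropy M E = (\<Sum>v\<in>insert c S. - (pr M E v * ln (pr M E v)))"
    using rv_entropy_superset[of "insert c S" E M] S by (simp add: sum_negf)
  also have "\<dots> = - (pr M E c * ln (pr M E c)) + (\<Sum>v\<in>S. - (pr M E v * ln (pr M E v)))"
    using S by simp
  also have "\<dots> \<le> d + real (card S) * (2 * sqrt d)"
    using c v by (intro add_mono sum_bounded_above) auto
  finally show ?thesis .
qed

text \<open>The itinerary of \<open>g\<close> is determined by the itineraries of \<open>q\<close> and of the error variable, and the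
  latter has small entropy.\<close>

lemma orbit_entropy_le_approx:
  assumes M: "prob_space M" and T: "T \<in> M \<rightarrow>\<^sub>M M" "distr M M T = M"
    and g: "simple_function M g" and q: "simple_function M q"
    and small: "measure M {x \<in> space M. q x \<noteq> g x} \<le> d"
  shows "orbit_entropy M T g \<le> orbit_entropy M T q + (d + real (card (g ` space M)) * (2 * sqrt d))"
proof -
  define E where "E x = (if q x = g x then None else Some (g x))" for x
  have E: "simple_function M E"
    unfolding E_def using simple_function_compose2[OF q g, of "\<lambda>a b. if a = b then None else Some b"] by simp
  have HE: "rv_entropy M E \<le> d + real (card (g ` space M)) * (2 * sqrt d)"
  proof -
    have "rv_entropy M E \<le> d + real (card (Some ` g ` space M)) * (2 * sqrt d)"
    proof (rule rv_entropy_concentrated[OF M E, where c=None])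
      have "{x \<in> space M. E x \<noteq> None} = {x \<in> space M. q x \<noteq> g x}" by (auto simp: E_def)
      then show "measure M {x \<in> space M. E x \<noteq> None} \<le> d" using small by simp
    qed (use simple_functionD(1)[OF g] in \<open>auto simp: E_def\<close>)
    then show ?thesis by (simp add: card_image)
  qed
  have "rv_entropy M (orbit_word T g n) / real n \<le> rv_entropy M (orbit_word T q n) / real n + rv_entropy M E"
    if n: "n > 0" for n
  proof -
    note s = simple_function_orbit_word[OF T(1) q, of n] simple_function_orbit_word[OF T(1) E, of n]
    have rec: "orbit_word T g n x = map2 (\<lambda>a e. case e of None \<Rightarrow> a | Some b \<Rightarrow> b) (orbit_word T q n x) (orbit_word T E n x)" for x
      by (rule nth_equalityI) (auto simp: orbit_word_def E_def)
    have "rv_entropy M (orbit_word T g n) \<le> rv_entropy M (\<lambda>x. (orbit_word T q n x, orbit_word T E n x))"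
      by (rule rv_entropy_mono[OF M simple_function_Pair[OF s]]) (auto simp: rec)
    also have "\<dots> \<le> rv_entropy M (orbit_word T q n) + rv_entropy M (orbit_word T E n)"
      by (rule rv_entropy_Pair_le[OF M s])
    also have "rv_entropy M (orbit_word T E n) \<le> real n * rv_entropy M E"
    proof -
      have one: "rv_entropy M (orbit_word T E 1) \<le> rv_entropy M E"
        by (rule rv_entropy_mono[OF M E]) (simp add: orbit_word_def)
      show ?thesis
      proof (induction n)
        case 0
        have "rv_entropy M (orbit_word T E 0) \<le> ln (real (card {[] :: 'b option list}))"
          by (rule rv_entropy_le_card[OF M simple_function_orbit_word[OF T(1) E]]) (auto simp: orbit_word_def)
        then show ?case by simp
      next
        case (Suc n)
        then show ?case using orbit_entropy_subadditive[OF M T E, of n 1] one by (simp add: algebra_simps)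
      qed
    qed
    finally show ?thesis using n by (simp add: field_simps)
  qed
  then have "orbit_entropy M T g \<le> orbit_entropy M T q + rv_entropy M E"
    using orbit_entropy(1)[OF M T g] orbit_entropy(1)[OF M T q]
    by (intro LIMSEQ_le[OF _ tendsto_add[OF _ tendsto_const]]) (auto intro!: exI[of _ 1])
  then show ?thesis using HE by linarith
qed

section \<open>Shift-invariant measures and their entropy\<close>

definition words :: "nat \<Rightarrow> nat \<Rightarrow> nat list set" where
  "words k n = {u. set u \<subseteq> {1..k} \<and> length u = n}"

lemma finite_words [simp]: "finite (words k n)"
  unfolding words_def by (rule finite_lists_length_eq) simp

text \<open>Unlike \<open>cylinder\<close>, this set lives in the space of all sequences, where it
  is open and belongs to a countable generating family; a measure on X sees it as X \<inter> cyl
  u.\<close>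

definition cyl :: "nat list \<Rightarrow> (nat \<Rightarrow> nat) set" where
  "cyl u = {x. map x [0..<length u] = u}"

lemma mem_cyl: "x \<in> cyl u \<longleftrightarrow> (\<forall>i<length u. x i = u ! i)"
proof -
  have "map x [0..<length u] = u \<longleftrightarrow> (\<forall>i<length u. x i = u ! i)"
    using list_eq_iff_nth_eq[of "map x [0..<length u]" u] by simp
  then show ?thesis by (simp only: cyl_def mem_Collect_eq)
qed

lemma prefix_mem_cyl [simp]: "x \<in> cyl (map x [0..<n])"
  by (simp add: mem_cyl)

lemma open_cyl: "open (cyl u)"
proof -
  have "cyl u = (\<Inter>i\<in>{..<length u}. (\<lambda>x. x i) -` {u ! i})"
    by (auto simp: mem_cyl)
  moreover have "open ((\<lambda>x::nat \<Rightarrow> nat. x i) -` {u ! i})" for i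
    by (rule open_vimage[OF discrete_topology_class.open_discrete continuous_on_product_coordinates])
  ultimately show ?thesis by (auto intro!: open_INT)
qed

lemma open_contains_cyl:
  assumes "open U" "x \<in> U"
  shows "\<exists>n. cyl (map x [0..<n]) \<subseteq> U"
proof -
  have "openin (product_topology (\<lambda>_. euclidean) UNIV) U"
    using assms(1) by (simp add: open_fun_def)
  from product_topology_open_contains_basis[OF this assms(2)]
  obtain V where V: "x \<in> PiE UNIV V" "finite {i. V i \<noteq> UNIV}" "PiE UNIV V \<subseteq> U"
    by auto
  from V(2) obtain n where n: "\<And>i. V i \<noteq> UNIV \<Longrightarrow> i < n"
    unfolding finite_nat_set_iff_bounded by blast
  have "cyl (map x [0..<n]) \<subseteq> PiE UNIV V"
  proof
    fix y assume y: "y \<in> cyl (map x [0..<n])"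
    have "y i \<in> V i" for i
    proof (cases "V i = UNIV")
      case False
      then have "i < n" by (rule n)
      then have "y i = x i" using y by (simp add: mem_cyl)
      then show ?thesis using V(1) by (auto simp: PiE_def)
    qed simp
    then show "y \<in> PiE UNIV V" by auto
  qed
  then show ?thesis using V(3) by blast
qed

text \<open>There are only countably many words, so an open set, being a union of cylinders, is a
  countable union of cylinders.\<close>

lemma borel_eq_sigma_cyl: "sets (borel :: (nat \<Rightarrow> nat) measure) = sigma_sets UNIV (range cyl)"
proof
  show "sigma_sets UNIV (range cyl) \<subseteq> sets borel"
    using sets.sigma_sets_subset[of "range cyl" "borel :: (nat \<Rightarrow> nat) measure"] open_cyl
    by (auto simp: image_subset_iff)
  have "U \<in> sigma_sets UNIV (range cyl)" if U: "open U" for U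
  proof -
    have "U = (\<Union>u\<in>{u. cyl u \<subseteq> U}. cyl u)"
    proof (intro equalityI subsetI)
      fix x assume "x \<in> U"
      then obtain n where "cyl (map x [0..<n]) \<subseteq> U" using open_contains_cyl[OF U] by blast
      then show "x \<in> (\<Union>u\<in>{u. cyl u \<subseteq> U}. cyl u)" by (auto intro: exI[of _ "map x [0..<n]"])
    qed auto
    moreover have "(\<Union>u\<in>{u. cyl u \<subseteq> U}. cyl u) \<in> sigma_sets UNIV (range cyl)"
      by (intro sigma_sets_UNION) (auto intro: sigma_sets.Basic)
    ultimately show ?thesis by simp
  qed
  then show "sets borel \<subseteq> sigma_sets UNIV (range cyl)"
    unfolding borel_def by (auto intro!: sigma_sets_mono simp: sets_measure_of)
qed

text \<open>Two cylinders are nested or disjoint; adjoining the empty set therefore gives an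
  intersection-stable generator.\<close>

lemma measure_eq_of_cyl:
  assumes "sets M = sets borel" "sets N = sets borel" "prob_space M" "prob_space N"
    and "\<And>u. measure M (cyl u) = measure N (cyl u)"
  shows "M = N"
proof (rule measure_eqI_generator_eq[where E="insert {} (range cyl)" and \<Omega>=UNIV and A="\<lambda>_. UNIV"])
  interpret M: prob_space M by fact
  interpret N: prob_space N by fact
  have *: "cyl u \<inter> cyl v \<in> insert {} (range cyl)" for u v
  proof -
    have c: "cyl u \<inter> cyl v = cyl v \<or> cyl u \<inter> cyl v = {}" if "length u \<le> length v" for u v
    proof (cases "cyl u \<inter> cyl v = {}")
      case False
      then obtain x where "x \<in> cyl u" "x \<in> cyl v" by auto
      then have "u ! i = v ! i" if "i < length u" for i
        using that \<open>length u \<le> length v\<close> by (auto simp: mem_cyl)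
      then have "cyl v \<subseteq> cyl u" using that by (auto simp: mem_cyl)
      then show ?thesis by auto
    qed simp
    show ?thesis using c[of u v] c[of v u] linear[of "length u" "length v"]
      by (auto simp: Int_commute)
  qed
  show "Int_stable (insert {} (range cyl))"
    unfolding Int_stable_def using * by auto
  have "UNIV = cyl []" by (auto simp: mem_cyl)
  then show "range (\<lambda>_. UNIV) \<subseteq> insert {} (range cyl)" by auto
  have s: "sigma_sets UNIV (insert {} (range cyl)) = sets borel"
    unfolding borel_eq_sigma_cyl
    by (intro equalityI sigma_sets_mono) (auto intro: sigma_sets.Basic sigma_sets.Empty)
  show "sets M = sigma_sets UNIV (insert {} (range cyl))" "sets N = sigma_sets UNIV (insert {} (range cyl))"
    using s assms by auto
  show "emeasure M A = emeasure N A" if "A \<in> insert {} (range cyl)" for A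
    using that assms(5) by (auto simp: M.emeasure_eq_measure N.emeasure_eq_measure)
  show "emeasure M UNIV \<noteq> \<infinity>" by (simp add: M.emeasure_eq_measure)
qed auto

lemma shift_funpow: "(shift ^^ i) x = (\<lambda>j. x (i + j))"
  by (induction i arbitrary: x) (auto simp: shift_def funpow_swap1)

text \<open>These numbers serve as the coordinates of a measure: they determine it
  (\<open>restrict_measure_eqI\<close>), and limits of measures are taken as pointwise limits of
  these functions on words.\<close>

definition wp :: "(nat \<Rightarrow> nat) measure \<Rightarrow> nat list \<Rightarrow> real" where
  "wp M u = measure M {x \<in> space M. map x [0..<length u] = u}"

section \<open>Approximation by sets depending on finitely many coordinates\<close>

definition prefix_set :: "nat \<Rightarrow> (nat \<Rightarrow> nat) set \<Rightarrow> bool" where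
  "prefix_set N C \<longleftrightarrow> (\<forall>x y. (\<forall>i<N. x i = y i) \<longrightarrow> x \<in> C \<longrightarrow> y \<in> C)"

lemma prefix_set_mono: "prefix_set N C \<Longrightarrow> N \<le> N' \<Longrightarrow> prefix_set N' C"
  unfolding prefix_set_def by (meson order_less_le_trans)

lemma prefix_set_borel:
  assumes "prefix_set N C" shows "C \<in> sets borel"
proof -
  have "C = (\<Union>u\<in>{u. cyl u \<subseteq> C}. cyl u)"
  proof (intro equalityI subsetI)
    fix x assume x: "x \<in> C"
    have "cyl (map x [0..<N]) \<subseteq> C"
    proof
      fix y assume "y \<in> cyl (map x [0..<N])"
      then have "\<forall>i<N. x i = y i" by (auto simp: mem_cyl)
      then show "y \<in> C" using assms x unfolding prefix_set_def by blast
    qed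
    then show "x \<in> (\<Union>u\<in>{u. cyl u \<subseteq> C}. cyl u)" by (auto intro: exI[of _ "map x [0..<N]"])
  qed auto
  moreover have "open (\<Union>u\<in>{u. cyl u \<subseteq> C}. cyl u)" using open_cyl by blast
  ultimately show ?thesis by auto
qed

lemma prefix_set_cyl: "prefix_set (length u) (cyl u)"
  by (auto simp: prefix_set_def mem_cyl)

text \<open>The sets with this approximation property for every e form a sigma-algebra containing
  the cylinders. A countable union is truncated to finitely many sets, at a cost below e / 2, before
  each of these is approximated.\<close>

lemma prefix_approx:
  assumes "prob_space M" and M: "sets M = sets (restrict_space borel X)" and X: "X \<in> sets borel"
    and "B \<in> sets borel" and "e > 0"
  shows "\<exists>N C. prefix_set N C \<and> measure M (X \<inter> sym_diff B C) < e"
proof -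
  interpret prob_space M by fact
  have sM: "X \<inter> B \<in> sets M" if "B \<in> sets borel" for B
    unfolding M sets_restrict_space using that by auto
  have sets_C: "X \<inter> sym_diff B C \<in> sets M" if "B \<in> sets borel" "prefix_set N C" for B C N
    using that prefix_set_borel[OF that(2)] by (intro sM) auto
  have "B \<in> sigma_sets UNIV (range cyl)" using assms by (simp add: borel_eq_sigma_cyl)
  then have "\<forall>e>0. \<exists>N C. prefix_set N C \<and> measure M (X \<inter> sym_diff B C) < e"
  proof (induction rule: sigma_sets.induct)
    case (Basic B)
    then obtain u where "B = cyl u" by auto
    then have "X \<inter> sym_diff B (cyl u) = {}" by auto
    then have "measure M (X \<inter> sym_diff B (cyl u)) = 0" by (metis measure_empty)
    then show ?case using prefix_set_cyl[of u] by metis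
  next
    case Empty
    have "prefix_set 0 {}" by (simp add: prefix_set_def)
    then show ?case by (intro allI impI exI[of _ 0] exI[of _ "{}"]) simp
  next
    case (Compl B)
    show ?case
    proof (intro allI impI)
      fix e :: real assume "e > 0"
      then obtain N C where C: "prefix_set N C" "measure M (X \<inter> sym_diff B C) < e" using Compl by blast
      have "prefix_set N (UNIV - C)"
        using C(1) unfolding prefix_set_def by (metis DiffD2 DiffI UNIV_I)
      moreover have "sym_diff (UNIV - B) (UNIV - C) = sym_diff B C" by auto
      ultimately show "\<exists>N C. prefix_set N C \<and> measure M (X \<inter> sym_diff (UNIV - B) C) < e"
        using C(2) by metis
    qed
  next
    case (Union B)
    have B: "B i \<in> sets borel" for i using Union.hyps by (simp add: borel_eq_sigma_cyl)
    show ?case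
    proof (intro allI impI)
      fix e :: real assume e: "e > 0"
      define S where "S n = X \<inter> (\<Union>i<n. B i)" for n
      have S: "range S \<subseteq> sets M" unfolding S_def using B by (auto intro!: sM)
      have "incseq S" unfolding S_def by (auto intro!: incseq_SucI simp: lessThan_Suc)
      from finite_Lim_measure_incseq[OF S this]
      have "(\<lambda>n. measure M (S n)) \<longlonglongrightarrow> measure M (\<Union>i. S i)" .
      moreover have "(\<Union>i. S i) = X \<inter> (\<Union>i. B i)" unfolding S_def by auto
      ultimately have "(\<lambda>n. measure M (S n)) \<longlonglongrightarrow> measure M (X \<inter> (\<Union>i. B i))" by simp
      from LIMSEQ_D[OF this, of "e/2"] e obtain m where
        "\<bar>measure M (S m) - measure M (X \<inter> (\<Union>i. B i))\<bar> < e/2" by force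
      moreover have "measure M (X \<inter> (\<Union>i. B i) - S m) = measure M (X \<inter> (\<Union>i. B i)) - measure M (S m)"
        using S B by (intro finite_measure_Diff sM) (auto simp: S_def)
      ultimately have m: "measure M (X \<inter> (\<Union>i. B i) - S m) < e/2" by linarith
      \<comment> \<open>The other e / 2 is shared among the \<open>m\<close> sets; the extra 1 keeps
        the denominator positive when m = 0.\<close>
      define d where "d = e / (2 * (real m + 1))"
      have d: "d > 0" using e by (simp add: d_def)
      have "\<exists>N C. prefix_set N C \<and> measure M (X \<inter> sym_diff (B i) C) < d" for i
        using Union.IH d by blast
      then obtain N C where C: "\<And>i. prefix_set (N i) (C i)" "\<And>i. measure M (X \<inter> sym_diff (B i) (C i)) < d"
        by metis
      define N' where "N' = (\<Sum>i<m. N i)"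
      have C': "prefix_set N' (C i)" if "i < m" for i
        using prefix_set_mono[OF C(1)[of i], of N'] member_le_sum[of i "{..<m}" N] that
        unfolding N'_def by auto
      have ps: "prefix_set N' (\<Union>i<m. C i)"
        unfolding prefix_set_def
      proof (intro allI impI)
        fix x y :: "nat \<Rightarrow> nat" assume "\<forall>i<N'. x i = y i" "x \<in> (\<Union>i<m. C i)"
        then show "y \<in> (\<Union>i<m. C i)" using C' unfolding prefix_set_def by blast
      qed
      have m1: "X \<inter> (\<Union>i. B i) - S m \<in> sets M"
        using S B by (intro sets.Diff sM) auto
      have m2: "(\<Union>i<m. X \<inter> sym_diff (B i) (C i)) \<in> sets M"
        using sets_C[OF B C(1)] by (intro sets.finite_UN) auto
      have "X \<inter> sym_diff (\<Union>i. B i) (\<Union>i<m. C i)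
          \<subseteq> (X \<inter> (\<Union>i. B i) - S m) \<union> (\<Union>i<m. X \<inter> sym_diff (B i) (C i))"
        unfolding S_def by blast
      then have "measure M (X \<inter> sym_diff (\<Union>i. B i) (\<Union>i<m. C i))
          \<le> measure M ((X \<inter> (\<Union>i. B i) - S m) \<union> (\<Union>i<m. X \<inter> sym_diff (B i) (C i)))"
        using m1 m2 by (intro finite_measure_mono sets.Un)
      also have "\<dots> \<le> measure M (X \<inter> (\<Union>i. B i) - S m) + measure M (\<Union>i<m. X \<inter> sym_diff (B i) (C i))"
        using m1 m2 by (rule measure_Un_le)
      also have "measure M (\<Union>i<m. X \<inter> sym_diff (B i) (C i)) \<le> (\<Sum>i<m. measure M (X \<inter> sym_diff (B i) (C i)))"
        using sets_C[OF B C(1)] by (intro measure_UNION_le) auto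
      also have "\<dots> \<le> (\<Sum>i<m. d)" using C(2) by (intro sum_mono) (auto intro: less_imp_le)
      also have "\<dots> \<le> e / 2" using e by (simp add: d_def field_simps)
      finally have "measure M (X \<inter> sym_diff (\<Union>i. B i) (\<Union>i<m. C i)) < e" using m by simp
      then show "\<exists>N C. prefix_set N C \<and> measure M (X \<inter> sym_diff (\<Union>i. B i) C) < e"
        using ps by blast
    qed
  qed
  then show ?thesis using \<open>e > 0\<close> by blast
qed

section \<open>Kolmogorov-Sinai entropy as a limit of block entropies\<close>

lemma shift_measurable_restrict:
  assumes "subshift k X" and M: "sets M = sets (restrict_space borel X)"
  shows "shift \<in> M \<rightarrow>\<^sub>M M"
proof -
  have "continuous_on UNIV shift" unfolding shift_def
    by (intro continuous_on_coordinatewise_then_product continuous_on_product_coordinates)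
  then have "shift \<in> borel \<rightarrow>\<^sub>M borel" by (rule borel_measurable_continuous_onI)
  then have "shift \<in> restrict_space borel X \<rightarrow>\<^sub>M restrict_space borel X"
    using assms(1) by (intro measurable_restrict_space2 measurable_restrict_space1)
       (auto simp: space_restrict_space subshift_def)
  then show ?thesis using measurable_cong_sets[OF M M] by simp
qed

text \<open>Invariance is left to the extension \<open>shift_measure\<close>, because orbit averages
  start from measures that need not be invariant.\<close>

locale seq_measure =
  fixes k :: nat and X :: "(nat \<Rightarrow> nat) set" and \<mu> :: "(nat \<Rightarrow> nat) measure"
  assumes subshift: "subshift k X" and sets_mu: "sets \<mu> = sets (restrict_space borel X)"
    and prob_mu: "prob_space \<mu>"
begin

lemma X_borel: "X \<in> sets borel"
  using subshift by (auto simp: subshift_def)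

lemma space_mu: "space \<mu> = X"
  using sets_eq_imp_space_eq[OF sets_mu] by (simp add: space_restrict_space)

lemma in_sets_mu: "B \<in> sets borel \<Longrightarrow> X \<inter> B \<in> sets \<mu>"
  by (auto simp: sets_mu sets_restrict_space)

lemma sets_mu_iff: "A \<in> sets \<mu> \<longleftrightarrow> A \<in> sets borel \<and> A \<subseteq> X"
  using X_borel by (auto simp: sets_mu sets_restrict_space)

lemma shift_in: "x \<in> X \<Longrightarrow> shift x \<in> X"
  using subshift by (auto simp: subshift_def)

lemma shift_measurable: "shift \<in> \<mu> \<rightarrow>\<^sub>M \<mu>"
  using shift_measurable_restrict[OF subshift sets_mu] .

lemma in_words: "x \<in> X \<Longrightarrow> map x [i..<i + n] \<in> words k n"
  using subshift by (auto simp: subshift_def full_shift_def words_def)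

lemma simple_function_coord: "simple_function \<mu> (\<lambda>x. x i)"
  unfolding simple_function_def
proof (intro conjI ballI)
  have "(\<lambda>x. x i) ` space \<mu> \<subseteq> {1..k}"
    using subshift by (auto simp: space_mu subshift_def full_shift_def)
  then show "finite ((\<lambda>x. x i) ` space \<mu>)" using finite_subset by blast
  fix a
  have "open ((\<lambda>x::nat \<Rightarrow> nat. x i) -` {a})"
    by (rule open_vimage[OF discrete_topology_class.open_discrete continuous_on_product_coordinates])
  then have "X \<inter> (\<lambda>x. x i) -` {a} \<in> sets \<mu>" by (intro in_sets_mu borel_open)
  then show "(\<lambda>x. x i) -` {a} \<inter> space \<mu> \<in> sets \<mu>" by (simp add: space_mu Int_commute)
qed

lemma simple_function_words: "simple_function \<mu> (\<lambda>x. map x is)"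
  using simple_function_map[of \<mu> "\<lambda>i x. x i", OF simple_function_coord] .

lemma block_entropy_words:
  "rv_entropy \<mu> (\<lambda>x. map x [0..<n]) = - (\<Sum>u\<in>words k n. wp \<mu> u * ln (wp \<mu> u))"
proof -
  have "rv_entropy \<mu> (\<lambda>x. map x [0..<n])
      = - (\<Sum>u\<in>words k n. pr \<mu> (\<lambda>x. map x [0..<n]) u * ln (pr \<mu> (\<lambda>x. map x [0..<n]) u))"
    using in_words[of _ 0 n] by (intro rv_entropy_superset) (auto simp: space_mu)
  also have "\<dots> = - (\<Sum>u\<in>words k n. wp \<mu> u * ln (wp \<mu> u))"
    by (intro arg_cong[where f=uminus] sum.cong) (auto simp: pr_def wp_def words_def)
  finally show ?thesis .
qed

end

locale shift_measure = seq_measure +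
  assumes distr_shift: "distr \<mu> \<mu> shift = \<mu>"
begin

lemma orbit_word_coord: "orbit_word shift (\<lambda>x. x 0) n x = map x [0..<n]"
  by (simp add: orbit_word_def shift_funpow)

text \<open>The entropy of the partition by the first symbol, as a real number;
  \<open>shift_entropy_eq\<close> identifies it with the Kolmogorov-Sinai entropy.\<close>

definition ent :: real where
  "ent = orbit_entropy \<mu> shift (\<lambda>x. x 0)"

lemma ent:
  shows ent_LIMSEQ: "(\<lambda>n. rv_entropy \<mu> (\<lambda>x. map x [0..<n]) / real n) \<longlonglongrightarrow> ent"
    and ent_le: "n > 0 \<Longrightarrow> ent \<le> rv_entropy \<mu> (\<lambda>x. map x [0..<n]) / real n"
  using orbit_entropy[OF prob_mu shift_measurable distr_shift simple_function_coord[of 0]]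
  unfolding ent_def orbit_word_coord[abs_def] by auto

text \<open>A function of N coordinates sees no more than n + N symbols along n steps of the orbit,
  and the N extra symbols add a constant that vanishes in the average.\<close>

lemma entropy_prefix_function:
  assumes q: "simple_function \<mu> q" and dep: "\<And>x y. x \<in> X \<Longrightarrow> y \<in> X \<Longrightarrow> (\<forall>i<N. x i = y i) \<Longrightarrow> q x = q y"
  shows "orbit_entropy \<mu> shift q \<le> ent"
proof -
  let ?H = "\<lambda>n. rv_entropy \<mu> (\<lambda>x. map x [0..<n])"
  have le: "rv_entropy \<mu> (orbit_word shift q n) / real n \<le> ?H n / real n + ?H N / real n" if "n > 0" for n
  proof -
    have "rv_entropy \<mu> (orbit_word shift q n) \<le> ?H (n + N)"
    proof (rule rv_entropy_mono[OF prob_mu simple_function_words])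
      fix x y assume xy: "x \<in> space \<mu>" "y \<in> space \<mu>" and eq: "map x [0..<n + N] = map y [0..<n + N]"
      have "q ((shift ^^ i) x) = q ((shift ^^ i) y)" if "i < n" for i
      proof (rule dep)
        show "(shift ^^ i) x \<in> X" "(shift ^^ i) y \<in> X"
          using xy by (induction i) (auto simp: space_mu shift_in)
        show "\<forall>j<N. (shift ^^ i) x j = (shift ^^ i) y j"
          using eq that by (auto simp: shift_funpow list_eq_iff_nth_eq)
      qed
      then show "orbit_word shift q n x = orbit_word shift q n y" by (auto simp: orbit_word_def)
    qed
    also have "\<dots> \<le> ?H n + ?H N"
      using orbit_entropy_subadditive[OF prob_mu shift_measurable distr_shift simple_function_coord[of 0], of n N]
      unfolding orbit_word_coord[abs_def] .
    finally show ?thesis using that by (simp add: add_divide_distrib[symmetric] divide_right_mono)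
  qed
  have "(\<lambda>n. ?H n / real n + ?H N / real n) \<longlonglongrightarrow> ent + 0"
    by (intro tendsto_add ent_LIMSEQ lim_const_over_n)
  then have "orbit_entropy \<mu> shift q \<le> ent + 0"
    using orbit_entropy(1)[OF prob_mu shift_measurable distr_shift q] le
    by (intro LIMSEQ_le) (auto intro!: exI[of _ 1])
  then show ?thesis by simp
qed

text \<open>Each cell of \<open>P\<close> is approximated by a set depending on finitely many
  coordinates. The approximants define a function \<open>q\<close> of a prefix that names the right
  cell off a small set, so \<open>orbit_entropy_le_approx\<close> reduces the claim to
  \<open>entropy_prefix_function\<close>.\<close>

lemma entropy_wrt_le_ent:
  assumes P: "P \<in> finite_partitions \<mu>"
  shows "entropy_wrt \<mu> shift P \<le> ent"
proof (rule field_le_epsilon)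
  fix e :: real assume e: "e > 0"
  interpret prob_space \<mu> by (rule prob_mu)
  have P': "finite P" "P \<subseteq> sets \<mu>" "partition_on (space \<mu>) P"
    using P by (auto simp: finite_partitions_def)
  let ?g = "cell P"
  have g: "simple_function \<mu> ?g" by (rule simple_function_cell[OF P])
  define c where "c = real (card (?g ` space \<mu>))"
  \<comment> \<open>With d the square of s, the error term d + 2 c sqrt d is at most (1 + 2 c) s;
    hence the two caps on \<open>s\<close>.\<close>
  define s where "s = min 1 (e / (1 + 2 * c))"
  have c0: "c \<ge> 0" by (simp add: c_def)
  have s: "0 < s" "s \<le> 1" "(1 + 2 * c) * s \<le> e"
    using e c0 pos_le_divide_eq[of "1 + 2 * c" s e] by (auto simp: s_def mult.commute)
  define d where "d = s\<^sup>2"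
  have d: "d > 0" "d + c * (2 * sqrt d) \<le> e"
  proof -
    have "d \<le> s" using s by (simp add: d_def power2_eq_square mult_left_le)
    moreover have "sqrt d = s" using s by (simp add: d_def)
    ultimately show "d + c * (2 * sqrt d) \<le> e" using s(3) by (simp add: algebra_simps)
  qed (use s in \<open>simp add: d_def\<close>)
  define d' where "d' = d / (real (card P) + 1)"
  have d': "d' > 0" using d by (simp add: d'_def)
  have "\<exists>N C. prefix_set N C \<and> measure \<mu> (X \<inter> sym_diff A C) < d'" if "A \<in> P" for A
    using prefix_approx[OF prob_mu sets_mu X_borel _ d', of A] that P'(2) sets_mu_iff by blast
  then obtain N C where C: "\<And>A. A \<in> P \<Longrightarrow> prefix_set (N A) (C A)"
    "\<And>A. A \<in> P \<Longrightarrow> measure \<mu> (X \<inter> sym_diff A (C A)) < d'" by metis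
  define N' where "N' = (\<Sum>A\<in>P. N A)"
  have C': "prefix_set N' (C A)" if "A \<in> P" for A
    using prefix_set_mono[OF C(1)[OF that], of N'] member_le_sum[of A P N] that P'(1)
    unfolding N'_def by auto
  \<comment> \<open>The approximants may overlap or leave points uncovered, hence the choice and the
    default. Where every approximant agrees with its cell, exactly one of them contains
    \<open>x\<close>, and the choice returns the right cell.\<close>
  define q where "q x = (if \<exists>A. A \<in> P \<and> x \<in> C A then SOME A. A \<in> P \<and> x \<in> C A else {})" for x
  have dep: "q x = q y" if "\<forall>i<N'. x i = y i" for x y
  proof -
    have "x \<in> C A \<longleftrightarrow> y \<in> C A" if "A \<in> P" for A
      using C'[OF that] \<open>\<forall>i<N'. x i = y i\<close> unfolding prefix_set_def by metis
    then have "(\<lambda>A. A \<in> P \<and> x \<in> C A) = (\<lambda>A. A \<in> P \<and> y \<in> C A)" by auto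
    \<comment> \<open>The choice depends on \<open>x\<close> only through the predicate that selects
      the candidate cells, so equal predicates give equal values even where the choice is
      arbitrary.\<close>
    from arg_cong[OF this, of "\<lambda>R. if \<exists>A. R A then SOME A. R A else {}"]
    show ?thesis unfolding q_def .
  qed
  have q: "simple_function \<mu> q"
    unfolding simple_function_def
  proof (intro conjI ballI)
    have "q x \<in> insert {} P" for x
      unfolding q_def using someI_ex[of "\<lambda>A. A \<in> P \<and> x \<in> C A"] by auto
    then have "q ` space \<mu> \<subseteq> insert {} P" by auto
    then show "finite (q ` space \<mu>)" using P'(1) finite_subset by blast
    fix A
    have "prefix_set N' (q -` {A})" unfolding prefix_set_def using dep by auto
    then have "X \<inter> q -` {A} \<in> sets \<mu>" by (intro in_sets_mu prefix_set_borel)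
    then show "q -` {A} \<inter> space \<mu> \<in> sets \<mu>" by (simp add: space_mu Int_commute)
  qed
  have "{x \<in> space \<mu>. q x \<noteq> ?g x} \<subseteq> (\<Union>A\<in>P. X \<inter> sym_diff A (C A))"
  proof
    fix x assume x: "x \<in> {x \<in> space \<mu>. q x \<noteq> ?g x}"
    show "x \<in> (\<Union>A\<in>P. X \<inter> sym_diff A (C A))"
    proof (rule ccontr)
      assume "x \<notin> (\<Union>A\<in>P. X \<inter> sym_diff A (C A))"
      then have "x \<in> A \<longleftrightarrow> x \<in> C A" if "A \<in> P" for A using x that by (auto simp: space_mu)
      then have "A \<in> P \<and> x \<in> C A \<longleftrightarrow> A = ?g x" for A
        using cell_in[OF P'(3)] cell_eqI[OF P'(3)] x by blast
      then have "q x = ?g x" unfolding q_def by auto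
      then show False using x by simp
    qed
  qed
  moreover have Cs: "X \<inter> sym_diff A (C A) \<in> sets \<mu>" if "A \<in> P" for A
    using prefix_set_borel[OF C(1)[OF that]] P'(2) sets_mu_iff that by (intro in_sets_mu) auto
  ultimately have "measure \<mu> {x \<in> space \<mu>. q x \<noteq> ?g x} \<le> measure \<mu> (\<Union>A\<in>P. X \<inter> sym_diff A (C A))"
    using P'(1) by (intro finite_measure_mono sets.finite_UN)
  also have "\<dots> \<le> (\<Sum>A\<in>P. measure \<mu> (X \<inter> sym_diff A (C A)))"
    using P'(1) Cs by (intro measure_UNION_le) auto
  also have "\<dots> \<le> (\<Sum>A\<in>P. d')" using C(2) by (intro sum_mono) (auto intro: less_imp_le)
  also have "\<dots> \<le> d" using d(1) by (simp add: d'_def field_simps)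
  finally have "orbit_entropy \<mu> shift ?g \<le> orbit_entropy \<mu> shift q + (d + c * (2 * sqrt d))"
    unfolding c_def by (intro orbit_entropy_le_approx prob_mu shift_measurable distr_shift g q)
  also have "\<dots> \<le> ent + e"
    using d(2) entropy_prefix_function[OF q, of N'] dep by (intro add_mono) auto
  finally show "entropy_wrt \<mu> shift P \<le> ent + e"
    using entropy_wrt_eq[OF P] by (simp add: space_mu shift_in)
qed

lemma shift_entropy_eq: "shift_entropy \<mu> = ereal ent"
  unfolding ks_entropy_def
proof (rule antisym)
  show "(SUP P\<in>finite_partitions \<mu>. ereal (entropy_wrt \<mu> shift P)) \<le> ereal ent"
    using entropy_wrt_le_ent by (intro SUP_least) simp
  define f where "f x = {y \<in> X. y 0 = x 0}" for x :: "nat \<Rightarrow> nat"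
  define P where "P = f ` X"
  have part: "partition_on (space \<mu>) P"
    unfolding partition_on_def P_def f_def by (auto simp: disjoint_def space_mu)
  have "f ` X = (\<lambda>a. {y \<in> X. y 0 = a}) ` (\<lambda>x. x 0) ` X" unfolding f_def by auto
  moreover have "finite ((\<lambda>x. x 0) ` X)"
    using simple_functionD(1)[OF simple_function_coord[of 0]] by (simp add: space_mu)
  ultimately have "finite P" unfolding P_def by simp
  moreover have "P \<subseteq> sets \<mu>"
    using simple_function_sets[OF simple_function_coord[of 0]] by (auto simp: P_def f_def space_mu)
  ultimately have P: "P \<in> finite_partitions \<mu>" using part by (simp add: finite_partitions_def)
  have cell: "cell P x = f x" if "x \<in> X" for x
    by (rule cell_eqI[OF part]) (use that in \<open>auto simp: P_def f_def\<close>)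
  have shiftn: "(shift ^^ i) x \<in> X" if "x \<in> X" for i x
    using that by (induction i) (auto simp: shift_in)
  have cc: "cell P x = cell P y \<longleftrightarrow> x 0 = y 0" if "x \<in> X" "y \<in> X" for x y
    unfolding cell[OF that(1)] cell[OF that(2)] using that by (auto simp: f_def)
  have "rv_entropy \<mu> (orbit_word shift (\<lambda>x. x 0) n) = rv_entropy \<mu> (orbit_word shift (cell P) n)" for n
  proof (rule antisym)
    show "rv_entropy \<mu> (orbit_word shift (\<lambda>x. x 0) n) \<le> rv_entropy \<mu> (orbit_word shift (cell P) n)"
      using cc[OF shiftn shiftn]
      by (intro rv_entropy_mono prob_mu simple_function_orbit_word shift_measurable simple_function_cell P)
         (auto simp: orbit_word_def space_mu)
    show "rv_entropy \<mu> (orbit_word shift (cell P) n) \<le> rv_entropy \<mu> (orbit_word shift (\<lambda>x. x 0) n)"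
      using cc[OF shiftn shiftn]
      by (intro rv_entropy_mono prob_mu simple_function_orbit_word shift_measurable simple_function_coord)
         (auto simp: orbit_word_def space_mu)
  qed
  then have "ent = entropy_wrt \<mu> shift P"
    using entropy_wrt_eq[OF P] by (simp add: space_mu shift_in ent_def orbit_entropy_def)
  then show "ereal ent \<le> (SUP P\<in>finite_partitions \<mu>. ereal (entropy_wrt \<mu> shift P))"
    using P by (auto intro: SUP_upper2)
qed

end

lemma shift_measureI:
  assumes "subshift k X" "\<mu> \<in> invariant_measures X"
  shows "shift_measure k X \<mu>"
  using assms by (auto simp: shift_measure_def seq_measure_def shift_measure_axioms_def invariant_measures_def)

section \<open>Measures from cylinder probabilities\<close>

lemma mem_cyl_snoc: "x \<in> cyl (u @ [a]) \<longleftrightarrow> x \<in> cyl u \<and> x (length u) = a"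
proof -
  have "map x [0..<length (u @ [a])] = map x [0..<length u] @ [x (length u)]" by simp
  then show ?thesis unfolding cyl_def mem_Collect_eq by (simp only: append_same_eq append1_eq_conv)
qed

lemma mem_cyl_Cons: "x \<in> cyl (a # u) \<longleftrightarrow> x 0 = a \<and> shift x \<in> cyl u"
  by (auto simp: mem_cyl shift_def nth_Cons split: nat.split)

lemma cyl_disjoint: "length u = length v \<Longrightarrow> u \<noteq> v \<Longrightarrow> cyl u \<inter> cyl v = {}"
  by (auto simp: mem_cyl list_eq_iff_nth_eq)

lemma language_iff:
  assumes "subshift k X"
  shows "u \<in> language X \<longleftrightarrow> (\<exists>x\<in>X. x \<in> cyl u)"
proof
  assume "u \<in> language X"
  then obtain x i n where x: "x \<in> X" "u = map x [i..<i + n]" by (auto simp: language_def)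
  have "(shift ^^ i) x \<in> X"
    using assms x(1) by (induction i) (auto simp: subshift_def)
  moreover have "(shift ^^ i) x \<in> cyl u"
    unfolding x(2) by (auto simp: mem_cyl shift_funpow)
  ultimately show "\<exists>x\<in>X. x \<in> cyl u" by blast
next
  assume "\<exists>x\<in>X. x \<in> cyl u"
  then obtain x where "x \<in> X" "u = map x [0..<0 + length u]" by (auto simp: cyl_def)
  then show "u \<in> language X" unfolding language_def by blast
qed

text \<open>Every point outside the closed set X has a prefix that no point of X shares. The
  complement is thus a countable union of cylinders, which is how vanishing outside the language
  becomes full mass on X.\<close>

lemma compl_subshift:
  assumes "subshift k X"
  shows "- X = (\<Union>u\<in>- language X. cyl u)"
proof (intro equalityI subsetI)
  fix x assume "x \<in> - X"
  moreover have "open (- X)" using assms by (auto simp: subshift_def)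
  ultimately obtain n where "cyl (map x [0..<n]) \<subseteq> - X" using open_contains_cyl by blast
  then have "map x [0..<n] \<notin> language X" using language_iff[OF assms] by blast
  then show "x \<in> (\<Union>u\<in>- language X. cyl u)" using prefix_mem_cyl by blast
next
  fix x assume "x \<in> (\<Union>u\<in>- language X. cyl u)"
  then show "x \<in> - X" using language_iff[OF assms] by blast
qed

lemma language_words:
  assumes "subshift k X" "u \<in> language X"
  shows "u \<in> words k (length u)"
proof -
  obtain x i n where x: "x \<in> X" "u = map x [i..<i + n]" using assms(2) by (auto simp: language_def)
  then have "x j \<in> {1..k}" for j using assms(1) by (auto simp: subshift_def full_shift_def)
  then show ?thesis using x(2) by (auto simp: words_def)
qed

lemma wp_eq:
  assumes "sets M = sets (restrict_space borel X)"
  shows "wp M u = measure M (X \<inter> cyl u)"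
proof -
  have "{x \<in> space M. map x [0..<length u] = u} = X \<inter> cyl u"
    using sets_eq_imp_space_eq[OF assms] by (auto simp: cyl_def space_restrict_space)
  then show ?thesis by (simp add: wp_def)
qed

text \<open>Both measures are carried by the identity to the whole sequence space, where the
  cylinders generate and the mass of a cylinder is its word probability.\<close>

lemma restrict_measure_eqI:
  assumes X: "X \<in> sets borel" and M: "sets M = sets (restrict_space borel X)"
    and N: "sets N = sets (restrict_space borel X)"
    and "prob_space M" "prob_space N" and wp: "\<And>u. wp M u = wp N u"
  shows "M = N"
proof -
  interpret M: prob_space M by fact
  interpret N: prob_space N by fact
  have id: "(\<lambda>x. x) \<in> L \<rightarrow>\<^sub>M borel" if L: "sets L = sets (restrict_space borel X)" for L
    unfolding measurable_cong_sets[OF L refl] by (intro measurable_restrict_space1) simp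
  have sp: "space L = X" if "sets L = sets (restrict_space borel X)" for L
    using sets_eq_imp_space_eq[OF that] by (simp add: space_restrict_space)
  have cyl: "cyl u \<in> sets borel" for u using open_cyl by simp
  have "distr M borel (\<lambda>x. x) = distr N borel (\<lambda>x. x)"
  proof (rule measure_eq_of_cyl)
    show "prob_space (distr M borel (\<lambda>x. x))" "prob_space (distr N borel (\<lambda>x. x))"
      by (intro M.prob_space_distr N.prob_space_distr id M N)+
    fix u
    show "measure (distr M borel (\<lambda>x. x)) (cyl u) = measure (distr N borel (\<lambda>x. x)) (cyl u)"
      using wp[of u] measure_distr[OF id[OF M] cyl] measure_distr[OF id[OF N] cyl]
      by (simp add: wp_eq[OF M] wp_eq[OF N] sp[OF M] sp[OF N] Int_commute)
  qed auto
  then have eq: "emeasure (distr M borel (\<lambda>x. x)) A = emeasure (distr N borel (\<lambda>x. x)) A" for A by simp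
  show ?thesis
  proof (rule measure_eqI)
    show "sets M = sets N" using M N by simp
    fix A assume "A \<in> sets M"
    then have A: "A \<in> sets borel" "A \<subseteq> X" using X by (auto simp: M sets_restrict_space)
    have "A \<inter> X = A" using A by auto
    then show "emeasure M A = emeasure N A"
      using eq[of A] emeasure_distr[OF id[OF M] A(1)] emeasure_distr[OF id[OF N] A(1)]
      by (simp add: sp[OF M] sp[OF N])
  qed
qed

lemma wp_split:
  assumes sub: "subshift k X" and M: "sets M = sets (restrict_space borel X)" and "prob_space M"
  shows wp_snoc: "wp M u = (\<Sum>a\<in>{1..k}. wp M (u @ [a]))"
    and wp_shift: "measure M {x \<in> X. shift x \<in> cyl u} = (\<Sum>a\<in>{1..k}. wp M (a # u))"
proof -
  interpret prob_space M by fact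
  have X: "X \<in> sets borel" using sub by (auto simp: subshift_def)
  have s: "X \<inter> cyl u \<in> sets M" for u
    unfolding M sets_restrict_space using open_cyl by auto
  have range: "x i \<in> {1..k}" if "x \<in> X" for x i
    using sub that by (auto simp: subshift_def full_shift_def)
  have "X \<inter> cyl u = (\<Union>a\<in>{1..k}. X \<inter> cyl (u @ [a]))"
    using range unfolding mem_cyl_snoc by (auto simp: mem_cyl_snoc simp del: atLeastAtMost_iff)
  moreover have "measure M (\<Union>a\<in>{1..k}. X \<inter> cyl (u @ [a])) = (\<Sum>a\<in>{1..k}. measure M (X \<inter> cyl (u @ [a])))"
    using s by (intro finite_measure_finite_Union) (auto simp: disjoint_family_on_def mem_cyl_snoc)
  ultimately show "wp M u = (\<Sum>a\<in>{1..k}. wp M (u @ [a]))"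
    unfolding wp_eq[OF M] by metis
  have "{x \<in> X. shift x \<in> cyl u} = (\<Union>a\<in>{1..k}. X \<inter> cyl (a # u))"
    using range by (auto simp: mem_cyl_Cons simp del: atLeastAtMost_iff)
  moreover have "measure M (\<Union>a\<in>{1..k}. X \<inter> cyl (a # u)) = (\<Sum>a\<in>{1..k}. measure M (X \<inter> cyl (a # u)))"
    using s by (intro finite_measure_finite_Union) (auto simp: disjoint_family_on_def mem_cyl_Cons)
  ultimately show "measure M {x \<in> X. shift x \<in> cyl u} = (\<Sum>a\<in>{1..k}. wp M (a # u))"
    unfolding wp_eq[OF M] by metis
qed

text \<open>Summation over a last letter is the consistency required of a probability on sequences,
  summation over a first letter is invariance under the shift, and the support condition places the
  measure on X. All are closed conditions on finitely many coordinates each, hence preserved by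
  pointwise limits.\<close>

definition word_measures :: "nat \<Rightarrow> (nat \<Rightarrow> nat) set \<Rightarrow> (nat list \<Rightarrow> real) set" where
  "word_measures k X = {p. p [] = 1 \<and> (\<forall>u. 0 \<le> p u) \<and> (\<forall>u. u \<notin> language X \<longrightarrow> p u = 0)
     \<and> (\<forall>u. p u = (\<Sum>a\<in>{1..k}. p (u @ [a]))) \<and> (\<forall>u. p u = (\<Sum>a\<in>{1..k}. p (a # u)))}"

lemma word_measuresD:
  assumes "p \<in> word_measures k X"
  shows word_measures_Nil: "p [] = 1" and word_measures_nonneg: "0 \<le> p u"
    and word_measures_support: "u \<notin> language X \<Longrightarrow> p u = 0"
    and word_measures_snoc: "p u = (\<Sum>a\<in>{1..k}. p (u @ [a]))"
    and word_measures_Cons: "p u = (\<Sum>a\<in>{1..k}. p (a # u))"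
  using assms unfolding word_measures_def by blast+

lemma (in shift_measure) wp_word_measure: "wp \<mu> \<in> word_measures k X"
proof -
  interpret prob_space \<mu> by (rule prob_mu)
  have "wp \<mu> [] = 1" by (simp add: wp_def prob_space)
  moreover have "wp \<mu> u = 0" if "u \<notin> language X" for u
  proof -
    have "X \<inter> cyl u = {}" using that language_iff[OF subshift] by blast
    then show ?thesis unfolding wp_eq[OF sets_mu] by (simp only: measure_empty)
  qed
  moreover have "wp \<mu> u = (\<Sum>a\<in>{1..k}. wp \<mu> (a # u))" for u
  proof -
    have "wp \<mu> u = measure (distr \<mu> \<mu> shift) (X \<inter> cyl u)" by (simp add: wp_eq[OF sets_mu] distr_shift)
    also have "\<dots> = measure \<mu> (shift -` (X \<inter> cyl u) \<inter> space \<mu>)"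
      using open_cyl by (intro measure_distr shift_measurable in_sets_mu) simp
    also have "shift -` (X \<inter> cyl u) \<inter> space \<mu> = {x \<in> X. shift x \<in> cyl u}"
      by (auto simp: space_mu shift_in)
    finally show ?thesis using wp_shift[OF subshift sets_mu prob_mu] by simp
  qed
  moreover have "0 \<le> wp \<mu> u" for u by (simp add: wp_def)
  moreover note wp_snoc[OF subshift sets_mu prob_mu]
  ultimately show ?thesis unfolding word_measures_def by blast
qed

lemma word_measures_append:
  assumes "p \<in> word_measures k X"
  shows "p v = (\<Sum>w\<in>words k j. p (v @ w))"
proof (induction j)
  case 0
  have "words k 0 = {[]}" by (auto simp: words_def)
  then show ?case by simp
next
  case (Suc j)
  have snoc: "(\<Sum>a\<in>{1..k}. p (v @ w @ [a])) = p (v @ w)" for w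
    using word_measures_snoc[OF assms, of "v @ w", symmetric] by (simp only: append_assoc)
  have "(\<Sum>w\<in>words k (Suc j). p (v @ w)) = (\<Sum>(w, a)\<in>words k j \<times> {1..k}. p (v @ w @ [a]))"
  proof (rule sum.reindex_bij_witness[where i="\<lambda>(w, a). w @ [a]" and j="\<lambda>w. (butlast w, last w)"])
    fix w assume w: "w \<in> words k (Suc j)"
    then have ne: "w \<noteq> []" by (auto simp: words_def)
    have "set (butlast w) \<subseteq> set w" by (auto dest: in_set_butlastD)
    then show "(butlast w, last w) \<in> words k j \<times> {1..k}"
      using w last_in_set[OF ne] by (auto simp: words_def)
    show "(case (butlast w, last w) of (w, a) \<Rightarrow> w @ [a]) = w" using ne by simp
    show "(case (butlast w, last w) of (w, a) \<Rightarrow> p (v @ w @ [a])) = p (v @ w)" using ne by simp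
  qed (auto simp: words_def)
  also have "\<dots> = (\<Sum>w\<in>words k j. p (v @ w))"
    unfolding sum.cartesian_product[symmetric] snoc ..
  finally show ?case using Suc by simp
qed

lemma word_measures_sum_words:
  assumes "p \<in> word_measures k X"
  shows "(\<Sum>w\<in>words k n. p w) = 1"
  using word_measures_append[OF assms, of "[]" n] word_measures_Nil[OF assms] by simp

lemma word_measures_prepend:
  assumes "p \<in> word_measures k X"
  shows "p v = (\<Sum>w\<in>words k j. p (w @ v))"
proof (induction j)
  case 0
  have "words k 0 = {[]}" by (auto simp: words_def)
  then show ?case by simp
next
  case (Suc j)
  have cons: "(\<Sum>a\<in>{1..k}. p (a # w @ v)) = p (w @ v)" for w
    by (rule word_measures_Cons[OF assms, symmetric])
  have "(\<Sum>w\<in>words k (Suc j). p (w @ v)) = (\<Sum>(w, a)\<in>words k j \<times> {1..k}. p (a # w @ v))"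
  proof (rule sum.reindex_bij_witness[where i="\<lambda>(w, a). a # w" and j="\<lambda>w. (tl w, hd w)"])
    fix w assume w: "w \<in> words k (Suc j)"
    then obtain a w' where aw: "w = a # w'" by (cases w) (auto simp: words_def)
    show "(tl w, hd w) \<in> words k j \<times> {1..k}" "(case (tl w, hd w) of (w, a) \<Rightarrow> a # w) = w"
      "(case (tl w, hd w) of (w, a) \<Rightarrow> p (a # w @ v)) = p (w @ v)"
      using w aw by (auto simp: words_def)
  qed (auto simp: words_def)
  also have "\<dots> = (\<Sum>w\<in>words k j. p (w @ v))"
    unfolding sum.cartesian_product[symmetric] cons ..
  finally show ?case using Suc by simp
qed

text \<open>Stationarity in terms of words: the letters after the window are summed out by
  consistency on the right, those before it by consistency on the left.\<close>

lemma word_measures_window: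
  assumes p: "p \<in> word_measures k X" and w: "w \<in> words k r" and n: "i + r \<le> n"
  shows "(\<Sum>v\<in>{v\<in>words k n. take r (drop i v) = w}. p v) = p w"
proof -
  have "(\<Sum>v\<in>{v\<in>words k n. take r (drop i v) = w}. p v)
      = (\<Sum>(a, b)\<in>words k i \<times> words k (n - i - r). p (a @ w @ b))"
  proof (rule sum.reindex_bij_witness[where i="\<lambda>(a, b). a @ w @ b" and j="\<lambda>v. (take i v, drop (i + r) v)"])
    fix v assume "v \<in> {v\<in>words k n. take r (drop i v) = w}"
    then have v: "v \<in> words k n" "take r (drop i v) = w" by auto
    have "v = take i v @ take r (drop i v) @ drop r (drop i v)" by (simp only: append_take_drop_id)
    then have eq: "take i v @ w @ drop (i + r) v = v" using v(2) by (simp add: add.commute)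
    then show "(case (take i v, drop (i + r) v) of (a, b) \<Rightarrow> a @ w @ b) = v"
      "(case (take i v, drop (i + r) v) of (a, b) \<Rightarrow> p (a @ w @ b)) = p v" by simp_all
    show "(take i v, drop (i + r) v) \<in> words k i \<times> words k (n - i - r)"
      using v(1) n by (auto simp: words_def dest: in_set_takeD in_set_dropD)
  qed (use w n in \<open>auto simp: words_def\<close>)
  also have "\<dots> = (\<Sum>a\<in>words k i. p (a @ w))"
    unfolding sum.cartesian_product[symmetric]
    using word_measures_append[OF p, of "_ @ w" "n - i - r", symmetric] by simp
  also have "\<dots> = p w" by (rule word_measures_prepend[OF p, symmetric])
  finally show ?thesis .
qed

section \<open>Realizing consistent word probabilities by measures\<close>

lemma words_pmf_exists:
  fixes p :: "nat list \<Rightarrow> real"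
  assumes p0: "\<And>u. 0 \<le> p u" and p1: "(\<Sum>u\<in>words k n. p u) = 1"
  shows "\<exists>W. \<forall>A. measure (measure_pmf W) A = (\<Sum>u\<in>{u\<in>words k n. u \<in> A}. p u)"
proof (intro exI allI)
  define W where "W = embed_pmf (\<lambda>u. if u \<in> words k n then p u else 0)"
  have pmf_W: "pmf W u = (if u \<in> words k n then p u else 0)" for u
    unfolding W_def
  proof (rule pmf_embed_pmf)
    have "(\<integral>\<^sup>+ u. ennreal (if u \<in> words k n then p u else 0) \<partial>count_space UNIV)
        = (\<integral>\<^sup>+ u. ennreal (p u) * indicator (words k n) u \<partial>count_space UNIV)"
      by (intro nn_integral_cong) (auto simp: indicator_def)
    also have "\<dots> = (\<Sum>u\<in>words k n. ennreal (p u))"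
      by (simp add: nn_integral_count_space_indicator[symmetric] nn_integral_count_space_finite)
    also have "\<dots> = 1" using p1 p0 by (simp add: sum_ennreal)
    finally show "(\<integral>\<^sup>+ u. ennreal (if u \<in> words k n then p u else 0) \<partial>count_space UNIV) = 1" .
  qed (use p0 in auto)
  fix A
  have "set_pmf W \<subseteq> words k n" by (auto simp: set_pmf_iff pmf_W split: if_splits)
  then have "measure W A = measure W {u\<in>words k n. u \<in> A}"
    by (intro measure_eq_AE) (auto simp: AE_measure_pmf_iff)
  also have "\<dots> = (\<Sum>u\<in>{u\<in>words k n. u \<in> A}. pmf W u)"
    by (intro measure_measure_pmf_finite) simp
  finally show "measure W A = (\<Sum>u\<in>{u\<in>words k n. u \<in> A}. p u)" by (simp add: pmf_W)
qed

text \<open>The finite-dimensional laws are those of the letters of a random word long enough to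
  contain the coordinates in question. Symbols are viewed as real numbers for the projective limit
  and decoded afterwards.\<close>

lemma kolmogorov_extension:
  assumes p: "p \<in> word_measures k X"
  obtains \<mu> where "prob_space \<mu>" "sets \<mu> = sets (borel :: (nat \<Rightarrow> nat) measure)"
    "\<And>u. set u \<subseteq> {1..k} \<Longrightarrow> measure \<mu> (cyl u) = p u"
proof -
  note p0 = word_measures_nonneg[OF p]
  have "\<forall>n. \<exists>W. \<forall>A. measure (measure_pmf W) A = (\<Sum>u\<in>{u\<in>words k n. u \<in> A}. p u)"
    by (intro allI words_pmf_exists p0 word_measures_sum_words[OF p])
  from choice[OF this] obtain W :: "nat \<Rightarrow> nat list pmf"
    where W_set: "\<And>n A. measure (W n) A = (\<Sum>u\<in>{u\<in>words k n. u \<in> A}. p u)" by blast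
  have pmf_W: "pmf (W n) u = (if u \<in> words k n then p u else 0)" for n u
  proof -
    have "{v \<in> words k n. v \<in> {u}} = (if u \<in> words k n then {u} else {})" by auto
    then show ?thesis using W_set[of n "{u}"] by (simp add: measure_pmf_single)
  qed
  have W_take: "map_pmf (take n) (W m) = W n" if "n \<le> m" for n m
  proof (rule pmf_eqI)
    fix v
    have "pmf (map_pmf (take n) (W m)) v = (\<Sum>u\<in>{u\<in>words k m. take n u = v}. p u)"
      by (simp add: pmf_map W_set vimage_def)
    also have "\<dots> = pmf (W n) v"
    proof (cases "v \<in> words k n")
      case True
      then show ?thesis using word_measures_window[OF p True, of 0 m] that by (simp add: pmf_W)
    next
      case False
      have "take n u \<in> words k n" if "u \<in> words k m" for u
        using that \<open>n \<le> m\<close> by (auto simp: words_def dest: in_set_takeD)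
      then have "{u\<in>words k m. take n u = v} = {}" using False by auto
      then show ?thesis using False unfolding pmf_W by (simp only: sum.empty if_False)
    qed
    finally show "pmf (map_pmf (take n) (W m)) v = pmf (W n) v" .
  qed
  \<comment> \<open>A word length exceeding every index in \<open>J\<close>; inserting 0 makes the
    maximum meaningful for empty \<open>J\<close>.\<close>
  define N where "N J = Suc (Max (insert 0 J))" for J :: "nat set"
  have N: "i < N J" if "finite J" "i \<in> J" for i J
    unfolding N_def using that by (auto simp: less_Suc_eq_le)
  have N_mono: "N J \<le> N H" if "finite H" "J \<subseteq> H" for J H
    unfolding N_def using that by (auto intro!: Max_mono)
  define f where "f J u = (\<lambda>i\<in>J. real (u ! i))" for J :: "nat set" and u :: "nat list"
  have f: "f J \<in> measure_pmf q \<rightarrow>\<^sub>M PiM J (\<lambda>_. borel)" for J and q :: "nat list pmf"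
    unfolding f_def by (auto simp: space_PiM)
  define P where "P J = distr (W (N J)) (PiM J (\<lambda>_. borel :: real measure)) (f J)" for J
  have P_eq: "P J = distr (W n) (PiM J (\<lambda>_. borel)) (f J)" if "finite J" "N J \<le> n" for J n
  proof -
    have "P J = distr (distr (W n) (count_space UNIV) (take (N J))) (PiM J (\<lambda>_. borel)) (f J)"
      unfolding P_def W_take[OF that(2), symmetric] map_pmf_rep_eq ..
    also have "\<dots> = distr (W n) (PiM J (\<lambda>_. borel)) (f J \<circ> take (N J))"
      by (intro distr_distr) (auto simp: f_def space_PiM)
    also have "f J \<circ> take (N J) = f J"
      using N[OF that(1)] by (auto simp: f_def fun_eq_iff restrict_def)
    finally show ?thesis .
  qed
  have prob_P: "prob_space (P J)" for J
    unfolding P_def by (intro prob_space.prob_space_distr f prob_space_measure_pmf)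
  interpret polish_projective UNIV P
  proof (intro polish_projective.intro projective_family.intro)
    fix J H :: "nat set" assume JH: "J \<subseteq> H" "finite H" "H \<subseteq> UNIV"
    have finJ: "finite J" using JH finite_subset by auto
    have "distr (P H) (PiM J (\<lambda>_. borel)) (\<lambda>g. restrict g J)
        = distr (W (N H)) (PiM J (\<lambda>_. borel)) ((\<lambda>g. restrict g J) \<circ> f H)"
      unfolding P_def using JH by (intro distr_distr measurable_restrict_subset f) auto
    also have "(\<lambda>g. restrict g J) \<circ> f H = f J"
      using JH by (auto simp: f_def fun_eq_iff restrict_def)
    also have "distr (W (N H)) (PiM J (\<lambda>_. borel)) (f J) = P J"
      using P_eq[OF finJ N_mono[OF JH(2,1)]] by simp
    finally show "P J = distr (P H) (PiM J (\<lambda>_. borel)) (\<lambda>g. restrict g J)" by (rule sym)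
  qed (rule prob_P)
  \<comment> \<open>The floor inverts the embedding of symbols into the reals.\<close>
  define \<mu> where "\<mu> = distr lim borel (\<lambda>g i. nat \<lfloor>g i\<rfloor> :: nat)"
  have g: "(\<lambda>g i. nat \<lfloor>g i\<rfloor>) \<in> lim \<rightarrow>\<^sub>M (borel :: (nat \<Rightarrow> nat) measure)"
  proof (rule measurable_coordinatewise_then_product)
    fix i :: nat
    have "(\<lambda>g. g i) \<in> lim \<rightarrow>\<^sub>M (borel :: real measure)"
      unfolding measurable_cong_sets[OF sets_lim refl] by (rule measurable_component_singleton) simp
    then show "(\<lambda>g. nat \<lfloor>g i\<rfloor>) \<in> borel_measurable lim"
      by measurable
  qed
  show thesis
  proof
    show "prob_space \<mu>" unfolding \<mu>_def by (intro P.prob_space_distr g)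
    show "sets \<mu> = sets borel" by (simp add: \<mu>_def)
    fix u :: "nat list" assume u: "set u \<subseteq> {1..k}"
    define n where "n = length u"
    define A where "A = PiE {..<n} (\<lambda>i. {t :: real. nat \<lfloor>t\<rfloor> = u ! i})"
    have "{t :: real. nat \<lfloor>t\<rfloor> = c} \<in> sets borel" for c by measurable
    then have A: "A \<in> sets (PiM {..<n} (\<lambda>_. borel))" unfolding A_def by (intro sets_PiM_I_finite) auto
    have "measure \<mu> (cyl u) = measure lim ((\<lambda>g i. nat \<lfloor>g i\<rfloor>) -` cyl u \<inter> space lim)"
      unfolding \<mu>_def using open_cyl by (intro measure_distr g) simp
    also have "(\<lambda>g i. nat \<lfloor>g i\<rfloor>) -` cyl u \<inter> space lim = emb UNIV {..<n} A"
      by (auto simp: prod_emb_def A_def mem_cyl n_def space_PiM)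
    also have "measure lim (emb UNIV {..<n} A) = measure (P {..<n}) A"
      using A by (intro measure_lim_emb) auto
    also have "P {..<n} = distr (W (max n (N {..<n}))) (PiM {..<n} (\<lambda>_. borel)) (f {..<n})"
      by (intro P_eq) auto
    also have "measure \<dots> A = measure (W (max n (N {..<n}))) (f {..<n} -` A)"
      using measure_distr[OF f A] by simp
    also have "f {..<n} -` A = {v. \<forall>i<n. v ! i = u ! i}"
    proof -
      have "f {..<n} v \<in> A \<longleftrightarrow> (\<forall>i<n. v ! i = u ! i)" for v
        unfolding A_def f_def PiE_iff by auto
      then show ?thesis by (simp add: vimage_def)
    qed
    also have "measure (W (max n (N {..<n}))) {v. \<forall>i<n. v ! i = u ! i}
        = (\<Sum>v\<in>{v\<in>words k (max n (N {..<n})). take n v = u}. p v)"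
      unfolding W_set
    proof (intro sum.cong refl Collect_cong conj_cong)
      fix v assume "v \<in> words k (max n (N {..<n}))"
      then have "length v \<ge> n" by (auto simp: words_def)
      then show "v \<in> {v. \<forall>i<n. v ! i = u ! i} \<longleftrightarrow> take n v = u"
        using list_eq_iff_nth_eq[of "take n v" u] by (auto simp: n_def)
    qed
    also have "\<dots> = p u"
      using word_measures_window[OF p, of u n 0 "max n (N {..<n})"] u by (simp add: words_def n_def)
    finally show "measure \<mu> (cyl u) = p u" .
  qed
qed

lemma word_measure_realized:
  assumes sub: "subshift k X" and p: "p \<in> word_measures k X"
  obtains \<mu> where "\<mu> \<in> invariant_measures X" "wp \<mu> = p"
proof -
  obtain \<nu> where \<nu>: "prob_space \<nu>" "sets \<nu> = sets (borel :: (nat \<Rightarrow> nat) measure)"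
    "\<And>u. set u \<subseteq> {1..k} \<Longrightarrow> measure \<nu> (cyl u) = p u" using kolmogorov_extension[OF p] by blast
  interpret \<nu>: prob_space \<nu> by fact
  have space: "space \<nu> = UNIV" using sets_eq_imp_space_eq[OF \<nu>(2)] by simp
  have X: "X \<in> sets borel" using sub by (auto simp: subshift_def)
  have cyl_sets: "cyl u \<in> sets \<nu>" for u using open_cyl \<nu>(2) by simp
  have total: "(\<Sum>u\<in>words k n. measure \<nu> (cyl u)) = 1" for n
    using word_measures_sum_words[OF p, of n] \<nu>(3) by (simp add: words_def)
  \<comment> \<open>For a word with a symbol outside the alphabet the extension says nothing, but
    the disjoint cylinders of the alphabet words of the same length already have total mass
    1.\<close>
  have null: "measure \<nu> (cyl u) = p u" for u
  proof (cases "set u \<subseteq> {1..k}")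
    case False
    have "u \<notin> language X" using False language_words[OF sub, of u] by (auto simp: words_def)
    then have "p u = 0" by (rule word_measures_support[OF p])
    have "cyl u \<inter> cyl v = {}" if "v \<in> words k (length u)" for v
      using that False by (intro cyl_disjoint) (auto simp: words_def)
    then have "cyl u \<inter> (\<Union>v\<in>words k (length u). cyl v) = {}" by blast
    moreover have "measure \<nu> (\<Union>v\<in>words k (length u). cyl v) = (\<Sum>v\<in>words k (length u). measure \<nu> (cyl v))"
    proof (rule \<nu>.finite_measure_finite_Union)
      show "disjoint_family_on cyl (words k (length u))"
        unfolding disjoint_family_on_def by (intro ballI impI cyl_disjoint) (auto simp: words_def)
    qed (use cyl_sets in auto)
    ultimately have "measure \<nu> (cyl u \<union> (\<Union>v\<in>words k (length u). cyl v)) = measure \<nu> (cyl u) + 1"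
      using cyl_sets by (subst \<nu>.finite_measure_Union) (auto simp: total)
    then have "measure \<nu> (cyl u) \<le> 0" using \<nu>.prob_le_1[of "cyl u \<union> (\<Union>v\<in>words k (length u). cyl v)"] by simp
    then show ?thesis using \<open>p u = 0\<close> measure_nonneg[of \<nu> "cyl u"] by linarith
  qed (rule \<nu>(3))
  have "emeasure \<nu> (- X) = 0"
  proof -
    have "(\<Union>u\<in>- language X. cyl u) \<in> null_sets \<nu>"
    proof (rule null_sets_UN')
      fix u assume "u \<in> - language X"
      then have "p u = 0" using word_measures_support[OF p] by simp
      then show "cyl u \<in> null_sets \<nu>" using null cyl_sets by (auto simp: \<nu>.emeasure_eq_measure)
    qed auto
    then show ?thesis unfolding compl_subshift[OF sub] by auto
  qed
  then have "measure \<nu> (- X) = 0" by (simp add: measure_def)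
  have XX: "measure \<nu> (X \<inter> B) = measure \<nu> B" if "B \<in> sets borel" for B
  proof -
    have "measure \<nu> B = measure \<nu> (X \<inter> B) + measure \<nu> (B - X)"
      using that X \<nu>(2) by (subst \<nu>.finite_measure_Union[symmetric]) (auto intro!: arg_cong[where f="measure \<nu>"])
    moreover have "measure \<nu> (B - X) \<le> measure \<nu> (- X)"
      using X \<nu>(2) that by (intro \<nu>.finite_measure_mono) auto
    ultimately show ?thesis using \<open>measure \<nu> (- X) = 0\<close> measure_nonneg[of \<nu> "B - X"] by linarith
  qed
  define \<mu> where "\<mu> = restrict_space \<nu> X"
  have sets: "sets \<mu> = sets (restrict_space borel X)"
    unfolding \<mu>_def using \<nu>(2) by (simp add: sets_restrict_space)
  have m: "measure \<mu> (X \<inter> B) = measure \<nu> B" if "B \<in> sets borel" for B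
    unfolding \<mu>_def using XX[OF that] X \<nu>(2) space by (subst measure_restrict_space) auto
  have space_mu: "space \<mu> = X" using sets_eq_imp_space_eq[OF sets] by (simp add: space_restrict_space)
  have prob: "prob_space \<mu>"
  proof
    have "measure \<nu> X = 1" using XX[of UNIV] \<nu>.prob_space space by simp
    then show "emeasure \<mu> (space \<mu>) = 1"
      unfolding space_mu \<mu>_def using X \<nu>(2) space by (subst emeasure_restrict_space) (auto simp: \<nu>.emeasure_eq_measure)
  qed
  have wp: "wp \<mu> u = p u" for u
    unfolding wp_eq[OF sets] using m[of "cyl u"] open_cyl null by simp
  note meas = shift_measurable_restrict[OF sub sets]
  have "distr \<mu> \<mu> shift = \<mu>"
  proof (rule restrict_measure_eqI[OF X])
    show "prob_space (distr \<mu> \<mu> shift)" using prob meas by (rule prob_space.prob_space_distr)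
    fix u
    have "wp (distr \<mu> \<mu> shift) u = measure (distr \<mu> \<mu> shift) (X \<inter> cyl u)"
      using sets by (intro wp_eq) simp
    also have "\<dots> = measure \<mu> (shift -` (X \<inter> cyl u) \<inter> space \<mu>)"
      using open_cyl by (intro measure_distr meas) (auto simp: sets sets_restrict_space)
    also have "shift -` (X \<inter> cyl u) \<inter> space \<mu> = {x \<in> X. shift x \<in> cyl u}"
      using sub by (auto simp: space_mu subshift_def)
    also have "measure \<mu> \<dots> = (\<Sum>a\<in>{1..k}. p (a # u))"
      using wp_shift[OF sub sets prob] wp by simp
    also have "\<dots> = p u" by (rule word_measures_Cons[OF p, symmetric])
    finally show "wp (distr \<mu> \<mu> shift) u = wp \<mu> u" using wp by simp
  qed (use sets prob in auto)
  then have "\<mu> \<in> invariant_measures X" using sets prob by (simp add: invariant_measures_def)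
  then show thesis using wp that by blast
qed

section \<open>Compactness, extreme points and continuity of t ln t\<close>

lemma compact_unit_functions: "compact (PiE UNIV (\<lambda>_. {0..1}) :: ('a::countable \<Rightarrow> real) set)"
proof -
  have "compactin (product_topology (\<lambda>_::'a. euclideanreal) UNIV) (PiE UNIV (\<lambda>_. {0..1}))"
    by (subst compactin_PiE) auto
  then show ?thesis by (simp add: euclidean_product_topology)
qed

lemma tendsto_coordinatewise:
  fixes p :: "'a::countable \<Rightarrow> real"
  assumes "(f \<longlongrightarrow> p) F" shows "((\<lambda>n. f n u) \<longlongrightarrow> p u) F"
  using continuous_on_tendsto_compose[OF continuous_on_product_coordinates assms] by simp

lemma convergent_subsequence:
  fixes P :: "nat \<Rightarrow> 'a::countable \<Rightarrow> real"
  assumes "\<And>n u. 0 \<le> P n u" "\<And>n u. P n u \<le> 1"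
  obtains p r where "strict_mono (r :: nat \<Rightarrow> nat)" "\<And>u. (\<lambda>n. P (r n) u) \<longlonglongrightarrow> p u"
proof -
  have "seq_compact (PiE UNIV (\<lambda>_. {0..1}) :: ('a \<Rightarrow> real) set)"
    using compact_unit_functions by (simp add: compact_eq_seq_compact_metric)
  moreover have "\<forall>n. P n \<in> PiE UNIV (\<lambda>_. {0..1})" using assms by auto
  ultimately obtain p r where r: "strict_mono r" "(P \<circ> r) \<longlonglongrightarrow> p"
    unfolding seq_compact_def by blast
  show thesis
    by (rule that[OF r(1)]) (use tendsto_coordinatewise[OF r(2)] in \<open>simp add: comp_def\<close>)
qed

text \<open>Maximizing one coordinate after the other leaves a single point.\<close>

lemma exists_extreme_point:
  fixes K :: "('a::countable \<Rightarrow> real) set"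
  assumes "compact K" "K \<noteq> {}"
  obtains p where "p \<in> K"
    "\<And>q1 q2 c. \<lbrakk>q1 \<in> K; q2 \<in> K; 0 < c; c < 1; \<And>u. p u = c * q1 u + (1 - c) * q2 u\<rbrakk> \<Longrightarrow> q1 = p"
proof -
  \<comment> \<open>Coordinates are processed in the order of \<open>to_nat\<close>; a number that
    encodes nothing imposes no condition.\<close>
  define F where "F = rec_nat K (\<lambda>j S. {p \<in> S. \<forall>q\<in>S. \<forall>u. to_nat u = j \<longrightarrow> q u \<le> p u})"
  have F0: "F 0 = K" and FS: "F (Suc j) = {p \<in> F j. \<forall>q\<in>F j. \<forall>u. to_nat u = j \<longrightarrow> q u \<le> p u}" for j
    by (simp_all add: F_def)
  have F: "compact (F j) \<and> F j \<noteq> {}" for j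
  proof (induction j)
    case (Suc j)
    show ?case
    proof (cases "\<exists>u::'a. to_nat u = j")
      case False
      then have "F (Suc j) = F j" by (auto simp: FS)
      then show ?thesis using Suc by simp
    next
      case True
      then obtain u :: 'a where u: "to_nat u = j" by blast
      have u': "to_nat w = j \<longleftrightarrow> w = u" for w using u[symmetric] by simp
      have "continuous_on (F j) (\<lambda>p. p u)"
        by (rule continuous_on_subset[OF continuous_on_product_coordinates subset_UNIV])
      with Suc obtain p where p: "p \<in> F j" "\<forall>q\<in>F j. q u \<le> p u"
        using continuous_attains_sup[of "F j" "\<lambda>p. p u"] by auto
      have "F (Suc j) = F j \<inter> {q. p u \<le> q u}"
        using p by (auto simp: FS u' intro: order_trans)
      moreover have "closed {q :: 'a \<Rightarrow> real. p u \<le> q u}"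
        by (intro closed_Collect_le continuous_on_const continuous_on_product_coordinates)
      ultimately show ?thesis using Suc p by (auto intro: compact_Int_closed)
    qed
  qed (use assms F0 in simp)
  have mono: "F n \<subseteq> F m" if "m \<le> n" for m n
    using that by (induction rule: dec_induct) (auto simp: FS)
  have "K \<inter> \<Inter>(range F) \<noteq> {}"
  proof (rule compact_imp_fip_image[OF assms(1)])
    show "closed (F j)" for j using F by (simp add: compact_imp_closed)
    fix J :: "nat set" assume "finite J" "J \<subseteq> UNIV"
    then obtain m where m: "\<forall>j\<in>J. j \<le> m" using finite_nat_set_iff_bounded_le by blast
    have "F m \<subseteq> K \<inter> \<Inter>(F ` J)" using mono[of _ m] mono[of 0 m] m F0 by auto
    moreover have "F m \<noteq> {}" using F by blast
    ultimately show "K \<inter> \<Inter>(F ` J) \<noteq> {}" by blast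
  qed
  then obtain p where p: "\<And>j. p \<in> F j" by auto
  show thesis
  proof (rule that[of p])
    show "p \<in> K" using p[of 0] F0 by simp
    fix q1 q2 c assume q: "q1 \<in> K" "q2 \<in> K" "0 < c" "c < (1::real)" "\<And>u. p u = c * q1 u + (1 - c) * q2 u"
    have eq: "q1 u = p u \<and> q2 u = p u" if "q1 \<in> F (to_nat u)" "q2 \<in> F (to_nat u)" for u
    proof -
      have "p \<in> F (Suc (to_nat u))" by (rule p)
      then have le: "q1 u \<le> p u" "q2 u \<le> p u" using that by (auto simp: FS)
      \<comment> \<open>Two nonnegative deficits with weighted mean 0 both vanish, so neither point
        is lost at this stage.\<close>
      have "c * (p u - q1 u) + (1 - c) * (p u - q2 u) = 0" using q(5)[of u] by (simp add: algebra_simps)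
      moreover have "0 \<le> c * (p u - q1 u)" "0 \<le> (1 - c) * (p u - q2 u)" using le q by auto
      ultimately have "c * (p u - q1 u) = 0" "(1 - c) * (p u - q2 u) = 0" by linarith+
      then show ?thesis using q by auto
    qed
    have "q1 \<in> F j \<and> q2 \<in> F j" for j
    proof (induction j)
      case (Suc j)
      have "p \<in> F (Suc j)" by (rule p)
      then show ?case using Suc eq by (auto simp: FS)
    qed (use q F0 in simp)
    then show "q1 = p" using eq by auto
  qed
qed

text \<open>At a = 0 the logarithm is not continuous; there the square root bound forces convergence
  to 0, which is also the value of \<open>a * ln a\<close>.\<close>

lemma tendsto_mult_ln:
  fixes f :: "'a \<Rightarrow> real"
  assumes f: "(f \<longlongrightarrow> a) F" and nn: "\<And>n. 0 \<le> f n" and a: "0 \<le> a"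
  shows "((\<lambda>n. f n * ln (f n)) \<longlongrightarrow> a * ln a) F"
proof (cases "a = 0")
  case False
  then show ?thesis using f by (intro tendsto_mult tendsto_ln)
next
  case True
  have "((\<lambda>n. 2 * sqrt (f n)) \<longlongrightarrow> 2 * sqrt a) F" using f by (intro tendsto_intros)
  moreover have "\<forall>\<^sub>F n in F. norm (f n * ln (f n)) \<le> 2 * sqrt (f n)"
  proof -
    have "\<forall>\<^sub>F n in F. f n < 1" using f True by (intro order_tendstoD) auto
    then show ?thesis
    proof eventually_elim
      case (elim n)
      have "f n * ln (f n) \<le> 0"
        using elim nn[of n] by (cases "f n = 0") (auto intro!: mult_nonneg_nonpos)
      then show ?case using neg_mult_ln_le_sqrt[OF nn[of n]] by simp
    qed
  qed
  ultimately show ?thesis using True by (auto intro: Lim_null_comparison)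
qed

lemma expectation_compose:
  fixes g :: "'b \<Rightarrow> real"
  assumes M: "prob_space M" and X: "simple_function M X" and S: "finite S" "X ` space M \<subseteq> S"
  shows "(\<integral>x. g (X x) \<partial>M) = (\<Sum>v\<in>S. pr M X v * g v)"
proof -
  interpret prob_space M by fact
  have "(\<integral>x. g (X x) \<partial>M) = (\<integral>x. (\<Sum>v\<in>S. g v * indicator {x \<in> space M. X x = v} x) \<partial>M)"
  proof (rule Bochner_Integration.integral_cong[OF refl])
    fix x assume x: "x \<in> space M"
    have "(\<Sum>v\<in>S. g v * indicator {x \<in> space M. X x = v} x) = (\<Sum>v\<in>{X x}. g v * indicator {x \<in> space M. X x = v} x)"
      using x S by (intro sum.mono_neutral_right) (auto simp: indicator_def)
    then show "g (X x) = (\<Sum>v\<in>S. g v * indicator {x \<in> space M. X x = v} x)" using x by simp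
  qed
  also have "\<dots> = (\<Sum>v\<in>S. \<integral>x. g v * indicator {x \<in> space M. X x = v} x \<partial>M)"
    using simple_function_sets[OF X] by (intro Bochner_Integration.integral_sum) (auto simp: emeasure_eq_measure)
  also have "\<dots> = (\<Sum>v\<in>S. pr M X v * g v)"
    using simple_function_sets[OF X] by (intro sum.cong) (auto simp: pr_def mult.commute)
  finally show ?thesis .
qed

section \<open>Block entropies of orbit averages\<close>

lemma card_words: "card (words k n) = k ^ n"
proof -
  have "card (words k n) = card {1..k} ^ n"
    unfolding words_def by (rule card_lists_length_eq) simp
  then show ?thesis by simp
qed

lemma word_entropy_le:
  assumes M: "prob_space M" and Z: "\<And>i. simple_function M (Z i)"
    and range: "\<And>x i. x \<in> space M \<Longrightarrow> Z i x \<in> {1..k}"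
  shows "rv_entropy M (\<lambda>x. map (\<lambda>j. Z j x) [a..<a + r]) \<le> real r * ln (real k)"
proof -
  have "rv_entropy M (\<lambda>x. map (\<lambda>j. Z j x) [a..<a + r]) \<le> ln (real (card (words k r)))"
    using range by (intro rv_entropy_le_card M simple_function_map[of M Z, OF Z] finite_words) (auto simp: words_def)
  moreover have "k > 0" using range prob_space.not_empty[OF M] by fastforce
  ultimately show ?thesis by (simp add: card_words ln_realpow)
qed

text \<open>Misiurewicz's argument: cut the word of length \<open>n\<close> into blocks of length \<open>q\<close> at each of the
  \<open>q\<close> possible offsets, and bound the sum of the block entropies by concavity.\<close>

lemma block_average_entropy:
  assumes M: "prob_space M" and Z: "\<And>i. simple_function M (Z i)"
    and range: "\<And>x i. x \<in> space M \<Longrightarrow> Z i x \<in> {1..k}" and n: "n > 0" and q: "q > 0"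
  defines "A \<equiv> \<lambda>w. (\<Sum>i<n. pr M (\<lambda>x. map (\<lambda>j. Z j x) [i..<i + q]) w) / real n"
  shows "real q * rv_entropy M (\<lambda>x. map (\<lambda>j. Z j x) [0..<n])
    \<le> real n * - (\<Sum>w\<in>words k q. A w * ln (A w)) + 2 * (real q)\<^sup>2 * ln (real k)"
proof -
  let ?H = "\<lambda>a b. rv_entropy M (\<lambda>x. map (\<lambda>j. Z j x) [a..<b])"
  define T where "T = n div q"
  have k: "k > 0" using range prob_space.not_empty[OF M] by fastforce
  note H_le = word_entropy_le[of M Z k, OF M Z range]
  note split = rv_entropy_block_le[of M Z, OF M Z]
  have mono: "?H 0 n \<le> ?H 0 m" if "n \<le> m" for m
  proof (rule rv_entropy_mono[OF M simple_function_map[of M Z, OF Z]])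
    fix x y assume "map (\<lambda>j. Z j x) [0..<m] = map (\<lambda>j. Z j y) [0..<m]"
    then show "map (\<lambda>j. Z j x) [0..<n] = map (\<lambda>j. Z j y) [0..<n]"
      using that by auto
  qed
  have blocks: "?H j (j + t * q) \<le> (\<Sum>s<t. ?H (j + s * q) (j + s * q + q))" for j t
  proof (induction t)
    case 0
    show ?case using H_le[of j 0] by simp
  next
    case (Suc t)
    have "?H j (j + t * q + q) \<le> ?H j (j + t * q) + ?H (j + t * q) (j + t * q + q)"
      by (rule split) auto
    moreover have eq: "j + Suc t * q = j + t * q + q" by simp
    ultimately show ?case unfolding sum.lessThan_Suc eq using Suc by linarith
  qed
  \<comment> \<open>Offset j leaves an initial piece of length j < q and a last block of length q,
    each costing at most q ln k. The last block may run past n, which is harmless because the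
    variables exist for all indices.\<close>
  have one: "?H 0 n \<le> (\<Sum>s<T. ?H (j + s * q) (j + s * q + q)) + 2 * real q * ln (real k)" if j: "j < q" for j
  proof -
    have "n = T * q + n mod q" by (simp add: T_def)
    moreover have "n mod q < q" using q by simp
    ultimately have "n \<le> j + T * q + q" by linarith
    then have "?H 0 n \<le> ?H 0 (j + T * q + q)" by (rule mono)
    also have "\<dots> \<le> ?H 0 j + ?H j (j + T * q + q)" by (rule split) auto
    also have "?H j (j + T * q + q) \<le> ?H j (j + T * q) + ?H (j + T * q) (j + T * q + q)" by (rule split) auto
    also have "?H (j + T * q) (j + T * q + q) \<le> real q * ln (real k)" by (rule H_le)
    also have "?H 0 j \<le> real q * ln (real k)"
    proof -
      have "real j * ln (real k) \<le> real q * ln (real k)"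
        using j k by (intro mult_right_mono) auto
      then show ?thesis using H_le[of 0 j] by simp
    qed
    also have "?H j (j + T * q) \<le> (\<Sum>s<T. ?H (j + s * q) (j + s * q + q))" by (rule blocks)
    finally show ?thesis by simp
  qed
  have "real q * ?H 0 n = (\<Sum>j<q. ?H 0 n)" by simp
  also have "\<dots> \<le> (\<Sum>j<q. (\<Sum>s<T. ?H (j + s * q) (j + s * q + q)) + 2 * real q * ln (real k))"
    using one by (intro sum_mono) auto
  also have "\<dots> = (\<Sum>j<q. \<Sum>s<T. ?H (j + s * q) (j + s * q + q)) + 2 * (real q)\<^sup>2 * ln (real k)"
    by (simp add: sum.distrib power2_eq_square)
  \<comment> \<open>Offset j and block number s give the starting position j + s q, and each
    position below T q arises exactly once.\<close>
  also have "(\<Sum>j<q. \<Sum>s<T. ?H (j + s * q) (j + s * q + q)) = (\<Sum>i<T * q. ?H i (i + q))"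
  proof -
    have "(\<Sum>j<q. \<Sum>s<T. ?H (j + s * q) (j + s * q + q)) = (\<Sum>s<T. \<Sum>j<q. ?H (j + s * q) (j + s * q + q))"
      by (rule sum.swap)
    also have "\<dots> = (\<Sum>i<T * q. ?H i (i + q))"
    proof -
      have "(\<Sum>j<q. g (j + s * q)) = sum g {s * q..<s * q + q}" for g :: "nat \<Rightarrow> real" and s
        using sum.shift_bounds_nat_ivl[of g 0 "s * q" q] by (simp add: atLeast0LessThan add.commute)
      from this[of "\<lambda>i. ?H i (i + q)"] show ?thesis
        using sum.nat_group[of "\<lambda>i. ?H i (i + q)" q T] by simp
    qed
    finally show ?thesis .
  qed
  also have "\<dots> \<le> (\<Sum>i<n. ?H i (i + q))"
  proof (rule sum_mono2)
    show "{..<T * q} \<subseteq> {..<n}" by (auto simp: T_def intro: order_less_le_trans)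
  qed (auto intro: rv_entropy_nonneg M)
  \<comment> \<open>Gibbs against the averaged law \<open>A\<close>, the same for all positions;
    this is concavity of entropy.\<close>
  also have "\<dots> \<le> (\<Sum>i<n. - (\<Sum>w\<in>words k q. pr M (\<lambda>x. map (\<lambda>j. Z j x) [i..<i + q]) w * ln (A w)))"
  proof (rule sum_mono)
    fix i assume i: "i \<in> {..<n}"
    let ?p = "\<lambda>i. pr M (\<lambda>x. map (\<lambda>j. Z j x) [i..<i + q])"
    have sub: "(\<lambda>x. map (\<lambda>j. Z j x) [i..<i + q]) ` space M \<subseteq> words k q" for i
      using range by (auto simp: words_def)
    have s1: "(\<Sum>w\<in>words k q. ?p i w) = 1" for i
      by (rule sum_pr[OF M simple_function_map[of M Z, OF Z] finite_words sub])
    have "?H i (i + q) = - (\<Sum>w\<in>words k q. ?p i w * ln (?p i w))"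
      by (rule rv_entropy_superset[OF finite_words sub])
    also have "\<dots> \<le> - (\<Sum>w\<in>words k q. ?p i w * ln (A w))"
    proof (rule gibbs)
      have "(\<Sum>w\<in>words k q. A w) = (\<Sum>i<n. \<Sum>w\<in>words k q. ?p i w) / real n"
        unfolding A_def sum_divide_distrib[symmetric] by (subst sum.swap) simp
      also have "\<dots> = 1" using n by (simp add: s1)
      finally show "(\<Sum>w\<in>words k q. A w) \<le> (\<Sum>w\<in>words k q. ?p i w)" by (simp add: s1)
      show "0 \<le> A w" for w unfolding A_def by (simp add: sum_nonneg)
      show "0 < A w" if "0 < ?p i w" for w
      proof -
        have "?p i w \<le> (\<Sum>i<n. ?p i w)" using i by (intro member_le_sum) auto
        then show ?thesis using that n by (simp add: A_def)
      qed
    qed auto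
    finally show "?H i (i + q) \<le> - (\<Sum>w\<in>words k q. ?p i w * ln (A w))" .
  qed
  also have "\<dots> = real n * - (\<Sum>w\<in>words k q. A w * ln (A w))"
  proof -
    let ?p = "\<lambda>i. pr M (\<lambda>x. map (\<lambda>j. Z j x) [i..<i + q])"
    have "(\<Sum>i<n. \<Sum>w\<in>words k q. ?p i w * ln (A w)) = (\<Sum>w\<in>words k q. (\<Sum>i<n. ?p i w) * ln (A w))"
      by (subst sum.swap) (simp add: sum_distrib_right)
    also have "\<dots> = real n * (\<Sum>w\<in>words k q. A w * ln (A w))"
      using n by (simp add: A_def sum_distrib_left)
    finally show ?thesis by (simp add: sum_negf)
  qed
  finally show ?thesis by simp
qed

section \<open>Orbit averages and the factor map\<close>

context seq_measure
begin

lemma range_coord: "x \<in> X \<Longrightarrow> x i \<in> {1..k}"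
  using subshift by (auto simp: subshift_def full_shift_def)

lemma pr_word: "pr \<mu> (\<lambda>x. map x [0..<length u]) u = wp \<mu> u"
  by (simp add: pr_def wp_def)

lemma shift_funpow_measurable: "shift ^^ i \<in> \<mu> \<rightarrow>\<^sub>M \<mu>"
  by (intro funpow_measurable shift_measurable_restrict[OF subshift sets_mu])

lemma seq_measure_distr: "seq_measure k X (distr \<mu> \<mu> (shift ^^ i))"
  using subshift sets_mu prob_space.prob_space_distr[OF prob_mu shift_funpow_measurable]
  by (simp add: seq_measure_def)

lemma wp_distr_funpow:
  "wp (distr \<mu> \<mu> (shift ^^ i)) w = pr \<mu> (\<lambda>x. map x [i..<i + length w]) w"
proof -
  interpret D: seq_measure k X "distr \<mu> \<mu> (shift ^^ i)" by (rule seq_measure_distr)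
  have "map ((shift ^^ i) x) [0..<length w] = map x [i..<i + length w]" for x
    by (rule nth_equalityI) (auto simp: shift_funpow)
  then have "pr (distr \<mu> \<mu> (shift ^^ i)) (\<lambda>x. map x [0..<length w]) w = pr \<mu> (\<lambda>x. map x [i..<i + length w]) w"
    using pr_distr[OF simple_function_words shift_funpow_measurable] by simp
  then show ?thesis using D.pr_word by simp
qed

lemma wp_nonneg: "0 \<le> wp \<mu> u" and wp_le_1: "wp \<mu> u \<le> 1"
  by (auto simp: wp_def prob_space.prob_le_1[OF prob_mu])

lemma wp_Nil: "wp \<mu> [] = 1"
  by (simp add: wp_def prob_space.prob_space[OF prob_mu])

lemma wp_outside: "u \<notin> language X \<Longrightarrow> wp \<mu> u = 0"
proof -
  assume "u \<notin> language X"
  then have "X \<inter> cyl u = {}" using language_iff[OF subshift] by blast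
  then show ?thesis unfolding wp_eq[OF sets_mu] by (simp only: measure_empty)
qed

lemma sum_wp: "(\<Sum>u\<in>words k n. wp \<mu> u) = 1"
proof -
  have "(\<Sum>u\<in>words k n. pr \<mu> (\<lambda>x. map x [0..<n]) u) = 1"
    using in_words[of _ 0 n] by (intro sum_pr prob_mu simple_function_words) (auto simp: space_mu)
  moreover have "pr \<mu> (\<lambda>x. map x [0..<n]) u = wp \<mu> u" if "u \<in> words k n" for u
    using that pr_word[of u] by (simp add: words_def)
  ultimately show ?thesis by simp
qed

lemma pr_word_function:
  "pr \<mu> (\<lambda>x. f (map x [0..<n])) w = (\<Sum>u\<in>{u\<in>words k n. f u = w}. wp \<mu> u)"
proof -
  have "pr \<mu> (\<lambda>x. f (map x [0..<n])) w = (\<Sum>u\<in>{u\<in>words k n. f u = w}. pr \<mu> (\<lambda>x. map x [0..<n]) u)"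
    using in_words[of _ 0 n] by (intro pr_compose_sum prob_mu simple_function_words) (auto simp: space_mu)
  also have "\<dots> = (\<Sum>u\<in>{u\<in>words k n. f u = w}. wp \<mu> u)"
    using pr_word by (intro sum.cong refl) (auto simp: words_def)
  finally show ?thesis .
qed

end

text \<open>The average of the first n shifted images of \<open>M\<close>, kept as a function on
  words because that is the form in which a limit is extracted.\<close>

definition orbit_average :: "(nat \<Rightarrow> nat) measure \<Rightarrow> nat \<Rightarrow> nat list \<Rightarrow> real" where
  "orbit_average M n w = (\<Sum>i<n. wp (distr M M (shift ^^ i)) w) / real n"

lemma orbit_average_bounds:
  assumes "seq_measure k X M"
  shows "0 \<le> orbit_average M n w" "orbit_average M n w \<le> 1"
proof -
  interpret seq_measure k X M by fact
  have D: "seq_measure k X (distr M M (shift ^^ i))" for i by (rule seq_measure_distr)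
  show "0 \<le> orbit_average M n w"
    unfolding orbit_average_def using seq_measure.wp_nonneg[OF D] by (intro divide_nonneg_nonneg sum_nonneg) auto
  have "(\<Sum>i<n. wp (distr M M (shift ^^ i)) w) \<le> (\<Sum>i<n. 1)"
    using seq_measure.wp_le_1[OF D] by (intro sum_mono) auto
  then show "orbit_average M n w \<le> 1" unfolding orbit_average_def by (cases "n = 0") auto
qed

text \<open>Summing over a letter in front passes from one shifted image to the next, so the
  difference telescopes to its two end terms divided by n.\<close>

lemma orbit_average_Cons:
  assumes "seq_measure k X M"
  shows "\<bar>(\<Sum>a\<in>{1..k}. orbit_average M n (a # w)) - orbit_average M n w\<bar> \<le> 1 / real n"
proof -
  interpret seq_measure k X M by fact
  let ?D = "\<lambda>i. distr M M (shift ^^ i)"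
  have D: "seq_measure k X (?D i)" for i by (rule seq_measure_distr)
  have "(\<Sum>a\<in>{1..k}. wp (?D i) (a # w)) = wp (?D (Suc i)) w" for i
  proof -
    interpret D: seq_measure k X "?D i" by (rule D)
    have "(\<Sum>a\<in>{1..k}. wp (?D i) (a # w)) = measure (?D i) {x \<in> X. shift x \<in> cyl w}"
      by (rule wp_shift[OF subshift D.sets_mu D.prob_mu, symmetric])
    also have "\<dots> = measure (?D i) (shift -` (X \<inter> cyl w) \<inter> space (?D i))"
      by (intro arg_cong[where f="measure (?D i)"]) (auto simp: space_mu shift_in)
    also have "\<dots> = measure (distr (?D i) M shift) (X \<inter> cyl w)"
      using open_cyl shift_measurable_restrict[OF subshift sets_mu]
      by (intro measure_distr[symmetric]) (auto intro!: in_sets_mu)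
    also have "distr (?D i) M shift = ?D (Suc i)"
      by (subst distr_distr[OF shift_measurable_restrict[OF subshift sets_mu] shift_funpow_measurable])
         (simp add: comp_def)
    finally show ?thesis unfolding wp_eq[OF seq_measure.sets_mu[OF D]] .
  qed
  then have "(\<Sum>a\<in>{1..k}. orbit_average M n (a # w)) = (\<Sum>i<n. wp (?D (Suc i)) w) / real n"
    unfolding orbit_average_def sum_divide_distrib[symmetric] by (subst sum.swap) simp
  then have "(\<Sum>a\<in>{1..k}. orbit_average M n (a # w)) - orbit_average M n w
      = (\<Sum>i<n. wp (?D (Suc i)) w - wp (?D i) w) / real n"
    by (simp add: orbit_average_def sum_subtractf diff_divide_distrib)
  also have "\<dots> = (wp (?D n) w - wp (?D 0) w) / real n"
    by (subst sum_lessThan_telescope) simp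
  finally have eq: "(\<Sum>a\<in>{1..k}. orbit_average M n (a # w)) - orbit_average M n w
      = (wp (?D n) w - wp (?D 0) w) / real n" .
  have "\<bar>wp (?D n) w - wp (?D 0) w\<bar> \<le> 1"
    using seq_measure.wp_nonneg[OF D, of n w] seq_measure.wp_le_1[OF D, of n w]
      seq_measure.wp_nonneg[OF D, of 0 w] seq_measure.wp_le_1[OF D, of 0 w]
    by linarith
  then have "\<bar>wp (?D n) w - wp (?D 0) w\<bar> / real n \<le> 1 / real n"
    by (rule divide_right_mono) simp
  then show ?thesis unfolding eq abs_divide by simp
qed

text \<open>The averages satisfy every condition of \<open>word_measures\<close> except possibly
  invariance, and the defect 1 / n there disappears along the subsequence. This is the
  Krylov-Bogolyubov argument with a starting measure that may change with n.\<close>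

lemma orbit_average_limit:
  assumes sub: "subshift k X" and M: "\<And>n. seq_measure k X (M n)"
  obtains r p where "strict_mono (r :: nat \<Rightarrow> nat)" "\<forall>j. r j > 0" "p \<in> word_measures k X"
    "\<forall>w. (\<lambda>j. orbit_average (M (r j)) (r j) w) \<longlonglongrightarrow> p w"
proof -
  obtain p r0 where r0: "strict_mono (r0 :: nat \<Rightarrow> nat)"
    "\<And>w. (\<lambda>n. orbit_average (M (Suc (r0 n))) (Suc (r0 n)) w) \<longlonglongrightarrow> p w"
    using convergent_subsequence[of "\<lambda>n. orbit_average (M (Suc n)) (Suc n)", OF orbit_average_bounds[OF M]]
    by metis
  \<comment> \<open>The successor keeps the index positive, so that no average runs over an empty
    range.\<close>
  define r where "r j = Suc (r0 j)" for j
  have r: "strict_mono r" "\<And>j. r j > 0" using r0(1) by (auto simp: r_def strict_mono_def)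
  have lim: "(\<lambda>j. orbit_average (M (r j)) (r j) w) \<longlonglongrightarrow> p w" for w
    using r0(2) by (simp add: r_def)
  have D: "seq_measure k X (distr (M n) (M n) (shift ^^ i))" for i n
    by (rule seq_measure.seq_measure_distr[OF M])
  have "p [] = 1"
  proof (rule LIMSEQ_unique[OF lim])
    have "orbit_average (M (r j)) (r j) [] = 1" for j
      using r(2)[of j] by (simp add: orbit_average_def seq_measure.wp_Nil[OF D])
    then show "(\<lambda>j. orbit_average (M (r j)) (r j) []) \<longlonglongrightarrow> 1" by simp
  qed
  moreover have "0 \<le> p u" for u
    using LIMSEQ_le_const[OF lim, of 0 u] orbit_average_bounds(1)[OF M] by blast
  moreover have "p u = 0" if "u \<notin> language X" for u
  proof (rule LIMSEQ_unique[OF lim])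
    have "orbit_average (M (r j)) (r j) u = 0" for j
      using that by (simp add: orbit_average_def seq_measure.wp_outside[OF D])
    then show "(\<lambda>j. orbit_average (M (r j)) (r j) u) \<longlonglongrightarrow> 0" by simp
  qed
  moreover have "p u = (\<Sum>a\<in>{1..k}. p (u @ [a]))" for u
  proof (rule LIMSEQ_unique[OF lim])
    have eq: "orbit_average (M (r j)) (r j) u = (\<Sum>a\<in>{1..k}. orbit_average (M (r j)) (r j) (u @ [a]))" for j
    proof -
      have "(\<Sum>i<n. wp (distr L L (shift ^^ i)) u) = (\<Sum>i<n. \<Sum>a\<in>{1..k}. wp (distr L L (shift ^^ i)) (u @ [a]))"
        if "\<And>i. seq_measure k X (distr L L (shift ^^ i))" for n L
        by (rule sum.cong[OF refl])
           (rule wp_snoc[OF sub seq_measure.sets_mu[OF that] seq_measure.prob_mu[OF that]])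
      from this[OF D] show ?thesis
        unfolding orbit_average_def sum_divide_distrib[symmetric] by (subst sum.swap) simp
    qed
    show "(\<lambda>j. orbit_average (M (r j)) (r j) u) \<longlonglongrightarrow> (\<Sum>a\<in>{1..k}. p (u @ [a]))"
      unfolding eq by (intro tendsto_sum lim)
  qed
  moreover have "p u = (\<Sum>a\<in>{1..k}. p (a # u))" for u
  proof -
    have "(\<lambda>j. (\<Sum>a\<in>{1..k}. orbit_average (M (r j)) (r j) (a # u)) - orbit_average (M (r j)) (r j) u)
        \<longlonglongrightarrow> (\<Sum>a\<in>{1..k}. p (a # u)) - p u"
      by (intro tendsto_diff tendsto_sum lim)
    moreover have "(\<lambda>j. (\<Sum>a\<in>{1..k}. orbit_average (M (r j)) (r j) (a # u)) - orbit_average (M (r j)) (r j) u)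
        \<longlonglongrightarrow> 0"
    proof (rule Lim_null_comparison)
      show "(\<lambda>j. 1 / real (r j)) \<longlonglongrightarrow> 0"
        using LIMSEQ_subseq_LIMSEQ[OF lim_1_over_n r(1)] by (simp add: comp_def)
    qed (use orbit_average_Cons[OF M] in auto)
    ultimately show ?thesis using LIMSEQ_unique by fastforce
  qed
  ultimately have "p \<in> word_measures k X" unfolding word_measures_def by blast
  then show thesis using that r lim by blast
qed

section \<open>The factor map on words\<close>

locale symbolic_factor =
  fixes k l :: nat and X Y :: "(nat \<Rightarrow> nat) set" and \<pi> :: "(nat \<Rightarrow> nat) \<Rightarrow> nat \<Rightarrow> nat" and \<phi> :: "nat \<Rightarrow> nat"
  assumes subX: "subshift k X" and subY: "subshift l Y" and cont: "continuous_on X \<pi>"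
    and image: "\<pi> ` X = Y" and code: "x \<in> X \<Longrightarrow> \<pi> x = (\<lambda>i. \<phi> (x i))"
begin

abbreviation push :: "(nat \<Rightarrow> nat) measure \<Rightarrow> (nat \<Rightarrow> nat) measure" where
  "push \<equiv> push_forward Y \<pi>"

definition fibre :: "nat list \<Rightarrow> nat list set" where
  "fibre v = {u \<in> language X. length u = length v \<and> map \<phi> u = v}"

definition fibre_count :: "nat list \<Rightarrow> real" where
  "fibre_count v = real (card (fibre v))"

lemma map_pi: "x \<in> X \<Longrightarrow> map (\<pi> x) is = map \<phi> (map x is)"
  by (simp add: code)

text \<open>A word of the language has a nonempty cylinder, and any point of it reveals the word
  with which the image starts.\<close>

lemma preimage_count: "real (preimage_count X Y \<pi> v) = fibre_count v"
proof -
  have "\<pi> ` cylinder X u \<subseteq> cylinder Y v \<longleftrightarrow> map \<phi> u = v" if u: "u \<in> language X" "length u = length v" for u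
  proof
    assume sub: "\<pi> ` cylinder X u \<subseteq> cylinder Y v"
    obtain x where x: "x \<in> X" "map x [0..<length u] = u"
      using u(1) language_iff[OF subX] by (auto simp: cyl_def)
    then have "\<pi> x \<in> cylinder Y v" using sub by (auto simp: cylinder_def)
    then have "map (\<pi> x) [0..<length v] = v" by (simp add: cylinder_def)
    then show "map \<phi> u = v" unfolding u(2)[symmetric] map_pi[OF x(1)] x(2) .
  next
    assume v: "map \<phi> u = v"
    show "\<pi> ` cylinder X u \<subseteq> cylinder Y v"
    proof
      fix y assume "y \<in> \<pi> ` cylinder X u"
      then obtain x where x: "x \<in> X" "map x [0..<length u] = u" "y = \<pi> x" by (auto simp: cylinder_def)
      then have "map (\<pi> x) [0..<length v] = v" unfolding u(2)[symmetric] map_pi[OF x(1)] x(2) v by simp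
      moreover have "y \<in> Y" using x image by auto
      ultimately show "y \<in> cylinder Y v" using x by (simp add: cylinder_def)
    qed
  qed
  then have "{u \<in> language X. length u = length v \<and> \<pi> ` cylinder X u \<subseteq> cylinder Y v} = fibre v"
    by (auto simp: fibre_def)
  then show ?thesis by (simp add: preimage_count_def fibre_count_def)
qed

lemma finite_fibre [simp]: "finite (fibre v)"
proof (rule finite_subset)
  show "fibre v \<subseteq> words k (length v)"
    using language_words[OF subX] by (auto simp: fibre_def words_def)
qed simp

lemma language_Y: "v \<in> language Y \<longleftrightarrow> fibre v \<noteq> {}"
proof
  assume "v \<in> language Y"
  then obtain x where x: "x \<in> X" "map (\<pi> x) [0..<length v] = v"
    using language_iff[OF subY] image by (auto simp: cyl_def)
  define u where "u = map x [0..<length v]"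
  have "u \<in> language X"
    unfolding u_def language_iff[OF subX] using x(1) prefix_mem_cyl by blast
  moreover have "map \<phi> u = v" unfolding u_def using x map_pi[OF x(1)] by simp
  ultimately have "u \<in> fibre v" by (auto simp: fibre_def u_def)
  then show "fibre v \<noteq> {}" by blast
next
  assume "fibre v \<noteq> {}"
  then obtain u where u: "u \<in> language X" "length u = length v" "map \<phi> u = v" by (auto simp: fibre_def)
  then obtain x where x: "x \<in> X" "map x [0..<length u] = u" using language_iff[OF subX] by (auto simp: cyl_def)
  have "map (\<pi> x) [0..<length v] = v" unfolding u(2)[symmetric] map_pi[OF x(1)] x(2) u(3) ..
  then have "\<pi> x \<in> cyl v" by (simp add: cyl_def)
  then show "v \<in> language Y" using language_iff[OF subY] image x(1) by blast
qed

lemma fibre_count_ge_1: "v \<in> language Y \<Longrightarrow> 1 \<le> fibre_count v"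
  unfolding language_Y fibre_count_def by (simp add: Suc_le_eq card_gt_0_iff)

lemma fibre_count_nonneg: "0 \<le> fibre_count v"
  by (simp add: fibre_count_def)

lemma map_code_words:
  assumes "u \<in> language X" shows "map \<phi> u \<in> words l (length u)"
proof -
  have "map \<phi> u \<in> language Y" using assms unfolding language_Y fibre_def by auto
  then show ?thesis using language_words[OF subY] by fastforce
qed

lemma language_infix:
  assumes "u @ w @ v \<in> language X" shows "w \<in> language X"
proof -
  obtain x i n where x: "x \<in> X" "u @ w @ v = map x [i..<i + n]" using assms by (auto simp: language_def)
  have "w = take (length w) (drop (length u) (u @ w @ v))" by simp
  also have "\<dots> = map x [i + length u..<i + length u + length w]"
  proof -
    have "length (u @ w @ v) = n" unfolding x(2) by simp
    then have "length u + length w \<le> n" by auto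
    then show ?thesis unfolding x(2) by (simp add: take_map drop_map take_upt)
  qed
  finally show ?thesis unfolding language_def using x(1) by blast
qed

text \<open>Cutting a preimage of a concatenation is injective, and both pieces occur in X because a
  subword of an occurring word occurs. Its logarithm is the subadditivity behind
  \<open>fibre_growth\<close>.\<close>

lemma fibre_count_append: "fibre_count (v @ w) \<le> fibre_count v * fibre_count w"
proof -
  have "card (fibre (v @ w)) \<le> card (fibre v \<times> fibre w)"
  proof (rule card_inj_on_le[where f="\<lambda>u. (take (length v) u, drop (length v) u)"])
    show "inj_on (\<lambda>u. (take (length v) u, drop (length v) u)) (fibre (v @ w))"
      by (rule inj_onI) (metis append_take_drop_id prod.inject)
    show "(\<lambda>u. (take (length v) u, drop (length v) u)) ` fibre (v @ w) \<subseteq> fibre v \<times> fibre w"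
    proof
      fix z assume "z \<in> (\<lambda>u. (take (length v) u, drop (length v) u)) ` fibre (v @ w)"
      then obtain u where u: "u \<in> language X" "length u = length v + length w" "map \<phi> u = v @ w"
        and z: "z = (take (length v) u, drop (length v) u)" by (auto simp: fibre_def)
      have "take (length v) u \<in> language X" "drop (length v) u \<in> language X"
        using language_infix[of "[]" "take (length v) u" "drop (length v) u"]
          language_infix[of "take (length v) u" "drop (length v) u" "[]"] u(1) by auto
      then show "z \<in> fibre v \<times> fibre w"
        using u(2,3) z by (auto simp: fibre_def take_map[symmetric] drop_map[symmetric])
    qed
  qed simp
  then show ?thesis by (simp add: fibre_count_def card_cartesian_product flip: of_nat_mult)
qed

lemma pi_measurable:
  assumes "sets M = sets (restrict_space borel X)"
  shows "\<pi> \<in> M \<rightarrow>\<^sub>M restrict_space borel Y"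
proof -
  have "\<pi> \<in> restrict_space borel X \<rightarrow>\<^sub>M borel"
    using cont by (rule borel_measurable_continuous_on_restrict)
  then have "\<pi> \<in> restrict_space borel X \<rightarrow>\<^sub>M restrict_space borel Y"
    using image by (intro measurable_restrict_space2) (auto simp: space_restrict_space)
  then show ?thesis unfolding measurable_cong_sets[OF assms refl] .
qed

lemma push_seq_measure:
  assumes "seq_measure k X M" shows "seq_measure l Y (push M)"
proof -
  interpret seq_measure k X M by fact
  show ?thesis
    using subY prob_space.prob_space_distr[OF prob_mu pi_measurable[OF sets_mu]]
    by (simp add: seq_measure_def push_forward_def)
qed

lemma push_invariant:
  assumes "\<mu> \<in> invariant_measures X" shows "push \<mu> \<in> invariant_measures Y"
proof -
  interpret shift_measure k X \<mu> by (rule shift_measureI[OF subX assms])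
  interpret Y: seq_measure l Y "push \<mu>" by (rule push_seq_measure) unfold_locales
  let ?N = "restrict_space borel Y"
  have sN: "shift \<in> ?N \<rightarrow>\<^sub>M ?N" by (rule shift_measurable_restrict[OF subY refl])
  have pm: "\<pi> \<in> \<mu> \<rightarrow>\<^sub>M ?N" by (rule pi_measurable[OF sets_mu])
  have "distr (push \<mu>) (push \<mu>) shift = distr (push \<mu>) ?N shift"
    by (intro distr_cong Y.sets_mu refl)
  also have "\<dots> = distr \<mu> ?N (shift \<circ> \<pi>)"
    unfolding push_forward_def by (rule distr_distr[OF sN pm])
  also have "\<dots> = distr \<mu> ?N (\<pi> \<circ> shift)"
    by (intro distr_cong refl) (simp add: space_mu code shift_in, simp add: shift_def)
  also have "\<dots> = distr (distr \<mu> \<mu> shift) ?N \<pi>"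
    by (rule distr_distr[OF pm shift_measurable, symmetric])
  also have "\<dots> = push \<mu>" by (simp add: distr_shift push_forward_def)
  finally show ?thesis
    using Y.sets_mu Y.prob_mu by (simp add: invariant_measures_def)
qed

lemma wp_push:
  assumes "seq_measure k X M"
  shows "wp (push M) v = (\<Sum>u\<in>{u\<in>words k (length v). map \<phi> u = v}. wp M u)"
proof -
  interpret seq_measure k X M by fact
  interpret Y: seq_measure l Y "push M" by (rule push_seq_measure) fact
  have "simple_function (restrict_space borel Y) (\<lambda>y. map y [0..<length v])"
    using Y.simple_function_words[of "[0..<length v]"] unfolding push_forward_def by simp
  from pr_distr[OF this pi_measurable[OF sets_mu], of v]
  have "wp (push M) v = pr M (\<lambda>x. map (\<pi> x) [0..<length v]) v"
    using Y.pr_word[of v] by (simp add: push_forward_def)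
  also have "\<dots> = pr M (\<lambda>x. map \<phi> (map x [0..<length v])) v"
    by (rule fun_cong[OF pr_cong]) (simp only: space_mu map_pi)
  also have "\<dots> = (\<Sum>u\<in>{u\<in>words k (length v). map \<phi> u = v}. wp M u)"
    by (rule pr_word_function)
  finally show ?thesis .
qed

lemma wp_push_fibre:
  assumes "seq_measure k X M"
  shows "wp (push M) v = (\<Sum>u\<in>fibre v. wp M u)"
  unfolding wp_push[OF assms]
proof (rule sum.mono_neutral_right)
  show "fibre v \<subseteq> {u\<in>words k (length v). map \<phi> u = v}"
    using language_words[OF subX] by (auto simp: fibre_def words_def)
  show "\<forall>u\<in>{u \<in> words k (length v). map \<phi> u = v} - fibre v. wp M u = 0"
    using seq_measure.wp_outside[OF assms] by (auto simp: fibre_def words_def)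
qed simp

text \<open>Words outside the language are dropped before grouping: their images need not be words
  over the alphabet of Y, and \<open>fibre\<close> contains only words that occur.\<close>

lemma sum_language:
  fixes h g :: "nat list \<Rightarrow> real"
  assumes "\<And>u. u \<notin> language X \<Longrightarrow> g u = 0"
  shows "(\<Sum>u\<in>words k n. h (map \<phi> u) * g u) = (\<Sum>v\<in>words l n. h v * (\<Sum>u\<in>fibre v. g u))"
proof -
  let ?L = "{u \<in> words k n. u \<in> language X}"
  have "(\<Sum>u\<in>words k n. h (map \<phi> u) * g u) = (\<Sum>u\<in>?L. h (map \<phi> u) * g u)"
    using assms by (intro sum.mono_neutral_right) auto
  also have "\<dots> = (\<Sum>v\<in>words l n. h v * (\<Sum>u\<in>{u\<in>?L. map \<phi> u = v}. g u))"
  proof (rule sum_fibres)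
    have "map \<phi> u \<in> words l n" if "u \<in> ?L" for u
      using map_code_words[of u] that by (simp add: words_def)
    then show "map \<phi> ` ?L \<subseteq> words l n" by blast
  qed auto
  also have "\<dots> = (\<Sum>v\<in>words l n. h v * (\<Sum>u\<in>fibre v. g u))"
  proof (intro sum.cong refl)
    fix v assume "v \<in> words l n"
    then have "{u\<in>?L. map \<phi> u = v} = fibre v"
      using language_words[OF subX] by (auto simp: fibre_def words_def)
    then show "h v * (\<Sum>u\<in>{u\<in>?L. map \<phi> u = v}. g u) = h v * (\<Sum>u\<in>fibre v. g u)" by simp
  qed
  finally show ?thesis .
qed

section \<open>Growth rate of the fibre counts\<close>

definition mean_log_count :: "(nat \<Rightarrow> nat) measure \<Rightarrow> nat \<Rightarrow> real" where
  "mean_log_count m n = (\<Sum>v\<in>words l n. wp m v * ln (fibre_count v))"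

text \<open>The limit average of the potential multiplied by \<alpha> + 1; in this normalization the
  relative variational principle is free of \<alpha>.\<close>

definition fibre_growth :: "(nat \<Rightarrow> nat) measure \<Rightarrow> real" where
  "fibre_growth m = lim (\<lambda>n. mean_log_count m n / real n)"

lemma mean_log_count_nonneg:
  assumes "seq_measure l Y m" shows "0 \<le> mean_log_count m n"
  unfolding mean_log_count_def
proof (rule sum_nonneg)
  fix v
  show "0 \<le> wp m v * ln (fibre_count v)"
  proof (cases "v \<in> language Y")
    case True
    then show ?thesis using fibre_count_ge_1[OF True] seq_measure.wp_nonneg[OF assms] by simp
  next
    case False
    then show ?thesis using seq_measure.wp_outside[OF assms] by simp
  qed
qed

text \<open>Submultiplicativity of the counts, integrated against \<open>m\<close>; by invariance
  both pieces of the word have the law of an initial word.\<close>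

lemma mean_log_count_add:
  assumes "m \<in> invariant_measures Y"
  shows "mean_log_count m (i + j) \<le> mean_log_count m i + mean_log_count m j"
proof -
  interpret shift_measure l Y m by (rule shift_measureI[OF subY assms])
  note window = word_measures_window[OF wp_word_measure]
  have part: "(\<Sum>v\<in>words l (i + j). ln (fibre_count (take r (drop s v))) * wp m v) = mean_log_count m r"
    if "s + r \<le> i + j" for r s
  proof -
    have "(\<Sum>v\<in>words l (i + j). ln (fibre_count (take r (drop s v))) * wp m v)
        = (\<Sum>w\<in>words l r. ln (fibre_count w) * (\<Sum>v\<in>{v\<in>words l (i + j). take r (drop s v) = w}. wp m v))"
      using that by (intro sum_fibres finite_words) (auto simp: words_def dest!: in_set_takeD in_set_dropD)
    also have "\<dots> = mean_log_count m r"
      unfolding mean_log_count_def using window that by (intro sum.cong) (auto simp: mult.commute)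
    finally show ?thesis .
  qed
  have "mean_log_count m (i + j)
      \<le> (\<Sum>v\<in>words l (i + j). ln (fibre_count (take i (drop 0 v))) * wp m v + ln (fibre_count (take j (drop i v))) * wp m v)"
    unfolding mean_log_count_def
  proof (rule sum_mono)
    fix v assume v: "v \<in> words l (i + j)"
    then have len: "length v = i + j" by (simp add: words_def)
    show "wp m v * ln (fibre_count v)
      \<le> ln (fibre_count (take i (drop 0 v))) * wp m v + ln (fibre_count (take j (drop i v))) * wp m v"
    \<comment> \<open>Outside the language the count is 0 and its logarithm only a default value,
      but there the weight vanishes.\<close>
    proof (cases "v \<in> language Y")
      case True
      have "fibre_count v \<le> fibre_count (take i v) * fibre_count (drop i v)"
        using fibre_count_append[of "take i v" "drop i v"] by simp
      moreover have "1 \<le> fibre_count v" by (rule fibre_count_ge_1[OF True])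
      ultimately have pos: "0 < fibre_count (take i v) * fibre_count (drop i v)" by linarith
      then have "0 < fibre_count (take i v)" "0 < fibre_count (drop i v)"
        using fibre_count_nonneg[of "take i v"] fibre_count_nonneg[of "drop i v"]
        by (auto simp: zero_less_mult_iff)
      then have "ln (fibre_count v) \<le> ln (fibre_count (take i v)) + ln (fibre_count (drop i v))"
      proof -
        have "ln (fibre_count v) \<le> ln (fibre_count (take i v) * fibre_count (drop i v))"
          using \<open>fibre_count v \<le> _\<close> \<open>1 \<le> fibre_count v\<close> pos by (subst ln_le_cancel_iff) auto
        then show ?thesis
          using \<open>0 < fibre_count (take i v)\<close> \<open>0 < fibre_count (drop i v)\<close> by (simp add: ln_mult)
      qed
      then have "wp m v * ln (fibre_count v) \<le> wp m v * (ln (fibre_count (take i v)) + ln (fibre_count (drop i v)))"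
        by (intro mult_left_mono wp_nonneg)
      then show ?thesis using len by (simp add: algebra_simps)
    qed (simp add: wp_outside)
  qed
  also have "\<dots> = mean_log_count m i + mean_log_count m j"
    using part[of 0 i] part[of i j] by (simp add: sum.distrib)
  finally show ?thesis .
qed

lemma fibre_growth:
  assumes "m \<in> invariant_measures Y"
  shows "(\<lambda>n. mean_log_count m n / real n) \<longlonglongrightarrow> fibre_growth m"
proof -
  interpret shift_measure l Y m by (rule shift_measureI[OF subY assms])
  have "seq_measure l Y m" by unfold_locales
  then obtain c where "(\<lambda>n. mean_log_count m n / real n) \<longlonglongrightarrow> c"
    using fekete[of "mean_log_count m", OF mean_log_count_add[OF assms] mean_log_count_nonneg] by metis
  then show ?thesis unfolding fibre_growth_def using limI by blast
qed

lemma potential_average_tendsto: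
  assumes m: "m \<in> invariant_measures Y" and \<alpha>: "\<alpha> > 0"
  shows "(\<lambda>n. ereal ((1 / real n) * (\<integral>y. potential X Y \<pi> \<alpha> n y \<partial>m))) \<longlonglongrightarrow> ereal (fibre_growth m / (\<alpha> + 1))"
proof -
  interpret shift_measure l Y m by (rule shift_measureI[OF subY m])
  have "(\<integral>y. potential X Y \<pi> \<alpha> n y \<partial>m) = mean_log_count m n / (\<alpha> + 1)" for n
  proof -
    \<comment> \<open>The exponent becomes a factor. A count of 0 is no exception, because
      \<open>0 powr _\<close> and \<open>ln 0\<close> are both 0.\<close>
    have "potential X Y \<pi> \<alpha> n y = ln (fibre_count (map y [0..<n])) / (\<alpha> + 1)" for y
      unfolding potential_def preimage_count using fibre_count_nonneg[of "map y [0..<n]"]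
      by (cases "fibre_count (map y [0..<n]) = 0") (auto simp: ln_powr)
    then have "(\<integral>y. potential X Y \<pi> \<alpha> n y \<partial>m) = (\<integral>y. (\<lambda>v. ln (fibre_count v) / (\<alpha> + 1)) (map y [0..<n]) \<partial>m)"
      by simp
    also have "\<dots> = (\<Sum>v\<in>words l n. pr m (\<lambda>y. map y [0..<n]) v * (ln (fibre_count v) / (\<alpha> + 1)))"
      using in_words[of _ 0 n]
      by (intro expectation_compose prob_mu simple_function_words) (auto simp: space_mu)
    also have "\<dots> = (\<Sum>v\<in>words l n. wp m v * (ln (fibre_count v) / (\<alpha> + 1)))"
      using pr_word by (intro sum.cong) (auto simp: words_def)
    finally show ?thesis by (simp add: mean_log_count_def sum_divide_distrib)
  qed
  then have "(\<lambda>n. ereal ((1 / real n) * (\<integral>y. potential X Y \<pi> \<alpha> n y \<partial>m)))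
      = (\<lambda>n. ereal (mean_log_count m n / real n / (\<alpha> + 1)))"
    by (simp add: field_simps)
  moreover have "(\<lambda>n. ereal (mean_log_count m n / real n / (\<alpha> + 1))) \<longlonglongrightarrow> ereal (fibre_growth m / (\<alpha> + 1))"
    using \<alpha> by (intro tendsto_ereal tendsto_divide fibre_growth m tendsto_const) auto
  ultimately show ?thesis by (simp only:)
qed

lemma limit_average_potential:
  assumes "m \<in> invariant_measures Y" "\<alpha> > 0"
  shows "limit_average (potential X Y \<pi> \<alpha>) m = ereal (fibre_growth m / (\<alpha> + 1))"
  unfolding limit_average_def using potential_average_tendsto[OF assms] by (rule limI)

lemma limit_average_potential_pi:
  assumes \<mu>: "\<mu> \<in> invariant_measures X" and \<alpha>: "\<alpha> > 0"
  shows "limit_average (\<lambda>n x. \<alpha> * potential X Y \<pi> \<alpha> n (\<pi> x)) \<mu> = ereal (\<alpha> * fibre_growth (push \<mu>) / (\<alpha> + 1))"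
proof -
  interpret shift_measure k X \<mu> by (rule shift_measureI[OF subX \<mu>])
  interpret Y: shift_measure l Y "push \<mu>" by (rule shift_measureI[OF subY push_invariant[OF \<mu>]])
  have pm: "\<pi> \<in> \<mu> \<rightarrow>\<^sub>M restrict_space borel Y" by (rule pi_measurable[OF sets_mu])
  have int: "(\<integral>x. \<alpha> * potential X Y \<pi> \<alpha> n (\<pi> x) \<partial>\<mu>) = \<alpha> * (\<integral>y. potential X Y \<pi> \<alpha> n y \<partial>(push \<mu>))" for n
  proof -
    have "simple_function (push \<mu>) (potential X Y \<pi> \<alpha> n)"
      using simple_function_compose[OF Y.simple_function_words[of "[0..<n]"],
        of "\<lambda>v. ln (real (preimage_count X Y \<pi> v) powr (1 / (\<alpha> + 1)))"]
      by (simp add: potential_def[abs_def] comp_def)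
    then have "potential X Y \<pi> \<alpha> n \<in> borel_measurable (restrict_space borel Y)"
      unfolding push_forward_def by (simp add: borel_measurable_simple_function)
    from integral_distr[OF pm this] show ?thesis by (simp add: push_forward_def)
  qed
  have "(\<lambda>n. ereal \<alpha> * ereal ((1 / real n) * (\<integral>y. potential X Y \<pi> \<alpha> n y \<partial>(push \<mu>))))
      \<longlonglongrightarrow> ereal \<alpha> * ereal (fibre_growth (push \<mu>) / (\<alpha> + 1))"
    by (intro tendsto_cmult_ereal potential_average_tendsto push_invariant \<mu> \<alpha>) auto
  moreover have "ereal \<alpha> * ereal ((1 / real n) * (\<integral>y. potential X Y \<pi> \<alpha> n y \<partial>(push \<mu>)))
      = ereal ((1 / real n) * (\<integral>x. \<alpha> * potential X Y \<pi> \<alpha> n (\<pi> x) \<partial>\<mu>))" for n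
    unfolding int by simp
  ultimately have "(\<lambda>n. ereal ((1 / real n) * (\<integral>x. \<alpha> * potential X Y \<pi> \<alpha> n (\<pi> x) \<partial>\<mu>)))
      \<longlonglongrightarrow> ereal (\<alpha> * fibre_growth (push \<mu>) / (\<alpha> + 1))"
    by (simp only: times_ereal.simps times_divide_eq_right)
  then show ?thesis unfolding limit_average_def by (rule limI)
qed

end

section \<open>The relative variational principle\<close>

definition word_entropy :: "nat \<Rightarrow> nat \<Rightarrow> (nat list \<Rightarrow> real) \<Rightarrow> real" where
  "word_entropy k n p = - (\<Sum>u\<in>words k n. p u * ln (p u))"

lemma (in shift_measure) word_entropy_LIMSEQ:
  "(\<lambda>n. word_entropy k n (wp \<mu>) / real n) \<longlonglongrightarrow> ent"
  using ent_LIMSEQ by (simp add: block_entropy_words word_entropy_def)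

lemma (in shift_measure) ent_le_word_entropy:
  "n > 0 \<Longrightarrow> ent \<le> word_entropy k n (wp \<mu>) / real n"
  using ent_le by (simp add: block_entropy_words word_entropy_def)

lemma (in shift_measure) ent_le_ln: "ent \<le> ln (real k)"
proof -
  have "ent \<le> rv_entropy \<mu> (\<lambda>x. map x [0..<1]) / real 1" by (rule ent_le) simp
  moreover have "rv_entropy \<mu> (\<lambda>x. map (\<lambda>j. x j) [0..<0 + 1]) \<le> real 1 * ln (real k)"
    using range_coord by (intro word_entropy_le prob_mu simple_function_coord) (simp add: space_mu)
  ultimately show ?thesis by simp
qed

section \<open>Limits, mixtures and conditioning\<close>

lemma word_entropy_tendsto:
  assumes "\<And>u. ((\<lambda>j. P j u) \<longlongrightarrow> p u) F" "\<And>j u. 0 \<le> P j u" "\<And>u. 0 \<le> p u"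
  shows "((\<lambda>j. word_entropy k n (P j)) \<longlongrightarrow> word_entropy k n p) F"
  unfolding word_entropy_def by (intro tendsto_minus tendsto_sum tendsto_mult_ln assms)

text \<open>The excess - c ln c - (1 - c) ln (1 - c) is the entropy of the choice between the two
  measures. It does not depend on n and so disappears in the entropy per symbol.\<close>

lemma word_entropy_convex_le:
  assumes p: "\<And>u. p u = c * p1 u + (1 - c) * p2 u" and c: "0 < c" "c < 1"
    and nn: "\<And>u. 0 \<le> p1 u" "\<And>u. 0 \<le> p2 u"
    and one: "(\<Sum>u\<in>words k n. p1 u) = 1" "(\<Sum>u\<in>words k n. p2 u) = 1"
  shows "word_entropy k n p \<le> c * word_entropy k n p1 + (1 - c) * word_entropy k n p2
    + (- (c * ln c) - (1 - c) * ln (1 - c))"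
proof -
  have sub: "- ((x + y) * ln (x + y)) \<le> - (x * ln x) - y * ln y" if "0 \<le> x" "0 \<le> y" for x y :: real
  proof -
    have "x * ln x \<le> x * ln (x + y)" using that by (cases "x = 0") (auto intro!: mult_left_mono)
    moreover have "y * ln y \<le> y * ln (x + y)" using that by (cases "y = 0") (auto intro!: mult_left_mono)
    ultimately show ?thesis by (simp add: distrib_right)
  qed
  have scale: "a * t * ln (a * t) = a * (t * ln t) + t * (a * ln a)" if "0 < a" "0 \<le> t" for a t :: real
    using that by (cases "t = 0") (auto simp: ln_mult algebra_simps)
  have "word_entropy k n p = (\<Sum>u\<in>words k n. - (p u * ln (p u)))"
    by (simp add: word_entropy_def sum_negf)
  also have "\<dots> \<le> (\<Sum>u\<in>words k n. c * - (p1 u * ln (p1 u)) + (1 - c) * - (p2 u * ln (p2 u))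
      + (p1 u * - (c * ln c) + p2 u * - ((1 - c) * ln (1 - c))))"
  proof (rule sum_mono)
    fix u
    have "- (p u * ln (p u)) \<le> - (c * p1 u * ln (c * p1 u)) - (1 - c) * p2 u * ln ((1 - c) * p2 u)"
      unfolding p using c nn by (intro sub) auto
    also have "\<dots> = c * - (p1 u * ln (p1 u)) + (1 - c) * - (p2 u * ln (p2 u))
      + (p1 u * - (c * ln c) + p2 u * - ((1 - c) * ln (1 - c)))"
      using scale[of c "p1 u"] scale[of "1 - c" "p2 u"] c nn by simp
    finally show "- (p u * ln (p u)) \<le> c * - (p1 u * ln (p1 u)) + (1 - c) * - (p2 u * ln (p2 u))
      + (p1 u * - (c * ln c) + p2 u * - ((1 - c) * ln (1 - c)))" .
  qed
  also have "\<dots> = c * word_entropy k n p1 + (1 - c) * word_entropy k n p2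
      + ((\<Sum>u\<in>words k n. p1 u) * - (c * ln c) + (\<Sum>u\<in>words k n. p2 u) * - ((1 - c) * ln (1 - c)))"
    unfolding sum.distrib sum_distrib_left[symmetric] sum_distrib_right[symmetric] word_entropy_def sum_negf ..
  finally show ?thesis unfolding one by simp
qed

text \<open>This inequality is what extremality rests on: if a mixture attains a supremum, so do
  both of its components.\<close>

lemma ent_convex_le:
  assumes sub: "subshift k X" and inv: "\<mu> \<in> invariant_measures X" "\<mu>1 \<in> invariant_measures X" "\<mu>2 \<in> invariant_measures X"
    and wp: "\<And>u. wp \<mu> u = c * wp \<mu>1 u + (1 - c) * wp \<mu>2 u" and c: "0 < c" "c < 1"
  shows "shift_measure.ent \<mu> \<le> c * shift_measure.ent \<mu>1 + (1 - c) * shift_measure.ent \<mu>2"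
proof -
  interpret M: shift_measure k X \<mu> by (rule shift_measureI[OF sub inv(1)])
  interpret M1: shift_measure k X \<mu>1 by (rule shift_measureI[OF sub inv(2)])
  interpret M2: shift_measure k X \<mu>2 by (rule shift_measureI[OF sub inv(3)])
  define D where "D = - (c * ln c) - (1 - c) * ln (1 - c)"
  have "word_entropy k n (wp \<mu>) / real n
      \<le> c * (word_entropy k n (wp \<mu>1) / real n) + (1 - c) * (word_entropy k n (wp \<mu>2) / real n) + D / real n" for n
  proof -
    have "word_entropy k n (wp \<mu>) \<le> c * word_entropy k n (wp \<mu>1) + (1 - c) * word_entropy k n (wp \<mu>2) + D"
      unfolding D_def
      by (rule word_entropy_convex_le[OF wp c M1.wp_nonneg M2.wp_nonneg M1.sum_wp M2.sum_wp])
    then have "word_entropy k n (wp \<mu>) / real n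
      \<le> (c * word_entropy k n (wp \<mu>1) + (1 - c) * word_entropy k n (wp \<mu>2) + D) / real n"
      by (rule divide_right_mono) simp
    then show ?thesis by (simp add: add_divide_distrib)
  qed
  moreover have "(\<lambda>n. c * (word_entropy k n (wp \<mu>1) / real n) + (1 - c) * (word_entropy k n (wp \<mu>2) / real n) + D / real n)
      \<longlonglongrightarrow> c * M1.ent + (1 - c) * M2.ent + 0"
    by (intro tendsto_add tendsto_mult tendsto_const M1.word_entropy_LIMSEQ M2.word_entropy_LIMSEQ lim_const_over_n)
  ultimately have "M.ent \<le> c * M1.ent + (1 - c) * M2.ent + 0"
    by (intro LIMSEQ_le[OF M.word_entropy_LIMSEQ]) auto
  then show ?thesis by simp
qed

lemma word_measures_closed:
  assumes P: "\<And>j. P j \<in> word_measures k X" and lim: "\<And>u. (\<lambda>j. P j u) \<longlonglongrightarrow> p u"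
  shows "p \<in> word_measures k X"
proof -
  have "p [] = 1" using lim[of "[]"] word_measures_Nil[OF P] LIMSEQ_unique[OF _ tendsto_const] by simp
  moreover have "0 \<le> p u" for u using LIMSEQ_le_const[OF lim] word_measures_nonneg[OF P] by blast
  moreover have "p u = 0" if "u \<notin> language X" for u
    using lim[of u] word_measures_support[OF P that] LIMSEQ_unique[OF _ tendsto_const] by simp
  moreover have "p u = (\<Sum>a\<in>{1..k}. p (u @ [a]))" for u
  proof (rule LIMSEQ_unique[OF lim])
    have "(\<lambda>j. \<Sum>a\<in>{1..k}. P j (u @ [a])) \<longlonglongrightarrow> (\<Sum>a\<in>{1..k}. p (u @ [a]))"
      by (intro tendsto_sum lim)
    then show "(\<lambda>j. P j u) \<longlonglongrightarrow> (\<Sum>a\<in>{1..k}. p (u @ [a]))"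
      by (subst word_measures_snoc[OF P])
  qed
  moreover have "p u = (\<Sum>a\<in>{1..k}. p (a # u))" for u
  proof (rule LIMSEQ_unique[OF lim])
    have "(\<lambda>j. \<Sum>a\<in>{1..k}. P j (a # u)) \<longlonglongrightarrow> (\<Sum>a\<in>{1..k}. p (a # u))"
      by (intro tendsto_sum lim)
    then show "(\<lambda>j. P j u) \<longlonglongrightarrow> (\<Sum>a\<in>{1..k}. p (a # u))"
      by (subst word_measures_Cons[OF P])
  qed
  ultimately show ?thesis unfolding word_measures_def by blast
qed

lemma word_measures_le_1:
  assumes "subshift k X" "p \<in> word_measures k X" shows "p u \<le> 1"
proof -
  obtain \<mu> where \<mu>: "\<mu> \<in> invariant_measures X" "wp \<mu> = p" using word_measure_realized[OF assms] by blast
  interpret shift_measure k X \<mu> by (rule shift_measureI[OF assms(1) \<mu>(1)])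
  show ?thesis using wp_le_1 \<mu>(2) by simp
qed

text \<open>Conditioning on an invariant set A preserves invariance because the preimage of A
  \<inter> B is A intersected with the preimage of B. The word probabilities exhibit
  \<open>\<mu>\<close> as a mixture of its conditionings on A and on the complement.\<close>

lemma (in shift_measure) uniform_measure_invariant:
  assumes A: "A \<in> sets \<mu>" "shift -` A \<inter> space \<mu> = A" "measure \<mu> A > 0"
  shows "uniform_measure \<mu> A \<in> invariant_measures X"
    and "wp (uniform_measure \<mu> A) u = measure \<mu> (A \<inter> cyl u) / measure \<mu> A"
proof -
  interpret prob_space \<mu> by (rule prob_mu)
  let ?U = "uniform_measure \<mu> A"
  have A0: "emeasure \<mu> A \<noteq> 0" "emeasure \<mu> A \<noteq> \<infinity>" using A(3) by (auto simp: emeasure_eq_measure)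
  have sU: "sets ?U = sets (restrict_space borel X)" by (simp add: sets_mu)
  have m: "shift \<in> ?U \<rightarrow>\<^sub>M ?U" by (rule shift_measurable_restrict[OF subshift sU])
  have "distr ?U ?U shift = ?U"
  proof (rule measure_eqI)
    fix B assume "B \<in> sets (distr ?U ?U shift)"
    then have B: "B \<in> sets \<mu>" by simp
    have vB: "shift -` B \<inter> space \<mu> \<in> sets \<mu>" using shift_measurable B by (rule measurable_sets)
    have "emeasure (distr ?U ?U shift) B = emeasure ?U (shift -` B \<inter> space \<mu>)"
      using emeasure_distr[OF m, of B] B by simp
    also have "\<dots> = emeasure \<mu> (A \<inter> (shift -` B \<inter> space \<mu>)) / emeasure \<mu> A"
      using A(1) vB by simp
    also have "A \<inter> (shift -` B \<inter> space \<mu>) = shift -` (A \<inter> B) \<inter> space \<mu>" using A(2) by blast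
    also have "emeasure \<mu> (shift -` (A \<inter> B) \<inter> space \<mu>) = emeasure (distr \<mu> \<mu> shift) (A \<inter> B)"
      using A(1) B by (intro emeasure_distr[symmetric] shift_measurable) auto
    also have "\<dots> = emeasure \<mu> (A \<inter> B)" by (simp add: distr_shift)
    also have "emeasure \<mu> (A \<inter> B) / emeasure \<mu> A = emeasure ?U B" using A(1) B by simp
    finally show "emeasure (distr ?U ?U shift) B = emeasure ?U B" .
  qed simp
  then show "?U \<in> invariant_measures X"
    using prob_space_uniform_measure[OF A0] sU by (simp add: invariant_measures_def)
  have AX: "A \<subseteq> X" using sets.sets_into_space[OF A(1)] by (simp add: space_mu)
  have "wp ?U u = measure ?U (X \<inter> cyl u)" by (rule wp_eq[OF sU])
  also have "\<dots> = measure \<mu> (A \<inter> (X \<inter> cyl u)) / measure \<mu> A"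
    using open_cyl in_sets_mu A0 by (intro measure_uniform_measure) auto
  also have "A \<inter> (X \<inter> cyl u) = A \<inter> cyl u" using AX by auto
  finally show "wp ?U u = measure \<mu> (A \<inter> cyl u) / measure \<mu> A" .
qed

text \<open>Here \<open>t i\<close> stands for the probability of a word of length r at position i,
  which is controlled only while the window stays inside the first n symbols; at most r positions
  fail this.\<close>

lemma average_near_constant:
  fixes t :: "nat \<Rightarrow> real"
  assumes "n > 0" and eq: "\<And>i. i + r \<le> n \<Longrightarrow> t i = c" and le: "\<And>i. \<bar>t i - c\<bar> \<le> 1"
  shows "\<bar>(\<Sum>i<n. t i) / real n - c\<bar> \<le> real r / real n"
proof -
  have "(\<Sum>i<n. t i) / real n - c = (\<Sum>i<n. t i - c) / real n"
    using \<open>n > 0\<close> by (simp add: sum_subtractf diff_divide_distrib)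
  then have "\<bar>(\<Sum>i<n. t i) / real n - c\<bar> \<le> (\<Sum>i<n. \<bar>t i - c\<bar>) / real n"
    by (simp add: abs_divide divide_right_mono sum_abs)
  also have "(\<Sum>i<n. \<bar>t i - c\<bar>) \<le> (\<Sum>i\<in>{n - r..<n}. 1)"
  proof -
    have "(\<Sum>i<n. \<bar>t i - c\<bar>) = (\<Sum>i\<in>{n - r..<n}. \<bar>t i - c\<bar>)"
      using eq by (intro sum.mono_neutral_right) (auto simp: not_le)
    also have "\<dots> \<le> (\<Sum>i\<in>{n - r..<n}. 1)" using le by (intro sum_mono) auto
    finally show ?thesis .
  qed
  also have "(\<Sum>i\<in>{n - r..<n}. 1) \<le> real r" by simp
  finally show ?thesis by (simp add: divide_right_mono)
qed

section \<open>Uniform lifts of the words of Y\<close>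

context symbolic_factor
begin

text \<open>An m-random word followed by a uniform choice among its preimages. One formula serves
  all lengths, but the laws of different lengths need not be marginals of one another, so this need
  not be a point of \<open>word_measures\<close>.\<close>

definition lift :: "(nat \<Rightarrow> nat) measure \<Rightarrow> nat list \<Rightarrow> real" where
  "lift m u = (if u \<in> language X then wp m (map \<phi> u) / fibre_count (map \<phi> u) else 0)"

lemma map_code_language: "u \<in> language X \<Longrightarrow> map \<phi> u \<in> language Y"
  unfolding language_Y fibre_def by auto

lemma lift_nonneg:
  assumes "seq_measure l Y m" shows "0 \<le> lift m u"
  unfolding lift_def using seq_measure.wp_nonneg[OF assms] fibre_count_nonneg by simp

lemma sum_fibre_lift:
  assumes "seq_measure l Y m" shows "(\<Sum>u\<in>fibre v. lift m u) = wp m v"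
proof (cases "v \<in> language Y")
  case True
  have "(\<Sum>u\<in>fibre v. lift m u) = (\<Sum>u\<in>fibre v. wp m v / fibre_count v)"
    by (intro sum.cong) (auto simp: fibre_def lift_def)
  also have "\<dots> = wp m v" using fibre_count_ge_1[OF True] True by (simp add: fibre_count_def language_Y)
  finally show ?thesis .
next
  case False
  then show ?thesis using seq_measure.wp_outside[OF assms] language_Y by simp
qed

lemma lift_outside: "u \<notin> language X \<Longrightarrow> lift m u = 0"
  by (simp add: lift_def)

lemma sum_lift:
  assumes "seq_measure l Y m" shows "(\<Sum>u\<in>words k n. lift m u) = 1"
  using sum_language[of "lift m" "\<lambda>_. 1" n] lift_outside sum_fibre_lift[OF assms]
    seq_measure.sum_wp[OF assms] by simp

text \<open>The logarithm of \<open>lift\<close> depends on the image word only, so the cross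
  entropy is the same for every law \<open>p\<close> over m. For the word law of an invariant
  measure it is the Gibbs bound; for the lift itself it is the entropy of the lift.\<close>

lemma cross_entropy_lift:
  assumes m: "seq_measure l Y m"
    and p: "\<And>u. u \<notin> language X \<Longrightarrow> p u = 0" "\<And>u. 0 \<le> p u" "\<And>v. (\<Sum>u\<in>fibre v. p u) = wp m v"
  shows "- (\<Sum>u\<in>words k n. p u * ln (lift m u)) = word_entropy l n (wp m) + mean_log_count m n"
    and "p u > 0 \<Longrightarrow> lift m u > 0"
proof -
  have pos: "0 < wp m (map \<phi> u) \<and> 1 \<le> fibre_count (map \<phi> u) \<and> u \<in> language X" if "p u > 0" for u
  proof -
    have u: "u \<in> language X" using p(1) that by force
    then have "u \<in> fibre (map \<phi> u)" by (simp add: fibre_def)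
    then have "p u \<le> (\<Sum>u\<in>fibre (map \<phi> u). p u)" using p(2) by (intro member_le_sum) auto
    then show ?thesis using that p(3) u fibre_count_ge_1[OF map_code_language[OF u]] by simp
  qed
  then show "p u > 0 \<Longrightarrow> lift m u > 0" by (force simp: lift_def)
  let ?h = "\<lambda>v. ln (wp m v) - ln (fibre_count v)"
  have "(\<Sum>u\<in>words k n. p u * ln (lift m u)) = (\<Sum>u\<in>words k n. ?h (map \<phi> u) * p u)"
  proof (rule sum.cong[OF refl])
    fix u
    show "p u * ln (lift m u) = ?h (map \<phi> u) * p u"
    proof (cases "p u > 0")
      case True
      with pos[OF this] show ?thesis by (simp add: lift_def ln_div)
    next
      case False
      then have "p u = 0" using p(2)[of u] by linarith
      then show ?thesis by simp
    qed
  qed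
  also have "\<dots> = (\<Sum>v\<in>words l n. ?h v * wp m v)" using sum_language[of p ?h n] p(1,3) by simp
  also have "\<dots> = - word_entropy l n (wp m) - mean_log_count m n"
    by (simp add: word_entropy_def mean_log_count_def right_diff_distrib sum_subtractf mult.commute)
  finally show "- (\<Sum>u\<in>words k n. p u * ln (lift m u)) = word_entropy l n (wp m) + mean_log_count m n" by simp
qed

lemma ent_le_relative:
  assumes \<mu>: "\<mu> \<in> invariant_measures X"
  shows "shift_measure.ent \<mu> \<le> shift_measure.ent (push \<mu>) + fibre_growth (push \<mu>)"
proof -
  interpret M: shift_measure k X \<mu> by (rule shift_measureI[OF subX \<mu>])
  interpret Y: shift_measure l Y "push \<mu>" by (rule shift_measureI[OF subY push_invariant[OF \<mu>]])
  have seq: "seq_measure k X \<mu>" and seqY: "seq_measure l Y (push \<mu>)" by unfold_locales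
  note cross = cross_entropy_lift[OF seqY M.wp_outside M.wp_nonneg wp_push_fibre[OF seq, symmetric]]
  have "word_entropy k n (wp \<mu>) \<le> word_entropy l n (wp (push \<mu>)) + mean_log_count (push \<mu>) n" for n
  proof -
    have "word_entropy k n (wp \<mu>) \<le> - (\<Sum>u\<in>words k n. wp \<mu> u * ln (lift (push \<mu>) u))"
      unfolding word_entropy_def
      using cross(2) sum_lift[OF seqY] M.sum_wp
      by (intro gibbs finite_words M.wp_nonneg lift_nonneg[OF seqY]) auto
    then show ?thesis using cross(1) by simp
  qed
  then have "word_entropy k n (wp \<mu>) / real n
      \<le> word_entropy l n (wp (push \<mu>)) / real n + mean_log_count (push \<mu>) n / real n" for n
    by (simp add: divide_right_mono flip: add_divide_distrib)
  then show ?thesis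
    by (intro LIMSEQ_le[OF M.word_entropy_LIMSEQ tendsto_add[OF Y.word_entropy_LIMSEQ fibre_growth[OF push_invariant[OF \<mu>]]]]) auto
qed

lemma lift_realized:
  assumes m: "seq_measure l Y m" and X: "X \<noteq> {}"
  obtains M where "seq_measure k X M" "\<And>u. u \<in> words k n \<Longrightarrow> wp M u = lift m u"
proof -
  obtain W where W: "\<And>A. measure (measure_pmf W) A = (\<Sum>u\<in>{u\<in>words k n. u \<in> A}. lift m u)"
    using words_pmf_exists[of "lift m" k n, OF lift_nonneg[OF m] sum_lift[OF m]] by blast
  \<comment> \<open>Words that do not occur in X also receive a point, but \<open>lift\<close> gives
    them weight 0.\<close>
  have "\<exists>x. x \<in> X \<and> (u \<in> language X \<longrightarrow> x \<in> cyl u)" for u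
    using language_iff[OF subX, of u] X by blast
  then obtain pt where pt: "\<And>u. pt u \<in> X" "\<And>u. u \<in> language X \<Longrightarrow> pt u \<in> cyl u" by metis
  have meas: "pt \<in> measure_pmf W \<rightarrow>\<^sub>M restrict_space borel X"
    using pt(1) by (auto simp: space_restrict_space)
  define M where "M = distr W (restrict_space borel X) pt"
  have M: "seq_measure k X M"
    using subX prob_space.prob_space_distr[OF prob_space_measure_pmf meas]
    by (simp add: seq_measure_def M_def)
  moreover have "wp M u = lift m u" if u: "u \<in> words k n" for u
  proof -
    have "wp M u = measure M (X \<inter> cyl u)" by (rule wp_eq[OF seq_measure.sets_mu[OF M]])
    also have "\<dots> = measure W (pt -` (X \<inter> cyl u))"
      unfolding M_def using measure_distr[OF meas, of "X \<inter> cyl u"] open_cyl by (auto simp: sets_restrict_space)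
    also have "\<dots> = (\<Sum>u'\<in>{u'\<in>words k n. u' \<in> pt -` (X \<inter> cyl u)}. lift m u')" by (rule W)
    also have "\<dots> = (\<Sum>u'\<in>{u}. lift m u')"
    proof (rule sum.mono_neutral_cong)
      fix u' assume u': "u' \<in> {u'\<in>words k n. u' \<in> pt -` (X \<inter> cyl u)} - {u}"
      have "u' \<notin> language X"
      proof
        assume "u' \<in> language X"
        then have "pt u' \<in> cyl u' \<inter> cyl u" using pt(2) u' by auto
        moreover have "length u' = length u" using u u' by (simp add: words_def)
        ultimately show False using cyl_disjoint[of u' u] u' by auto
      qed
      then show "lift m u' = 0" by (rule lift_outside)
    next
      fix u' assume u': "u' \<in> {u} - {u'\<in>words k n. u' \<in> pt -` (X \<inter> cyl u)}"
      then have "u' \<notin> language X" using u pt by auto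
      then show "lift m u' = 0" by (rule lift_outside)
    qed auto
    finally show ?thesis by simp
  qed
  ultimately show thesis by (rule that)
qed

text \<open>While the window stays inside the first n symbols, the law of its image is a marginal of
  the image of the lift, which is the law of n-words under m; stationarity of m makes the position
  irrelevant.\<close>

lemma wp_push_window:
  assumes m: "m \<in> invariant_measures Y" and M: "seq_measure k X M"
    and wp: "\<And>u. u \<in> words k n \<Longrightarrow> wp M u = lift m u" and i: "i + length v \<le> n"
  shows "wp (push (distr M M (shift ^^ i))) v = wp m v"
proof -
  interpret seq_measure k X M by (rule M)
  interpret m: shift_measure l Y m by (rule shift_measureI[OF subY m])
  have seqm: "seq_measure l Y m" by unfold_locales
  let ?r = "length v"
  have D: "seq_measure k X (distr M M (shift ^^ i))" by (rule seq_measure_distr)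
  interpret P: seq_measure l Y "push (distr M M (shift ^^ i))" by (rule push_seq_measure[OF D])
  show ?thesis
  proof (cases "v \<in> language Y")
    case False
    then show ?thesis using P.wp_outside m.wp_outside by simp
  next
    case True
    have v: "v \<in> words l ?r" by (rule language_words[OF subY True])
    have "wp (push (distr M M (shift ^^ i))) v
        = (\<Sum>u\<in>{u\<in>words k ?r. map \<phi> u = v}. pr M (\<lambda>x. map x [i..<i + ?r]) u)"
      unfolding wp_push[OF D] wp_distr_funpow by (intro sum.cong) (auto simp: words_def)
    also have "\<dots> = pr M (\<lambda>x. map \<phi> (map x [i..<i + ?r])) v"
      using in_words[of _ i ?r]
      by (intro pr_compose_sum[symmetric] prob_mu simple_function_words finite_words) (auto simp: space_mu)
    also have "\<dots> = pr M (\<lambda>x. take ?r (drop i (map \<phi> (map x [0..<n])))) v"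
      using i by (intro fun_cong[OF pr_cong]) (simp add: take_map drop_map take_upt)
    also have "\<dots> = (\<Sum>u\<in>{u\<in>words k n. take ?r (drop i (map \<phi> u)) = v}. wp M u)"
      by (rule pr_word_function)
    also have "\<dots> = (\<Sum>u\<in>words k n. (if take ?r (drop i (map \<phi> u)) = v then 1 else 0) * lift m u)"
      using wp by (subst sum.inter_filter) (auto intro!: sum.cong)
    also have "\<dots> = (\<Sum>w\<in>words l n. (if take ?r (drop i w) = v then 1 else 0) * wp m w)"
      using sum_language[of "lift m" "\<lambda>w. if take ?r (drop i w) = v then 1 else 0" n] lift_outside
        sum_fibre_lift[OF seqm] by simp
    also have "\<dots> = (\<Sum>w\<in>{w\<in>words l n. take ?r (drop i w) = v}. wp m w)"
      by (subst sum.inter_filter) (auto intro!: sum.cong)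
    also have "\<dots> = wp m v" by (rule word_measures_window[OF m.wp_word_measure v i])
    finally show ?thesis .
  qed
qed

text \<open>The n-word law of \<open>M n\<close> has exactly the block entropy that is wanted, and
  its orbit averages converge along a subsequence. For fixed block length q the block estimate
  passes to the limit in n; only then does q tend to infinity, turning the block entropies of the
  limit into its entropy.\<close>

lemma relative_maximizer:
  assumes m: "m \<in> invariant_measures Y" and X: "X \<noteq> {}"
  obtains \<mu> where "\<mu> \<in> invariant_measures X" "push \<mu> = m"
    "shift_measure.ent \<mu> = shift_measure.ent m + fibre_growth m"
proof -
  interpret m: shift_measure l Y m by (rule shift_measureI[OF subY m])
  have seqm: "seq_measure l Y m" by unfold_locales
  have "\<exists>M. seq_measure k X M \<and> (\<forall>u\<in>words k n. wp M u = lift m u)" for n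
    using lift_realized[OF seqm X, of n] by metis
  then obtain M where M: "\<And>n. seq_measure k X (M n)" "\<And>n u. u \<in> words k n \<Longrightarrow> wp (M n) u = lift m u"
    by metis
  obtain r p where r: "strict_mono (r :: nat \<Rightarrow> nat)" "\<forall>j. r j > 0" and p: "p \<in> word_measures k X"
    and lims: "\<forall>w. (\<lambda>j. orbit_average (M (r j)) (r j) w) \<longlonglongrightarrow> p w"
    by (rule orbit_average_limit[of k X M, OF subX M(1)])
  note lim = lims[rule_format]
  obtain \<mu> where \<mu>: "\<mu> \<in> invariant_measures X" "wp \<mu> = p" using word_measure_realized[OF subX p] by blast
  interpret M: shift_measure k X \<mu> by (rule shift_measureI[OF subX \<mu>(1)])
  have seq: "seq_measure k X \<mu>" by unfold_locales
  interpret P: shift_measure l Y "push \<mu>" by (rule shift_measureI[OF subY push_invariant[OF \<mu>(1)]])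
  have r_inv: "(\<lambda>j. c / real (r j)) \<longlonglongrightarrow> 0" for c
    using LIMSEQ_subseq_LIMSEQ[OF lim_const_over_n[of c] r(1)] by (simp add: comp_def)
  have "wp (push \<mu>) v = wp m v" for v
  proof -
    have "(\<lambda>j. (\<Sum>u\<in>fibre v. orbit_average (M (r j)) (r j) u) - wp m v) \<longlonglongrightarrow> (\<Sum>u\<in>fibre v. p u) - wp m v"
      by (intro tendsto_diff tendsto_sum lim tendsto_const)
    moreover have "(\<lambda>j. (\<Sum>u\<in>fibre v. orbit_average (M (r j)) (r j) u) - wp m v) \<longlonglongrightarrow> 0"
    proof (rule Lim_null_comparison[OF _ r_inv])
      have "\<bar>(\<Sum>u\<in>fibre v. orbit_average (M n) n u) - wp m v\<bar> \<le> real (length v) / real n" if n: "n > 0" for n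
      proof -
        let ?D = "\<lambda>i. distr (M n) (M n) (shift ^^ i)"
        have D: "seq_measure k X (?D i)" for i
          by (rule seq_measure.seq_measure_distr[OF M(1)])
        note PD = push_seq_measure[OF D]
        have "(\<Sum>u\<in>fibre v. orbit_average (M n) n u) = (\<Sum>i<n. wp (push (?D i)) v) / real n"
          unfolding orbit_average_def sum_divide_distrib[symmetric] wp_push_fibre[OF D] by (subst sum.swap) simp
        moreover have "\<bar>(\<Sum>i<n. wp (push (?D i)) v) / real n - wp m v\<bar> \<le> real (length v) / real n"
        proof (rule average_near_constant[OF n])
          show "wp (push (?D i)) v = wp m v" if "i + length v \<le> n" for i
            using wp_push_window[OF m M(1) M(2) that] .
          show "\<bar>wp (push (?D i)) v - wp m v\<bar> \<le> 1" for i
            using seq_measure.wp_nonneg[OF PD, of i v] seq_measure.wp_le_1[OF PD, of i v]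
              m.wp_nonneg[of v] m.wp_le_1[of v] by linarith
        qed
        ultimately show ?thesis by simp
      qed
      then show "\<forall>\<^sub>F j in sequentially. norm ((\<Sum>u\<in>fibre v. orbit_average (M (r j)) (r j) u) - wp m v)
          \<le> real (length v) / real (r j)" using r(2) by simp
    qed
    ultimately have "(\<Sum>u\<in>fibre v. p u) - wp m v = 0" by (rule LIMSEQ_unique)
    then show ?thesis using wp_push_fibre[OF seq, of v] \<mu>(2) by simp
  qed
  then have push: "push \<mu> = m"
    by (intro restrict_measure_eqI[OF m.X_borel P.sets_mu m.sets_mu P.prob_mu m.prob_mu])
  have "m.ent + fibre_growth m \<le> word_entropy k q p / real q" if q: "q > 0" for q
  proof -
    have "word_entropy l n (wp m) / real n + mean_log_count m n / real n
        \<le> word_entropy k q (orbit_average (M n) n) / real q + 2 * real q * ln (real k) / real n" if n: "n > 0" for n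
    proof -
      interpret N: seq_measure k X "M n" by (rule M(1))
      have "- (\<Sum>u\<in>words k n. lift m u * ln (lift m u)) = word_entropy l n (wp m) + mean_log_count m n"
        by (rule cross_entropy_lift(1)[OF seqm lift_outside lift_nonneg[OF seqm] sum_fibre_lift[OF seqm]])
      then have H: "rv_entropy (M n) (\<lambda>x. map x [0..<n]) = word_entropy l n (wp m) + mean_log_count m n"
        using M(2)[of _ n] by (simp add: N.block_entropy_words)
      define A where "A w = (\<Sum>i<n. pr (M n) (\<lambda>x. map (\<lambda>j. x j) [i..<i + q]) w) / real n" for w
      have "real q * rv_entropy (M n) (\<lambda>x. map (\<lambda>j. x j) [0..<n])
          \<le> real n * - (\<Sum>w\<in>words k q. A w * ln (A w)) + 2 * (real q)\<^sup>2 * ln (real k)"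
        unfolding A_def using N.range_coord
        by (intro block_average_entropy N.prob_mu N.simple_function_coord n q) (auto simp: N.space_mu)
      moreover have "A w = orbit_average (M n) n w" if "w \<in> words k q" for w
        using that by (simp add: A_def orbit_average_def N.wp_distr_funpow words_def)
      ultimately have "real q * (word_entropy l n (wp m) + mean_log_count m n)
          \<le> real n * word_entropy k q (orbit_average (M n) n) + 2 * (real q)\<^sup>2 * ln (real k)"
        by (simp add: word_entropy_def H)
      \<comment> \<open>Dividing by q n turns the boundary term into 2 q ln k / n, which vanishes
        for fixed q.\<close>
      then have "real q * (word_entropy l n (wp m) + mean_log_count m n) / (real q * real n)
          \<le> (real n * word_entropy k q (orbit_average (M n) n) + 2 * (real q)\<^sup>2 * ln (real k)) / (real q * real n)"
        by (rule divide_right_mono) simp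
      then show ?thesis using n q by (simp add: add_divide_distrib power2_eq_square)
    qed
    then have "word_entropy l (r j) (wp m) / real (r j) + mean_log_count m (r j) / real (r j)
        \<le> word_entropy k q (orbit_average (M (r j)) (r j)) / real q + 2 * real q * ln (real k) / real (r j)" for j
      using r(2) by blast
    moreover have "(\<lambda>j. word_entropy l (r j) (wp m) / real (r j) + mean_log_count m (r j) / real (r j))
        \<longlonglongrightarrow> m.ent + fibre_growth m"
      using LIMSEQ_subseq_LIMSEQ[OF tendsto_add[OF m.word_entropy_LIMSEQ fibre_growth[OF m]] r(1)]
      by (simp add: comp_def)
    moreover have "(\<lambda>j. word_entropy k q (orbit_average (M (r j)) (r j)) / real q + 2 * real q * ln (real k) / real (r j))
        \<longlonglongrightarrow> word_entropy k q p / real q + 0"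
      using q by (intro tendsto_add r_inv tendsto_divide word_entropy_tendsto lim tendsto_const
        orbit_average_bounds(1)[OF M(1)] word_measures_nonneg[OF p]) auto
    ultimately have "m.ent + fibre_growth m \<le> word_entropy k q p / real q + 0"
      by (intro LIMSEQ_le) auto
    then show ?thesis by simp
  qed
  then have "m.ent + fibre_growth m \<le> M.ent"
    unfolding \<mu>(2)[symmetric] by (intro LIMSEQ_le_const[OF M.word_entropy_LIMSEQ]) (auto intro!: exI[of _ 1])
  moreover have "M.ent \<le> m.ent + fibre_growth m" using ent_le_relative[OF \<mu>(1)] push by simp
  ultimately show thesis using that \<mu>(1) push by simp
qed

end

section \<open>Ergodic maximizers\<close>

context symbolic_factor
begin

text \<open>The orbit averages of a point mass have an invariant limit.\<close>

lemma invariant_measures_nonempty: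
  assumes "X \<noteq> {}" shows "invariant_measures X \<noteq> {}"
proof -
  obtain x where x: "x \<in> X" using assms by blast
  define M where "M = return (restrict_space borel X) x"
  have "x \<in> space (restrict_space borel X)" using x by (simp add: space_restrict_space)
  then have M: "seq_measure k X M"
    using subX by (simp add: seq_measure_def M_def prob_space_return)
  obtain r p where "strict_mono (r :: nat \<Rightarrow> nat)" "\<forall>j. r j > 0" "p \<in> word_measures k X"
    "\<forall>w. (\<lambda>j. orbit_average M (r j) w) \<longlonglongrightarrow> p w"
    by (rule orbit_average_limit[of k X "\<lambda>_. M", OF subX M])
  then show ?thesis using word_measure_realized[OF subX] by blast
qed

section \<open>Maximizers in terms of word probabilities\<close>

definition push_words :: "(nat list \<Rightarrow> real) \<Rightarrow> nat list \<Rightarrow> real" where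
  "push_words p v = (\<Sum>u\<in>fibre v. p u)"

definition weighted_ent :: "real \<Rightarrow> (nat \<Rightarrow> nat) measure \<Rightarrow> real" where
  "weighted_ent \<alpha> \<mu> = shift_measure.ent \<mu> + \<alpha> * shift_measure.ent (push \<mu>)"

text \<open>The block version of the weighted entropy: for n > 0 a continuous function of the word
  probabilities that bounds the weighted entropy from above and converges to it.\<close>

definition weighted_block :: "real \<Rightarrow> nat \<Rightarrow> (nat list \<Rightarrow> real) \<Rightarrow> real" where
  "weighted_block \<alpha> n p = word_entropy k n p / real n + \<alpha> * (word_entropy l n (push_words p) / real n)"

lemma wp_push_words:
  assumes "\<mu> \<in> invariant_measures X" shows "wp (push \<mu>) = push_words (wp \<mu>)"
proof -
  interpret shift_measure k X \<mu> by (rule shift_measureI[OF subX assms])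
  have "seq_measure k X \<mu>" by unfold_locales
  then show ?thesis by (simp add: fun_eq_iff wp_push_fibre push_words_def)
qed

lemma weighted_block_bound:
  assumes \<mu>: "\<mu> \<in> invariant_measures X" and \<alpha>: "\<alpha> > 0"
  shows "(\<lambda>n. weighted_block \<alpha> n (wp \<mu>)) \<longlonglongrightarrow> weighted_ent \<alpha> \<mu>"
    and "n > 0 \<Longrightarrow> weighted_ent \<alpha> \<mu> \<le> weighted_block \<alpha> n (wp \<mu>)"
    and "weighted_ent \<alpha> \<mu> \<le> ln (real k) + \<alpha> * ln (real l)"
proof -
  interpret shift_measure k X \<mu> by (rule shift_measureI[OF subX \<mu>])
  interpret Y: shift_measure l Y "push \<mu>" by (rule shift_measureI[OF subY push_invariant[OF \<mu>]])
  show "(\<lambda>n. weighted_block \<alpha> n (wp \<mu>)) \<longlonglongrightarrow> weighted_ent \<alpha> \<mu>"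
    unfolding weighted_block_def weighted_ent_def wp_push_words[OF \<mu>, symmetric]
    by (intro tendsto_intros word_entropy_LIMSEQ Y.word_entropy_LIMSEQ)
  show "n > 0 \<Longrightarrow> weighted_ent \<alpha> \<mu> \<le> weighted_block \<alpha> n (wp \<mu>)"
    unfolding weighted_block_def weighted_ent_def wp_push_words[OF \<mu>, symmetric]
    using \<alpha> by (intro add_mono mult_left_mono ent_le_word_entropy Y.ent_le_word_entropy) auto
  show "weighted_ent \<alpha> \<mu> \<le> ln (real k) + \<alpha> * ln (real l)"
    unfolding weighted_ent_def using \<alpha> by (intro add_mono mult_left_mono ent_le_ln Y.ent_le_ln) auto
qed

lemma weighted_block_tendsto:
  assumes lim: "\<And>u. (\<lambda>j. P j u) \<longlonglongrightarrow> p u" and P: "\<And>j. P j \<in> word_measures k X" and n: "n > 0"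
  shows "(\<lambda>j. weighted_block \<alpha> n (P j)) \<longlonglongrightarrow> weighted_block \<alpha> n p"
proof -
  have p: "p \<in> word_measures k X" by (rule word_measures_closed[OF P lim])
  have "(\<lambda>j. push_words (P j) v) \<longlonglongrightarrow> push_words p v" for v
    unfolding push_words_def by (intro tendsto_sum lim)
  moreover have "0 \<le> push_words q v" if "q \<in> word_measures k X" for q v
    unfolding push_words_def using word_measures_nonneg[OF that] by (simp add: sum_nonneg)
  ultimately show ?thesis
    unfolding weighted_block_def using n
    by (intro tendsto_add tendsto_mult tendsto_divide tendsto_const word_entropy_tendsto lim
        word_measures_nonneg[OF P] word_measures_nonneg[OF p]) (auto simp: P p)
qed

text \<open>Since the weighted entropy is both the limit and a lower bound of its block versions,
  these are the laws of weighted entropy at least \<open>s\<close>, expressed by closed conditions: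
  upper semicontinuity in disguise. For \<open>s\<close> the supremum they are the
  maximizers.\<close>

definition maximizing_words :: "real \<Rightarrow> real \<Rightarrow> (nat list \<Rightarrow> real) set" where
  "maximizing_words \<alpha> s = {p \<in> word_measures k X. \<forall>n>0. s \<le> weighted_block \<alpha> n p}"

lemma maximizing_words_limit:
  assumes lim: "\<And>u. (\<lambda>j. P j u) \<longlonglongrightarrow> p u" and P: "\<And>j. P j \<in> maximizing_words \<alpha> (t j)"
    and t: "t \<longlonglongrightarrow> s"
  shows "p \<in> maximizing_words \<alpha> s"
proof -
  have Pw: "\<And>j. P j \<in> word_measures k X" using P by (simp add: maximizing_words_def)
  have "s \<le> weighted_block \<alpha> n p" if n: "n > 0" for n
    using P n by (intro LIMSEQ_le[OF t weighted_block_tendsto[OF lim Pw n]]) (auto simp: maximizing_words_def)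
  then show ?thesis using word_measures_closed[OF Pw lim] by (simp add: maximizing_words_def)
qed

lemma compact_maximizing_words: "compact (maximizing_words \<alpha> s)"
proof -
  have "closed (maximizing_words \<alpha> s)"
    unfolding closed_sequential_limits
    using maximizing_words_limit[where t="\<lambda>_. s"] tendsto_coordinatewise tendsto_const by blast
  moreover have "maximizing_words \<alpha> s \<subseteq> PiE UNIV (\<lambda>_. {0..1})"
    using word_measures_nonneg word_measures_le_1[OF subX] by (auto simp: maximizing_words_def)
  ultimately show ?thesis using compact_unit_functions closed_Int_compact Int_absorb2 by metis
qed

lemma maximizing_words_iff:
  assumes \<mu>: "\<mu> \<in> invariant_measures X" and \<alpha>: "\<alpha> > 0"
  shows "wp \<mu> \<in> maximizing_words \<alpha> s \<longleftrightarrow> s \<le> weighted_ent \<alpha> \<mu>"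
proof -
  interpret shift_measure k X \<mu> by (rule shift_measureI[OF subX \<mu>])
  show ?thesis
  proof
    assume "wp \<mu> \<in> maximizing_words \<alpha> s"
    then show "s \<le> weighted_ent \<alpha> \<mu>"
      by (intro LIMSEQ_le_const[OF weighted_block_bound(1)[OF \<mu> \<alpha>]])
         (auto simp: maximizing_words_def intro!: exI[of _ 1])
  next
    assume "s \<le> weighted_ent \<alpha> \<mu>"
    then show "wp \<mu> \<in> maximizing_words \<alpha> s"
      using weighted_block_bound(2)[OF \<mu> \<alpha>] wp_word_measure by (auto simp: maximizing_words_def intro: order_trans)
  qed
qed

lemma weighted_ent_convex_le:
  assumes inv: "\<mu> \<in> invariant_measures X" "\<mu>1 \<in> invariant_measures X" "\<mu>2 \<in> invariant_measures X"
    and wp: "\<And>u. wp \<mu> u = c * wp \<mu>1 u + (1 - c) * wp \<mu>2 u" and c: "0 < c" "c < 1" and \<alpha>: "\<alpha> > 0"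
  shows "weighted_ent \<alpha> \<mu> \<le> c * weighted_ent \<alpha> \<mu>1 + (1 - c) * weighted_ent \<alpha> \<mu>2"
proof -
  have 1: "shift_measure.ent \<mu> \<le> c * shift_measure.ent \<mu>1 + (1 - c) * shift_measure.ent \<mu>2"
    by (rule ent_convex_le[OF subX inv wp c])
  have "wp (push \<mu>) v = c * wp (push \<mu>1) v + (1 - c) * wp (push \<mu>2) v" for v
    unfolding inv[THEN wp_push_words] push_words_def wp by (simp add: sum.distrib sum_distrib_left)
  then have "shift_measure.ent (push \<mu>)
      \<le> c * shift_measure.ent (push \<mu>1) + (1 - c) * shift_measure.ent (push \<mu>2)"
    by (intro ent_convex_le[OF subY push_invariant push_invariant push_invariant] inv c)
  then have "\<alpha> * shift_measure.ent (push \<mu>)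
      \<le> \<alpha> * (c * shift_measure.ent (push \<mu>1) + (1 - c) * shift_measure.ent (push \<mu>2))"
    using \<alpha> by (intro mult_left_mono) auto
  with 1 show ?thesis by (simp add: weighted_ent_def algebra_simps)
qed

lemma ergodic_maximizer:
  assumes X: "X \<noteq> {}" and \<alpha>: "\<alpha> > 0"
  obtains \<mu> where "\<mu> \<in> invariant_measures X" "ergodic \<mu>"
    "\<And>\<mu>'. \<mu>' \<in> invariant_measures X \<Longrightarrow> weighted_ent \<alpha> \<mu>' \<le> weighted_ent \<alpha> \<mu>"
proof -
  define s where "s = (SUP \<mu>\<in>invariant_measures X. weighted_ent \<alpha> \<mu>)"
  have ne: "invariant_measures X \<noteq> {}" by (rule invariant_measures_nonempty[OF X])
  have bdd: "bdd_above (weighted_ent \<alpha> ` invariant_measures X)"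
    using weighted_block_bound(3)[OF _ \<alpha>] by (intro bdd_aboveI[where M="ln (real k) + \<alpha> * ln (real l)"]) auto
  have le_s: "weighted_ent \<alpha> \<mu> \<le> s" if "\<mu> \<in> invariant_measures X" for \<mu>
    unfolding s_def using that bdd by (rule cSUP_upper)
  \<comment> \<open>Measures approaching the supremum; along a convergent subsequence their bounds s
    - 1 / (j + 1) become \<open>s\<close>.\<close>
  have "\<exists>\<mu>\<in>invariant_measures X. s - 1 / real (Suc j) < weighted_ent \<alpha> \<mu>" for j
    using less_cSUP_iff[OF ne bdd, of "s - 1 / real (Suc j)"] by (simp add: s_def)
  then obtain \<nu> where \<nu>: "\<And>j. \<nu> j \<in> invariant_measures X"
    "\<And>j. s - 1 / real (Suc j) < weighted_ent \<alpha> (\<nu> j)" by metis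
  have P: "wp (\<nu> j) \<in> maximizing_words \<alpha> (s - 1 / real (Suc j))" for j
    using maximizing_words_iff[OF \<nu>(1) \<alpha>] \<nu>(2) less_imp_le by blast
  have "0 \<le> wp (\<nu> j) u" "wp (\<nu> j) u \<le> 1" for j u
    using P[of j] word_measures_nonneg word_measures_le_1[OF subX] by (auto simp: maximizing_words_def)
  then obtain p0 r where r: "strict_mono (r :: nat \<Rightarrow> nat)" "\<And>u. (\<lambda>j. wp (\<nu> (r j)) u) \<longlonglongrightarrow> p0 u"
    using convergent_subsequence[of "\<lambda>j. wp (\<nu> j)"] by metis
  have "(\<lambda>j. s - 1 / real (Suc j)) \<longlonglongrightarrow> s - 0"
    by (intro tendsto_diff tendsto_const LIMSEQ_inverse_real_of_nat[unfolded inverse_eq_divide])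
  from LIMSEQ_subseq_LIMSEQ[OF this r(1)] have "(\<lambda>j. s - 1 / real (Suc (r j))) \<longlonglongrightarrow> s" by (simp add: comp_def)
  with r(2) P have "p0 \<in> maximizing_words \<alpha> s" by (rule maximizing_words_limit)
  then have "maximizing_words \<alpha> s \<noteq> {}" by blast
  then obtain p where p: "p \<in> maximizing_words \<alpha> s"
    and ext: "\<And>q1 q2 c. \<lbrakk>q1 \<in> maximizing_words \<alpha> s; q2 \<in> maximizing_words \<alpha> s; 0 < c; c < 1;
      \<And>u. p u = c * q1 u + (1 - c) * q2 u\<rbrakk> \<Longrightarrow> q1 = p"
    using exists_extreme_point[OF compact_maximizing_words] by metis
  obtain \<mu> where \<mu>: "\<mu> \<in> invariant_measures X" "wp \<mu> = p"
    using word_measure_realized[OF subX] p by (auto simp: maximizing_words_def)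
  have s_le: "s \<le> weighted_ent \<alpha> \<mu>" using p maximizing_words_iff[OF \<mu>(1) \<alpha>] \<mu>(2) by simp
  interpret shift_measure k X \<mu> by (rule shift_measureI[OF subX \<mu>(1)])
  interpret prob_space \<mu> by (rule prob_mu)
  have "ergodic \<mu>"
    unfolding ergodic_def
  proof (intro ballI impI, rule ccontr)
    fix A assume A: "A \<in> sets \<mu>" "shift -` A \<inter> space \<mu> = A" and A01: "\<not> (measure \<mu> A = 0 \<or> measure \<mu> A = 1)"
    define c where "c = measure \<mu> A"
    have c: "0 < c" "c < 1"
      using A01 prob_le_1[of A] measure_nonneg[of \<mu> A] by (auto simp: c_def order_less_le)
    let ?B = "space \<mu> - A"
    have B: "?B \<in> sets \<mu>" "shift -` ?B \<inter> space \<mu> = ?B" "measure \<mu> ?B = 1 - c"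
    proof -
      show "shift -` ?B \<inter> space \<mu> = ?B" using A(2) shift_in by (auto simp: space_mu)
      show "measure \<mu> ?B = 1 - c" using prob_compl[OF A(1)] by (simp add: c_def)
    qed (use A in auto)
    let ?\<mu>1 = "uniform_measure \<mu> A" and ?\<mu>2 = "uniform_measure \<mu> ?B"
    have inv: "?\<mu>1 \<in> invariant_measures X" "?\<mu>2 \<in> invariant_measures X"
      using uniform_measure_invariant(1)[OF A] uniform_measure_invariant(1)[OF B(1,2)] B(3) c
      by (auto simp: c_def)
    have mix: "wp \<mu> u = c * wp ?\<mu>1 u + (1 - c) * wp ?\<mu>2 u" for u
    proof -
      have "wp \<mu> u = measure \<mu> (X \<inter> cyl u)" by (rule wp_eq[OF sets_mu])
      also have "X \<inter> cyl u = (A \<inter> cyl u) \<union> (?B \<inter> cyl u)"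
        using sets.sets_into_space[OF A(1)] by (auto simp: space_mu)
      also have "measure \<mu> \<dots> = measure \<mu> (A \<inter> cyl u) + measure \<mu> (?B \<inter> cyl u)"
        using A(1) B(1) open_cyl by (intro finite_measure_Union) (auto simp: sets_mu_iff)
      finally show ?thesis
        using uniform_measure_invariant(2)[OF A, of u] uniform_measure_invariant(2)[OF B(1,2), of u] B(3) c
        by (simp add: c_def)
    qed
    have "weighted_ent \<alpha> \<mu> \<le> c * weighted_ent \<alpha> ?\<mu>1 + (1 - c) * weighted_ent \<alpha> ?\<mu>2"
      by (rule weighted_ent_convex_le[OF \<mu>(1) inv mix c \<alpha>])
    \<comment> \<open>No measure exceeds \<open>s\<close>, so both deficits are nonnegative and have
      to vanish: both conditioned measures are maximizers.\<close>
    then have "c * (s - weighted_ent \<alpha> ?\<mu>1) + (1 - c) * (s - weighted_ent \<alpha> ?\<mu>2) \<le> 0"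
      using s_le by (simp add: algebra_simps)
    moreover have nn: "0 \<le> c * (s - weighted_ent \<alpha> ?\<mu>1)" "0 \<le> (1 - c) * (s - weighted_ent \<alpha> ?\<mu>2)"
      using le_s[OF inv(1)] le_s[OF inv(2)] c by auto
    ultimately have "c * (s - weighted_ent \<alpha> ?\<mu>1) = 0" "(1 - c) * (s - weighted_ent \<alpha> ?\<mu>2) = 0"
      by linarith+
    then have "wp ?\<mu>1 \<in> maximizing_words \<alpha> s" "wp ?\<mu>2 \<in> maximizing_words \<alpha> s"
      using maximizing_words_iff[OF inv(1) \<alpha>] maximizing_words_iff[OF inv(2) \<alpha>] c by auto
    then have "wp ?\<mu>1 = wp \<mu>" using ext[of "wp ?\<mu>1" "wp ?\<mu>2" c] mix c \<mu>(2) by simp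
    interpret M1: shift_measure k X ?\<mu>1 by (rule shift_measureI[OF subX inv(1)])
    \<comment> \<open>Extremality leaves no proper decomposition, yet the conditioned measure gives
      \<open>A\<close> mass 1 while \<open>\<mu>\<close> gives it c < 1.\<close>
    have "?\<mu>1 = \<mu>"
      using \<open>wp ?\<mu>1 = wp \<mu>\<close>
      by (intro restrict_measure_eqI[OF X_borel M1.sets_mu sets_mu M1.prob_mu prob_mu]) simp
    moreover have "measure ?\<mu>1 A = 1"
      using A(1) c by (subst measure_uniform_measure) (auto simp: c_def emeasure_eq_measure)
    ultimately show False using c by (simp add: c_def)
  qed
  then show thesis using that[OF \<mu>(1)] le_s s_le by (meson order_trans)
qed

end

section \<open>Comparison of the suprema\<close>

lemma SUP_ereal_attained:
  fixes f :: "'a \<Rightarrow> real"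
  assumes "x \<in> A" "\<And>y. y \<in> A \<Longrightarrow> f y \<le> f x" "\<And>y. y \<in> A \<Longrightarrow> g y = ereal (f y)"
  shows "(SUP y\<in>A. g y) = ereal (f x)"
  using assms by (intro antisym SUP_least) (auto intro: SUP_upper2)

text \<open>By itself \<open>one_block\<close> allows a different rule at each position. The rule is
  read off at position 0, and commutation with the shift carries it to all others; a symbol at
  position i of a point of X is at position 0 of a shifted point of X.\<close>

lemma one_block_code:
  assumes "factor_map X Y \<pi>" "one_block X \<pi>" "subshift k X"
  obtains \<phi> where "\<And>x. x \<in> X \<Longrightarrow> \<pi> x = (\<lambda>i. \<phi> (x i))"
proof -
  define \<phi> where "\<phi> a = \<pi> (SOME x. x \<in> X \<and> x 0 = a) 0" for a
  have zero: "\<pi> x 0 = \<phi> (x 0)" if "x \<in> X" for x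
  proof -
    define y where "y = (SOME y. y \<in> X \<and> y 0 = x 0)"
    have "\<exists>y. y \<in> X \<and> y 0 = x 0" using that by blast
    then have "y \<in> X \<and> y 0 = x 0" unfolding y_def by (rule someI_ex)
    then have "\<pi> x 0 = \<pi> y 0" using assms(2) that unfolding one_block_def by metis
    then show ?thesis by (simp add: \<phi>_def y_def)
  qed
  have orbit: "(shift ^^ i) x \<in> X \<and> \<pi> ((shift ^^ i) x) = (shift ^^ i) (\<pi> x)" if "x \<in> X" for i x
  proof (induction i)
    case (Suc i)
    then have "shift ((shift ^^ i) x) \<in> X" using assms(3) unfolding subshift_def by blast
    moreover have "\<pi> (shift ((shift ^^ i) x)) = shift (\<pi> ((shift ^^ i) x))"
      using Suc assms(1) unfolding factor_map_def by blast
    ultimately show ?case using Suc by simp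
  qed (use that in simp)
  have "\<pi> x = (\<lambda>i. \<phi> (x i))" if x: "x \<in> X" for x
  proof
    fix i
    have "(shift ^^ i) (\<pi> x) 0 = \<phi> ((shift ^^ i) x 0)" using zero[of "(shift ^^ i) x"] orbit[OF x, of i] by simp
    then show "\<pi> x i = \<phi> (x i)" unfolding shift_funpow by simp
  qed
  then show thesis by (rule that)
qed

theorem proposition3p11:
  fixes X Y :: "(nat \<Rightarrow> nat) set" and \<pi> :: "(nat \<Rightarrow> nat) \<Rightarrow> nat \<Rightarrow> nat"
    and k l :: nat and \<alpha> :: real
  assumes "shift_of_finite_type k X" and "irreducible_shift X"
    and "subshift l Y"
    and "factor_map X Y \<pi>" and "one_block X \<pi>"
    and "\<alpha> > 0"
  shows "(SUP \<mu>\<in>invariant_measures X. weighted_entropy Y \<pi> \<alpha> \<mu>)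
         = ereal (\<alpha> + 1) *
           (SUP m\<in>invariant_measures Y. shift_entropy m + limit_average (potential X Y \<pi> \<alpha>) m)
       \<and> (SUP \<mu>\<in>invariant_measures X. weighted_entropy Y \<pi> \<alpha> \<mu>)
         = ereal (\<alpha> + 1) *
           (SUP \<mu>\<in>invariant_measures X.
              shift_entropy \<mu> - limit_average (\<lambda>n x. \<alpha> * potential X Y \<pi> \<alpha> n (\<pi> x)) \<mu>)
       \<and> (\<exists>\<mu>\<in>invariant_measures X. ergodic \<mu> \<and>
            weighted_entropy Y \<pi> \<alpha> \<mu>
              = (SUP \<mu>'\<in>invariant_measures X. weighted_entropy Y \<pi> \<alpha> \<mu>'))
       \<and> (\<forall>\<mu>. \<mu> \<in> weighted_maximizers X Y \<pi> \<alpha> \<longleftrightarrow>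
            equilibrium_state Y (potential X Y \<pi> \<alpha>) (push_forward Y \<pi> \<mu>) \<and>
            maximal_relative_entropy X Y \<pi> (push_forward Y \<pi> \<mu>) \<mu>)"
proof -
  have subX: "subshift k X" using assms(1) by (simp add: shift_of_finite_type_def)
  have X: "X \<noteq> {}" using assms(2) by (simp add: irreducible_shift_def)
  obtain \<phi> where \<phi>: "\<And>x. x \<in> X \<Longrightarrow> \<pi> x = (\<lambda>i. \<phi> (x i))"
    using one_block_code[OF assms(4,5) subX] by blast
  interpret symbolic_factor k l X Y \<pi> \<phi>
    using subX assms(3,4) \<phi> by unfold_locales (auto simp: factor_map_def)
  note \<alpha> = \<open>\<alpha> > 0\<close>
  let ?e = "shift_measure.ent" and ?MX = "invariant_measures X" and ?MY = "invariant_measures Y"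
  let ?g = fibre_growth
  have eX: "shift_entropy \<mu> = ereal (?e \<mu>)" if "\<mu> \<in> ?MX" for \<mu>
    by (rule shift_measure.shift_entropy_eq[OF shift_measureI[OF subX that]])
  have eY: "shift_entropy m = ereal (?e m)" if "m \<in> ?MY" for m
    by (rule shift_measure.shift_entropy_eq[OF shift_measureI[OF subY that]])
  have w: "weighted_entropy Y \<pi> \<alpha> \<mu> = ereal (weighted_ent \<alpha> \<mu>)" if "\<mu> \<in> ?MX" for \<mu>
    using eX[OF that] eY[OF push_invariant[OF that]] by (simp add: weighted_entropy_def weighted_ent_def)
  have pY: "shift_entropy m + limit_average (potential X Y \<pi> \<alpha>) m = ereal (?e m + ?g m / (\<alpha> + 1))"
    if "m \<in> ?MY" for m
    using eY[OF that] limit_average_potential[OF that \<alpha>] by simp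
  have pX: "shift_entropy \<mu> - limit_average (\<lambda>n x. \<alpha> * potential X Y \<pi> \<alpha> n (\<pi> x)) \<mu>
      = ereal (?e \<mu> - \<alpha> * ?g (push \<mu>) / (\<alpha> + 1))" if "\<mu> \<in> ?MX" for \<mu>
    using eX[OF that] limit_average_potential_pi[OF that \<alpha>] by simp
  obtain \<mu>0 where \<mu>0: "\<mu>0 \<in> ?MX" "ergodic \<mu>0" "\<And>\<mu>'. \<mu>' \<in> ?MX \<Longrightarrow> weighted_ent \<alpha> \<mu>' \<le> weighted_ent \<alpha> \<mu>0"
    using ergodic_maximizer[OF X \<alpha>] by metis
  define s where "s = weighted_ent \<alpha> \<mu>0"
  have rel: "?e \<mu> \<le> ?e (push \<mu>) + ?g (push \<mu>)" if "\<mu> \<in> ?MX" for \<mu>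
    by (rule ent_le_relative[OF that])
  \<comment> \<open>A relative maximizer over m has weighted entropy (\<alpha> + 1) h_m + g, which
    therefore cannot exceed the supremum.\<close>
  have ent_le: "(\<alpha> + 1) * ?e m + ?g m \<le> s" if m: "m \<in> ?MY" for m
  proof -
    obtain \<mu> where \<mu>: "\<mu> \<in> ?MX" "push \<mu> = m" "?e \<mu> = ?e m + ?g m"
      by (rule relative_maximizer[OF m X])
    then show ?thesis using \<mu>0(3)[OF \<mu>(1)] by (simp add: weighted_ent_def s_def algebra_simps)
  qed
  \<comment> \<open>For a maximizer the chain s = h_\<mu> + \<alpha> h_m \<le> (\<alpha> + 1) h_m +
    g \<le> s collapses, and its two equalities are the conditions (ii) and (i).\<close>
  have s_eq: "s = (\<alpha> + 1) * ?e (push \<mu>) + ?g (push \<mu>) \<and> ?e \<mu> = ?e (push \<mu>) + ?g (push \<mu>)"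
    if "\<mu> \<in> ?MX" "weighted_ent \<alpha> \<mu> = s" for \<mu>
    using rel[OF that(1)] ent_le[OF push_invariant[OF that(1)]] that(2)
    by (simp add: weighted_ent_def algebra_simps)
  define m0 where "m0 = push \<mu>0"
  have m0: "m0 \<in> ?MY" "s = (\<alpha> + 1) * ?e m0 + ?g m0" "?e \<mu>0 = ?e m0 + ?g m0"
    using push_invariant[OF \<mu>0(1)] s_eq[OF \<mu>0(1)] by (auto simp: m0_def s_def)
  have scale: "?e m + ?g m / (\<alpha> + 1) = ((\<alpha> + 1) * ?e m + ?g m) / (\<alpha> + 1)" for m
    using \<alpha> by (simp add: field_simps)
  have sup1: "(SUP \<mu>\<in>?MX. weighted_entropy Y \<pi> \<alpha> \<mu>) = ereal s"
    unfolding s_def by (rule SUP_ereal_attained[where f="weighted_ent \<alpha>"]) (use \<mu>0 w in auto)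
  have sup2: "(SUP m\<in>?MY. shift_entropy m + limit_average (potential X Y \<pi> \<alpha>) m) = ereal (s / (\<alpha> + 1))"
  proof -
    have "(SUP m\<in>?MY. shift_entropy m + limit_average (potential X Y \<pi> \<alpha>) m)
        = ereal (((\<alpha> + 1) * ?e m0 + ?g m0) / (\<alpha> + 1))"
    proof (rule SUP_ereal_attained[where f="\<lambda>m. ((\<alpha> + 1) * ?e m + ?g m) / (\<alpha> + 1)"])
      show "((\<alpha> + 1) * ?e m + ?g m) / (\<alpha> + 1) \<le> ((\<alpha> + 1) * ?e m0 + ?g m0) / (\<alpha> + 1)" if "m \<in> ?MY" for m
        using ent_le[OF that] m0(2) \<alpha> by (intro divide_right_mono) auto
    qed (use m0 pY scale in auto)
    then show ?thesis using m0(2) by simp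
  qed
  have sup3: "(SUP \<mu>\<in>?MX. shift_entropy \<mu> - limit_average (\<lambda>n x. \<alpha> * potential X Y \<pi> \<alpha> n (\<pi> x)) \<mu>)
      = ereal (s / (\<alpha> + 1))"
  proof -
    have "(SUP \<mu>\<in>?MX. shift_entropy \<mu> - limit_average (\<lambda>n x. \<alpha> * potential X Y \<pi> \<alpha> n (\<pi> x)) \<mu>)
        = ereal (?e \<mu>0 - \<alpha> * ?g (push \<mu>0) / (\<alpha> + 1))"
    proof (rule SUP_ereal_attained[where f="\<lambda>\<mu>. ?e \<mu> - \<alpha> * ?g (push \<mu>) / (\<alpha> + 1)"])
      fix \<mu> assume \<mu>: "\<mu> \<in> ?MX"
      \<comment> \<open>The relative bound turns the expression into the pressure of the image
        measure, since g - \<alpha> g / (\<alpha> + 1) = g / (\<alpha> + 1).\<close>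
      have "?e \<mu> - \<alpha> * ?g (push \<mu>) / (\<alpha> + 1) \<le> ?e (push \<mu>) + ?g (push \<mu>) - \<alpha> * ?g (push \<mu>) / (\<alpha> + 1)"
        using rel[OF \<mu>] by simp
      also have "\<dots> = ((\<alpha> + 1) * ?e (push \<mu>) + ?g (push \<mu>)) / (\<alpha> + 1)"
        using \<alpha> by (simp add: field_simps)
      also have "\<dots> \<le> s / (\<alpha> + 1)"
        using ent_le[OF push_invariant[OF \<mu>]] \<alpha> by (intro divide_right_mono) auto
      also have "\<dots> = ?e \<mu>0 - \<alpha> * ?g (push \<mu>0) / (\<alpha> + 1)"
        using \<alpha> m0(2,3) by (simp add: m0_def field_simps)
      finally show "?e \<mu> - \<alpha> * ?g (push \<mu>) / (\<alpha> + 1) \<le> ?e \<mu>0 - \<alpha> * ?g (push \<mu>0) / (\<alpha> + 1)" .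
    qed (use \<mu>0 pX in auto)
    also have "?e \<mu>0 - \<alpha> * ?g (push \<mu>0) / (\<alpha> + 1) = s / (\<alpha> + 1)"
      using \<alpha> m0(2,3) by (simp add: m0_def field_simps)
    finally show ?thesis .
  qed
  have "(\<mu> \<in> weighted_maximizers X Y \<pi> \<alpha>) \<longleftrightarrow>
      equilibrium_state Y (potential X Y \<pi> \<alpha>) (push \<mu>) \<and> maximal_relative_entropy X Y \<pi> (push \<mu>) \<mu>" for \<mu>
  proof (cases "\<mu> \<in> ?MX")
    case False
    then show ?thesis by (simp add: weighted_maximizers_def maximal_relative_entropy_def)
  next
    case True
    have mY: "push \<mu> \<in> ?MY" by (rule push_invariant[OF True])
    have relsup: "(SUP \<mu>'\<in>{\<mu>' \<in> ?MX. push \<mu>' = push \<mu>}. shift_entropy \<mu>') = ereal (?e (push \<mu>) + ?g (push \<mu>))"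
    proof -
      obtain \<mu>1 where \<mu>1: "\<mu>1 \<in> ?MX" "push \<mu>1 = push \<mu>" "?e \<mu>1 = ?e (push \<mu>) + ?g (push \<mu>)"
        by (rule relative_maximizer[OF mY X])
      have "(SUP \<mu>'\<in>{\<mu>' \<in> ?MX. push \<mu>' = push \<mu>}. shift_entropy \<mu>') = ereal (?e \<mu>1)"
        by (rule SUP_ereal_attained[where f="?e"]) (use \<mu>1 rel eX in force)+
      then show ?thesis using \<mu>1(3) by simp
    qed
    have "\<mu> \<in> weighted_maximizers X Y \<pi> \<alpha> \<longleftrightarrow> weighted_ent \<alpha> \<mu> = s"
      using True w[OF True] sup1 by (simp add: weighted_maximizers_def)
    also have "\<dots> \<longleftrightarrow> (\<alpha> + 1) * ?e (push \<mu>) + ?g (push \<mu>) = s \<and> ?e \<mu> = ?e (push \<mu>) + ?g (push \<mu>)"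
      using s_eq[OF True] by (auto simp: weighted_ent_def algebra_simps)
    also have "(\<alpha> + 1) * ?e (push \<mu>) + ?g (push \<mu>) = s \<longleftrightarrow> equilibrium_state Y (potential X Y \<pi> \<alpha>) (push \<mu>)"
      using mY pY[OF mY] sup2 \<alpha> scale[of "push \<mu>"] by (simp add: equilibrium_state_def)
    also have "?e \<mu> = ?e (push \<mu>) + ?g (push \<mu>) \<longleftrightarrow> maximal_relative_entropy X Y \<pi> (push \<mu>) \<mu>"
      using True mY eX[OF True] relsup by (simp add: maximal_relative_entropy_def)
    finally show ?thesis .
  qed
  moreover have "ereal (\<alpha> + 1) * ereal (s / (\<alpha> + 1)) = ereal s" using \<alpha> by simp
  moreover have "weighted_entropy Y \<pi> \<alpha> \<mu>0 = ereal s" using w[OF \<mu>0(1)] by (simp add: s_def)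
  ultimately show ?thesis
    unfolding sup1 sup2 sup3 using \<mu>0(1,2) by metis
qed

end
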